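(* Let $f:(A,d,\pi_n)\to(A',d,\pi_n)$ and $g:(A',d,\pi_n)\to(A'',d,\pi_n)$ be any morphisms of $A_\infty$-algebras over $K$, with composition $gf:(A,d,\pi_n)\to(A'',d,\pi_n)$. Then $$\widetilde{gf}=\widetilde g\,\widetilde f:(T(A),d,\widetilde\partial)\to(T(A''),d,\widetilde\partial)$$ as morphisms of differential modules with $\infty$-simplicial faces, where $\widetilde f,\widetilde g,\widetilde{gf}$ are the morphisms of tensor modules induced by $f$, $g$, $gf$, and $\widetilde g\,\widetilde f$ is the composition of morphisms of differential modules with $\infty$-simplicial faces.
   Context: **Conventions.** $K$ is a commutative ring with unity; all modules and maps are $K$-modules and $K$-linear maps. Tensor products of graded maps follow the Koszul rule: $(u\otimes v)(a\otimes b)=(-1)^{\deg(v)\deg(a)}u(a)\otimes v(b)$. A differential (bigraded) module $(X,d)$ is a bigraded module $X=\{X_{n,m}\}$, $n,m\ge0$, with $d:X_{*,\bullet}\to X_{*,\bullet-1}$, $d^2=0$. For a map $u$ between differential bigraded modules of bidegree $(a,b)$, $d(u)=du-(-1)^{a+b}ud$. For a permutation, $\mathrm{sign}(\sigma)\in\{0,1\}$ denotes its parity ($0$ for even, $1$ for odd). **Permuted tuples.** For $i_1<\dots<i_k$ nonnegative integers and $\sigma\in\Sigma_k$ (symmetric group), $\sigma$ permutes the components of $(i_1,\dots,i_k)$, giving $(\sigma(i_1),\dots,\sigma(i_k))$. Put $\widehat{\sigma(i_s)}=\sigma(i_s)-\alpha(\sigma(i_s))$, where $\alpha(\sigma(i_s))$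 is the number of entries of $(\sigma(i_1),\dots,\sigma(i_k))$ to the right of $\sigma(i_s)$ that are smaller than $\sigma(i_s)$. Let $I_\sigma$ (resp. $I'_\sigma$) be the set of all partitions of $(\widehat{\sigma(i_1)},\dots,\widehat{\sigma(i_k)})$ into two tuples $(\widehat{\sigma(i_1)},\dots,\widehat{\sigma(i_m)})$ and $(\widehat{\sigma(i_{m+1})},\dots,\widehat{\sigma(i_k)})$ with $1\le m\le k-1$ (resp. $0\le m\le k$), such that both tuples are strictly increasing. **Differential module with $\infty$-simplicial faces** $(X,d,\widetilde\partial)$: a differential module $(X,d)$ with maps $\widetilde\partial=\{\partial_{(i_1,\dots,i_k)}:X_{n,\bullet}\to X_{n-k,\bullet+k-1}\}$, $1\le k\le n$, $0\le i_1<\dots<i_k\le n$, such that $$d(\partial_{(i_1,\dots,i_k)})=\sum_{\sigma\in\Sigma_k}\sum_{I_\sigma}(-1)^{\mathrm{sign}(\sigma)+1}\partial_{(\widehat{\sigma(i_1)},\dots,\widehat{\sigma(i_m)})}\partial_{(\widehat{\sigma(i_{m+1})},\dots,\widehat{\sigma(i_k)})}.$$ **Morphism** $\widetilde f:(X,d,\widetilde\partial)\to(Y,d,\widetilde\partial)$: a family of maps $f_{(i_1,\dots,i_k)}:X_{n,\bullet}\to Y_{n-k,\bullet+k}$, $0\le k\le n$, $0\le i_1<\dots<i_k\le n$ (written $f_{(\,)}$ for $k=0$), such that $d(f_{(\,)})=0$ and for $k\ge1$ $$d(f_{(i_1,\dots,i_k)})=-\partial_{(i_1,\dots,i_k)}f_{(\,)}+f_{(\,)}\partial_{(i_1,\dots,i_k)}+\sum_{\sigma\in\Sigma_k}\sum_{I_\sigma}(-1)^{\mathrm{sign}(\sigma)+1}\Big(\partial_{(\widehat{\sigma(i_1)},\dots,\widehat{\sigma(i_m)})}f_{(\widehat{\sigma(i_{m+1})},\dots,\widehat{\sigma(i_k)})}-f_{(\widehat{\sigma(i_1)},\dots,\widehat{\sigma(i_m)})}\partial_{(\widehat{\sigma(i_{m+1})},\dots,\widehat{\sigma(i_k)})}\Big).$$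 **Composition** $\widetilde g\widetilde f=\{(gf)_{(i_1,\dots,i_k)}\}$ of such morphisms: $$(gf)_{(i_1,\dots,i_k)}=\sum_{\sigma\in\Sigma_k}\sum_{I'_\sigma}(-1)^{\mathrm{sign}(\sigma)}g_{(\widehat{\sigma(i_1)},\dots,\widehat{\sigma(i_m)})}f_{(\widehat{\sigma(i_{m+1})},\dots,\widehat{\sigma(i_k)})},$$ with $(gf)_{(\,)}=g_{(\,)}f_{(\,)}$. **$A_\infty$-algebra** $(A,d,\pi_n)$: a graded module $A=\{A_n\}_{n\ge0}$ with differential $d:A_\bullet\to A_{\bullet-1}$ and maps $\pi_n:(A^{\otimes(n+2)})_\bullet\to A_{\bullet+n}$, $n\ge0$, such that for all integers $n\ge-1$ $$d(\pi_{n+1})=\sum_{m=0}^n\sum_{t=1}^{m+2}(-1)^{t(n-m+1)+n+1}\pi_m(1^{\otimes(t-1)}\otimes\pi_{n-m}\otimes1^{\otimes(m-t+2)}),\quad d(\pi_{n+1})=d\pi_{n+1}+(-1)^n\pi_{n+1}d.$$ **Morphism of $A_\infty$-algebras** $f:(A,d,\pi_n)\to(A',d,\pi_n)$: maps $f_n:(A^{\otimes(n+1)})_\bullet\to A'_{\bullet+n}$, $n\ge0$, such that for all integers $n\ge-1$ $$d(f_{n+1})=\sum_{m=0}^n\sum_{t=1}^{m+1}(-1)^{t(n-m+1)+n+1}f_m(1^{\otimes(t-1)}\otimes\pi_{n-m}\otimes1^{\otimes(m-t+1)})-\sum_{m=0}^n\sum_{J_{n-m}}(-1)^{\varepsilon}\pi_m(f_{n_1}\otimes\dots\otimes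 f_{n_{m+2}}),$$ where $d(f_{n+1})=df_{n+1}+(-1)^nf_{n+1}d$, $J_{n-m}=\{n_1,\dots,n_{m+2}\ge0\mid n_1+\dots+n_{m+2}=n-m\}$, $\varepsilon=\sum_{i=1}^{m+1}(n_i+1)(n_{i+1}+\dots+n_{m+2})$. **Composition of morphisms of $A_\infty$-algebras:** $gf=\{(gf)_n\}$ with $$(gf)_n=\sum_{m=0}^n\ \sum_{n_1,\dots,n_{m+1}\ge0,\ n_1+\dots+n_{m+1}=n-m}(-1)^{\varepsilon}g_m(f_{n_1}\otimes\dots\otimes f_{n_{m+1}}),\quad \varepsilon=\sum_{i=1}^m(n_i+1)(n_{i+1}+\dots+n_{m+1}).$$ **Tensor module of an $A_\infty$-algebra.** $T(A)_{n,m}=(A^{\otimes n})_m$, $n,m\ge0$, with $d$ the usual tensor product differential, and $\widetilde\partial=\{\partial^n_{(i_1,\dots,i_k)}:T(A)_{n,q}\to T(A)_{n-k,q+k-1}\}$ ($1\le k\le n$, $0\le i_1<\dots<i_k\le n$) given by $\partial^n_{(i_1,\dots,i_k)}=(-1)^{k(q-1)}1^{\otimes(j-1)}\otimes\pi_{k-1}\otimes1^{\otimes(n-k-j)}$ if $(i_1,\dots,i_k)=(j,j+1,\dots,j+k-1)$ with $1\le j\le n-k$, and $\partial^n_{(i_1,\dots,i_k)}=0$ otherwise. $(T(A),d,\widetilde\partial)$ is a differential module with $\infty$-simplicial faces. **Induced morphism.** For a morphism $f=\{f_n\}$ of $A_\infty$-algebras, $\widetilde f=\{f^n_{(i_1,\dots,i_k)}:T(A)_{n,q}\to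 T(A')_{n-k,q+k}\}$, $0\le k\le n$, $0\le i_1<\dots<i_k\le n$, is the morphism of differential modules with $\infty$-simplicial faces defined as follows. 1) For $k=0$: $f^n_{(\,)}=f_0^{\otimes n}$. 2) If $k\ge 1$ and $i_1=0$ or $i_k=n$: $f^n_{(i_1,\dots,i_k)}=0$. 3) Otherwise write $(i_1,\dots,i_k)=((j^1_1,\dots,j^1_{n_1}),\dots,(j^s_1,\dots,j^s_{n_s}))$ as a concatenation of maximal blocks of consecutive integers ($n_m\ge1$, $n_1+\dots+n_s=k$, $j^m_{p+1}=j^m_p+1$, $j^{m+1}_1>j^m_{n_m}+1$), put $k_1=j^1_1$, $k_i=j^i_1-j^{i-1}_{n_{i-1}}-1$ for $2\le i\le s$, $\gamma=\sum_{i=1}^{s-1}n_i(n_{i+1}+\dots+n_s)$, and $$f^n_{(i_1,\dots,i_k)}=(-1)^{k(q-1)+\gamma}f_0^{\otimes(k_1-1)}\otimes f_{n_1}\otimes f_0^{\otimes(k_2-1)}\otimes f_{n_2}\otimes\dots\otimes f_0^{\otimes(k_s-1)}\otimes f_{n_s}\otimes f_0^{\otimes(n-(k_1+\dots+k_s)-k)}.$$ *)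

theory Defs
  imports "HOL-Algebra.Module" "HOL-Algebra.AbelCoset" "HOL-Combinatorics.Permutations"
begin

section \<open>Linear maps, free modules, quotient modules\<close>

definition lin_maps ::
  "'k ring \<Rightarrow> ('k, 'a) module \<Rightarrow> ('k, 'b) module \<Rightarrow> ('a \<Rightarrow> 'b) set" where
  "lin_maps K M N = {u. u \<in> carrier M \<rightarrow> carrier N
     \<and> (\<forall>x\<in>carrier M. \<forall>y\<in>carrier M. u (x \<oplus>\<^bsub>M\<^esub> y) = u x \<oplus>\<^bsub>N\<^esub> u y)
     \<and> (\<forall>c\<in>carrier K. \<forall>x\<in>carrier M. u (c \<odot>\<^bsub>M\<^esub> x) = c \<odot>\<^bsub>N\<^esub> u x)}"

text \<open>\<open>signed M e x\<close> is $(-1)^e x$ in the module \<open>M\<close>.\<close>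

definition signed :: "('k, 'a) module \<Rightarrow> int \<Rightarrow> 'a \<Rightarrow> 'a" where
  "signed M e x = (if even e then x else \<ominus>\<^bsub>M\<^esub> x)"

text \<open>The multiplicative fields \<open>mult\<close> and \<open>one\<close> of a module record carry no meaning.\<close>

definition free_module :: "'k ring \<Rightarrow> 'w set \<Rightarrow> ('k, 'w \<Rightarrow> 'k) module" where
  "free_module K W =
    \<lparr>carrier = {x. (\<forall>w. x w \<in> carrier K) \<and> (\<forall>w. w \<notin> W \<longrightarrow> x w = \<zero>\<^bsub>K\<^esub>)
                    \<and> finite {w. x w \<noteq> \<zero>\<^bsub>K\<^esub>}},
     monoid.mult = undefined, one = undefined,
     zero = (\<lambda>w. \<zero>\<^bsub>K\<^esub>), add = (\<lambda>x y w. x w \<oplus>\<^bsub>K\<^esub> y w),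
     smult = (\<lambda>c x w. c \<otimes>\<^bsub>K\<^esub> x w)\<rparr>"

definition basis_vec :: "'k ring \<Rightarrow> 'w \<Rightarrow> 'w \<Rightarrow> 'k" where
  "basis_vec K w = (\<lambda>v. if v = w then \<one>\<^bsub>K\<^esub> else \<zero>\<^bsub>K\<^esub>)"

definition submodule_span :: "'k ring \<Rightarrow> ('k, 'a) module \<Rightarrow> 'a set \<Rightarrow> 'a set" where
  "submodule_span K M S = \<Inter>{H. submodule H K M \<and> S \<subseteq> H}"

definition quot_module :: "('k, 'a) module \<Rightarrow> 'a set \<Rightarrow> ('k, 'a set) module" where
  "quot_module M H =
    \<lparr>carrier = a_rcosets\<^bsub>M\<^esub> H,
     monoid.mult = undefined, one = undefined,
     zero = H, add = (\<lambda>X Y. X <+>\<^bsub>M\<^esub> Y),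
     smult = (\<lambda>c X. \<Union>x\<in>X. H +>\<^bsub>M\<^esub> (c \<odot>\<^bsub>M\<^esub> x))\<rparr>"

section \<open>Graded modules and their tensor powers\<close>

text \<open>
  Degrees are integers, and a graded module $\{A_n\}_{n\ge 0}$ is extended by $A_n = 0$ for
  $n < 0$; so a map of degree $-1$ vanishes on $A_0$.
\<close>

type_synonym ('k, 'a) graded = "int \<Rightarrow> ('k, 'a) module"

definition graded_module :: "'k ring \<Rightarrow> ('k, 'a) graded \<Rightarrow> bool" where
  "graded_module K A \<longleftrightarrow>
     (\<forall>n. module K (A n)) \<and> (\<forall>n<0. carrier (A n) = {\<zero>\<^bsub>A n\<^esub>})"

text \<open>
  A word $(p_1,a_1)\dots(p_n,a_n)$ with $a_i \in A_{p_i}$ stands for the pure tensor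
  $a_1\otimes\dots\otimes a_n$. The component $(A^{\otimes n})_m$, that is
  $\bigoplus_{p_1+\dots+p_n=m} A_{p_1}\otimes\dots\otimes A_{p_n}$, is the free module on the words
  of length $n$ and total degree $m$ modulo linearity in every letter. In particular
  $A^{\otimes 0}$ is $K$ in degree $0$.
\<close>

type_synonym 'a word = "(int \<times> 'a) list"
type_synonym ('k, 'a) tensor = "('a word \<Rightarrow> 'k) set"

definition wdeg :: "'a word \<Rightarrow> int" where
  "wdeg w = sum_list (map fst w)"

definition words :: "('k, 'a) graded \<Rightarrow> nat \<Rightarrow> int \<Rightarrow> 'a word set" where
  "words A n m = {w. length w = n \<and> wdeg w = m \<and> (\<forall>(p, a)\<in>set w. a \<in> carrier (A p))}"

definition word_module ::
  "'k ring \<Rightarrow> ('k, 'a) graded \<Rightarrow> nat \<Rightarrow> int \<Rightarrow> ('k, 'a word \<Rightarrow> 'k) module" where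
  "word_module K A n m = free_module K (words A n m)"

definition tensor_gens ::
  "'k ring \<Rightarrow> ('k, 'a) graded \<Rightarrow> nat \<Rightarrow> int \<Rightarrow> ('a word \<Rightarrow> 'k) set" where
  "tensor_gens K A n m =
     {basis_vec K (u @ (p, a \<oplus>\<^bsub>A p\<^esub> b) # v)
        \<ominus>\<^bsub>word_module K A n m\<^esub> (basis_vec K (u @ (p, a) # v)
            \<oplus>\<^bsub>word_module K A n m\<^esub> basis_vec K (u @ (p, b) # v))
      | u v p a b. u @ (p, a) # v \<in> words A n m \<and> b \<in> carrier (A p)}
   \<union> {basis_vec K (u @ (p, c \<odot>\<^bsub>A p\<^esub> a) # v)
        \<ominus>\<^bsub>word_module K A n m\<^esub> (c \<odot>\<^bsub>word_module K A n m\<^esub> basis_vec K (u @ (p, a) # v))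
      | u v p a c. u @ (p, a) # v \<in> words A n m \<and> c \<in> carrier K}"

definition tensor_rels ::
  "'k ring \<Rightarrow> ('k, 'a) graded \<Rightarrow> nat \<Rightarrow> int \<Rightarrow> ('a word \<Rightarrow> 'k) set" where
  "tensor_rels K A n m = submodule_span K (word_module K A n m) (tensor_gens K A n m)"

text \<open>\<open>tensor_power K A n m\<close> is $(A^{\otimes n})_m = T(A)_{n,m}$.\<close>

definition tensor_power ::
  "'k ring \<Rightarrow> ('k, 'a) graded \<Rightarrow> nat \<Rightarrow> int \<Rightarrow> ('k, ('k, 'a) tensor) module" where
  "tensor_power K A n m = quot_module (word_module K A n m) (tensor_rels K A n m)"

definition pure_tensor :: "'k ring \<Rightarrow> ('k, 'a) graded \<Rightarrow> 'a word \<Rightarrow> ('k, 'a) tensor" where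
  "pure_tensor K A w =
     tensor_rels K A (length w) (wdeg w) +>\<^bsub>word_module K A (length w) (wdeg w)\<^esub> basis_vec K w"

text \<open>
  The linear map on a tensor power with prescribed values \<open>\<phi> w\<close> on pure tensors; for \<open>\<phi>\<close>
  linear in every letter, the value does not depend on the representative \<open>x\<close> of \<open>X\<close>.
\<close>

definition tensor_lift ::
  "'k ring \<Rightarrow> ('k, 'b) module \<Rightarrow> ('a word \<Rightarrow> 'b) \<Rightarrow> ('k, 'a) tensor \<Rightarrow> 'b" where
  "tensor_lift K N \<phi> X =
     the_elem ((\<lambda>x. \<Oplus>\<^bsub>N\<^esub>w\<in>{w. x w \<noteq> \<zero>\<^bsub>K\<^esub>}. x w \<odot>\<^bsub>N\<^esub> \<phi> w) ` X)"

section \<open>Tensor products of homogeneous maps\<close>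

text \<open>
  A factor \<open>(r, e, u)\<close> is a map $u : A^{\otimes r}\to B$ of degree $e$, where \<open>u p\<close> is its
  component $(A^{\otimes r})_p\to B_{p+e}$.
\<close>

type_synonym ('k, 'a, 'b) factor = "nat \<times> int \<times> (int \<Rightarrow> ('k, 'a) tensor \<Rightarrow> 'b)"

fun tensor_word ::
  "'k ring \<Rightarrow> ('k, 'a) graded \<Rightarrow> ('k, 'a, 'b) factor list \<Rightarrow> 'a word \<Rightarrow> 'b word" where
  "tensor_word K A [] w = []"
| "tensor_word K A ((r, e, u) # us) w =
     (wdeg (take r w) + e, u (wdeg (take r w)) (pure_tensor K A (take r w)))
       # tensor_word K A us (drop r w)"

text \<open>
  The Koszul sign: $(u\otimes v)(a\otimes b) = (-1)^{\deg v\cdot\deg a}u(a)\otimes v(b)$, where $v$ is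
  the tensor product of the remaining factors.
\<close>

fun koszul :: "('k, 'a, 'b) factor list \<Rightarrow> 'a word \<Rightarrow> int" where
  "koszul [] w = 0"
| "koszul ((r, e, u) # us) w =
     sum_list (map (\<lambda>(r, e, u). e) us) * wdeg (take r w) + koszul us (drop r w)"

definition tensor_map ::
  "'k ring \<Rightarrow> ('k, 'a) graded \<Rightarrow> ('k, 'b) graded \<Rightarrow> ('k, 'a, 'b) factor list
    \<Rightarrow> int \<Rightarrow> ('k, 'a) tensor \<Rightarrow> ('k, 'b) tensor" where
  "tensor_map K A B us q =
     (let N = tensor_power K B (length us) (q + sum_list (map (\<lambda>(r, e, u). e) us))
      in tensor_lift K N
           (\<lambda>w. signed N (koszul us w) (pure_tensor K B (tensor_word K A us w))))"

text \<open>The canonical isomorphism $(A^{\otimes 1})_p \to A_p$.\<close>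

definition tensor_one :: "'k ring \<Rightarrow> ('k, 'a) graded \<Rightarrow> int \<Rightarrow> ('k, 'a) tensor \<Rightarrow> 'a" where
  "tensor_one K A p = tensor_lift K (A p) (\<lambda>w. snd (hd w))"

definition id_factor :: "'k ring \<Rightarrow> ('k, 'a) graded \<Rightarrow> ('k, 'a, 'a) factor" where
  "id_factor K A = (1, 0, tensor_one K A)"

definition diff_factor ::
  "'k ring \<Rightarrow> ('k, 'a) graded \<Rightarrow> (int \<Rightarrow> 'a \<Rightarrow> 'a) \<Rightarrow> ('k, 'a, 'a) factor" where
  "diff_factor K A d = (1, -1, \<lambda>p X. d p (tensor_one K A p X))"

text \<open>The differential $\sum_i 1^{\otimes i}\otimes d\otimes 1^{\otimes(n-1-i)}$ of $A^{\otimes n}$.\<close>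

definition tensor_diff ::
  "'k ring \<Rightarrow> ('k, 'a) graded \<Rightarrow> (int \<Rightarrow> 'a \<Rightarrow> 'a) \<Rightarrow> nat \<Rightarrow> int
    \<Rightarrow> ('k, 'a) tensor \<Rightarrow> ('k, 'a) tensor" where
  "tensor_diff K A d n q X =
     (\<Oplus>\<^bsub>tensor_power K A n (q - 1)\<^esub>i\<in>{..<n}.
        tensor_map K A A
          (replicate i (id_factor K A) @ [diff_factor K A d] @ replicate (n - 1 - i) (id_factor K A))
          q X)"

section \<open>\<open>A\<^sub>\<infinity>\<close>-algebras and their morphisms\<close>

definition diff_graded_module ::
  "'k ring \<Rightarrow> ('k, 'a) graded \<Rightarrow> (int \<Rightarrow> 'a \<Rightarrow> 'a) \<Rightarrow> bool" where
  "diff_graded_module K A d \<longleftrightarrow> graded_module K A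
     \<and> (\<forall>n. d n \<in> lin_maps K (A n) (A (n - 1)))
     \<and> (\<forall>n. \<forall>x\<in>carrier (A n). d (n - 1) (d n x) = \<zero>\<^bsub>A (n - 2)\<^esub>)"

text \<open>
  The operations $\pi_n : (A^{\otimes(n+2)})_\bullet \to A_{\bullet+n}$ and the components
  $f_n : (A^{\otimes(n+1)})_\bullet \to A'_{\bullet+n}$ of a morphism.
\<close>

type_synonym ('k, 'a, 'b) maps = "nat \<Rightarrow> int \<Rightarrow> ('k, 'a) tensor \<Rightarrow> 'b"

definition op_factor :: "('k, 'a, 'a) maps \<Rightarrow> nat \<Rightarrow> ('k, 'a, 'a) factor" where
  "op_factor \<pi> n = (n + 2, int n, \<pi> n)"

definition mor_factor :: "('k, 'a, 'b) maps \<Rightarrow> nat \<Rightarrow> ('k, 'a, 'b) factor" where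
  "mor_factor f n = (n + 1, int n, f n)"

text \<open>$1^{\otimes a}\otimes\pi_n\otimes 1^{\otimes b}$\<close>

definition op_at ::
  "'k ring \<Rightarrow> ('k, 'a) graded \<Rightarrow> ('k, 'a, 'a) maps \<Rightarrow> nat \<Rightarrow> nat \<Rightarrow> nat \<Rightarrow> int
    \<Rightarrow> ('k, 'a) tensor \<Rightarrow> ('k, 'a) tensor" where
  "op_at K A \<pi> a n b =
     tensor_map K A A (replicate a (id_factor K A) @ [op_factor \<pi> n] @ replicate b (id_factor K A))"

text \<open>
  In the next two definitions the structure relations, usually indexed by $n \ge -1$, are indexed
  by $N = n + 1$. With this $d(\pi_N) = d\pi_N + (-1)^{N-1}\pi_N d$, and $t(n-m+1)+n+1$ reads
  $t(N-m)+N$.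
\<close>

definition ainf_algebra ::
  "'k ring \<Rightarrow> ('k, 'a) graded \<Rightarrow> (int \<Rightarrow> 'a \<Rightarrow> 'a) \<Rightarrow> ('k, 'a, 'a) maps \<Rightarrow> bool" where
  "ainf_algebra K A d \<pi> \<longleftrightarrow> diff_graded_module K A d
     \<and> (\<forall>n q. \<pi> n q \<in> lin_maps K (tensor_power K A (n + 2) q) (A (q + int n)))
     \<and> (\<forall>N q. \<forall>X\<in>carrier (tensor_power K A (N + 2) q).
          let M = A (q + int N - 1) in
          d (q + int N) (\<pi> N q X)
            \<oplus>\<^bsub>M\<^esub> signed M (int N - 1) (\<pi> N (q - 1) (tensor_diff K A d (N + 2) q X))
          = (\<Oplus>\<^bsub>M\<^esub>m\<in>{..<N}. \<Oplus>\<^bsub>M\<^esub>t\<in>{1..m + 2}.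
               signed M (int t * (int N - int m) + int N)
                 (\<pi> m (q + int (N - 1 - m))
                   (op_at K A \<pi> (t - 1) (N - 1 - m) (m + 2 - t) q X))))"

definition compositions :: "nat \<Rightarrow> nat \<Rightarrow> nat list set" where
  "compositions r s = {ns. length ns = r \<and> sum_list ns = s}"

text \<open>$\varepsilon = \sum_{i=1}^{r-1}(n_i+1)(n_{i+1}+\dots+n_r)$\<close>

definition ainf_eps :: "nat list \<Rightarrow> int" where
  "ainf_eps ns = (\<Sum>i<length ns - 1. int ((ns ! i + 1) * sum_list (drop (i + 1) ns)))"

definition ainf_morphism ::
  "'k ring \<Rightarrow> ('k, 'a) graded \<Rightarrow> (int \<Rightarrow> 'a \<Rightarrow> 'a) \<Rightarrow> ('k, 'a, 'a) maps
    \<Rightarrow> ('k, 'b) graded \<Rightarrow> (int \<Rightarrow> 'b \<Rightarrow> 'b) \<Rightarrow> ('k, 'b, 'b) maps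
    \<Rightarrow> ('k, 'a, 'b) maps \<Rightarrow> bool" where
  "ainf_morphism K A d \<pi> A' d' \<pi>' f \<longleftrightarrow>
       (\<forall>n q. f n q \<in> lin_maps K (tensor_power K A (n + 1) q) (A' (q + int n)))
     \<and> (\<forall>N q. \<forall>X\<in>carrier (tensor_power K A (N + 1) q).
          let M = A' (q + int N - 1) in
          d' (q + int N) (f N q X)
            \<oplus>\<^bsub>M\<^esub> signed M (int N - 1) (f N (q - 1) (tensor_diff K A d (N + 1) q X))
          = (\<Oplus>\<^bsub>M\<^esub>m\<in>{..<N}. \<Oplus>\<^bsub>M\<^esub>t\<in>{1..m + 1}.
               signed M (int t * (int N - int m) + int N)
                 (f m (q + int (N - 1 - m))
                   (op_at K A \<pi> (t - 1) (N - 1 - m) (m + 1 - t) q X)))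
            \<ominus>\<^bsub>M\<^esub>
            (\<Oplus>\<^bsub>M\<^esub>m\<in>{..<N}. \<Oplus>\<^bsub>M\<^esub>ns\<in>compositions (m + 2) (N - 1 - m).
               signed M (ainf_eps ns)
                 (\<pi>' m (q + int (N - 1 - m))
                   (tensor_map K A A' (map (mor_factor f) ns) q X))))"

text \<open>The composition $gf$ of $f : A\to A'$ and $g : A'\to A''$.\<close>

definition ainf_comp ::
  "'k ring \<Rightarrow> ('k, 'a) graded \<Rightarrow> ('k, 'b) graded \<Rightarrow> ('k, 'c) graded
    \<Rightarrow> ('k, 'b, 'c) maps \<Rightarrow> ('k, 'a, 'b) maps \<Rightarrow> ('k, 'a, 'c) maps" where
  "ainf_comp K A A' A'' g f n q X =
     (\<Oplus>\<^bsub>A'' (q + int n)\<^esub>m\<in>{..n}. \<Oplus>\<^bsub>A'' (q + int n)\<^esub>ns\<in>compositions (m + 1) (n - m).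
        signed (A'' (q + int n)) (ainf_eps ns)
          (g m (q + int (n - m)) (tensor_map K A A' (map (mor_factor f) ns) q X)))"

section \<open>Families indexed by increasing tuples and their composition\<close>

text \<open>
  For a family \<open>F\<close> of maps between bigraded modules, \<open>F n q I\<close> is the component
  $f_{(i_1,\dots,i_k)} : X_{n,q}\to Y_{n-k,q+k}$ with $I = (i_1,\dots,i_k)$.
\<close>

type_synonym ('x, 'y) family = "nat \<Rightarrow> int \<Rightarrow> nat list \<Rightarrow> 'x \<Rightarrow> 'y"

definition index_tuple :: "nat \<Rightarrow> nat list \<Rightarrow> bool" where
  "index_tuple n I \<longleftrightarrow> length I \<le> n \<and> sorted_wrt (<) I \<and> (\<forall>i\<in>set I. i \<le> n)"

text \<open>
  Each entry is lowered by the number of smaller entries to its right. For distinct entries this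
  number is at most the entry, so the subtraction is not truncated.
\<close>

definition hat :: "nat list \<Rightarrow> nat list" where
  "hat J = map (\<lambda>s. J ! s - card {r. s < r \<and> r < length J \<and> J ! r < J ! s}) [0..<length J]"

text \<open>The cut points \<open>m\<close> encoding the set of partitions $I'_\sigma$, of a tuple \<open>J\<close> of hatted entries.\<close>

definition cuts :: "nat list \<Rightarrow> nat set" where
  "cuts J = {m. m \<le> length J \<and> sorted_wrt (<) (take m J) \<and> sorted_wrt (<) (drop m J)}"

definition family_comp ::
  "(nat \<Rightarrow> int \<Rightarrow> ('k, 'z) module) \<Rightarrow> ('y, 'z) family \<Rightarrow> ('x, 'y) family \<Rightarrow> ('x, 'z) family" where
  "family_comp Z G F n q I x =
     (let k = length I; M = Z (n - k) (q + int k) in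
      \<Oplus>\<^bsub>M\<^esub>\<sigma>\<in>{\<sigma>. \<sigma> permutes {..<k}}.
        let J = hat (permute_list \<sigma> I) in
        \<Oplus>\<^bsub>M\<^esub>m\<in>cuts J.
          signed M (if evenperm \<sigma> then 0 else 1)
            (G (n - (k - m)) (q + int (k - m)) (take m J) (F n q (drop m J) x)))"

section \<open>The family induced by a morphism of \<open>A\<^sub>\<infinity>\<close>-algebras\<close>

text \<open>The maximal blocks of consecutive integers of an increasing tuple.\<close>

fun blocks :: "nat list \<Rightarrow> nat list list" where
  "blocks [] = []"
| "blocks (i # I) =
     (case blocks I of
        [] \<Rightarrow> [[i]]
      | b # bs \<Rightarrow> if hd b = Suc i then (i # b) # bs else [i] # b # bs)"

text \<open>The numbers $k_1,\dots,k_s$.\<close>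

definition gaps :: "nat list list \<Rightarrow> nat list" where
  "gaps bs = map (\<lambda>i. if i = 0 then hd (bs ! 0) else hd (bs ! i) - last (bs ! (i - 1)) - 1)
                 [0..<length bs]"

text \<open>
  The indices of the successive factors of
  $f_0^{\otimes(k_1-1)}\otimes f_{n_1}\otimes\dots\otimes f_0^{\otimes(k_s-1)}\otimes f_{n_s}\otimes
   f_0^{\otimes(n-(k_1+\dots+k_s)-k)}$.
\<close>

definition induced_indices :: "nat \<Rightarrow> nat list \<Rightarrow> nat list" where
  "induced_indices n I =
     concat (map2 (\<lambda>k b. replicate (k - 1) 0 @ [length b]) (gaps (blocks I)) (blocks I))
     @ replicate (n - sum_list (gaps (blocks I)) - length I) 0"

text \<open>$\gamma = \sum_{i=1}^{s-1}n_i(n_{i+1}+\dots+n_s)$\<close>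

definition induced_gamma :: "nat list \<Rightarrow> int" where
  "induced_gamma I =
     (let ns = map length (blocks I)
      in \<Sum>i<length ns - 1. int (ns ! i * sum_list (drop (i + 1) ns)))"

definition induced ::
  "'k ring \<Rightarrow> ('k, 'a) graded \<Rightarrow> ('k, 'b) graded \<Rightarrow> ('k, 'a, 'b) maps
    \<Rightarrow> (('k, 'a) tensor, ('k, 'b) tensor) family" where
  "induced K A B f n q I X =
     (let k = length I; M = tensor_power K B (n - k) (q + int k) in
      if I = [] then tensor_map K A B (replicate n (mor_factor f 0)) q X
      else if hd I = 0 \<or> last I = n then \<zero>\<^bsub>M\<^esub>
      else signed M (int k * (q - 1) + induced_gamma I)
             (tensor_map K A B (map (mor_factor f) (induced_indices n I)) q X))"

end

theory Submission
  imports Defs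
begin

text \<open>
  Both sides are linear, so they are compared on pure tensors. A permutation of
  $(i_1,\dots,i_k)$ together with a cut contributes to $\widetilde g\,\widetilde f$ exactly when
  both parts are increasing before the hats are applied, so the sum runs over the subsets $T$ of
  $I = \{i_1,\dots,i_k\}$: $T$ indexes $\widetilde f$ and $I \setminus T$, with hats, indexes
  $\widetilde g$. If $0$ or $n$ lies in $I$, every term vanishes. Otherwise $i \in I$ says that the
  tensor positions $i$ and $i+1$ belong to the same factor, so $I$ is a composition of $n$, the
  subsets $T \subseteq I$ are its refinements, and these are also what expanding each factor
  $(gf)_N$ by multilinearity produces. The signs agree because the number of inversions of the
  shuffle plus $|I \setminus T|\,|T|$ has the parity of the number of pairs $s < t$ with
  $s \in I \setminus T$ and $t \in T$.
\<close>

section \<open>Linear maps\<close>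

text \<open>A tuple does not show the factors \<open>f_0\<close>, and lowering its entries moves
  them all, so the argument is carried out on compositions: an entry \<open>n\<close> stands for a
  factor with \<open>n + 1\<close> inputs. A refinement is then a list of lists. Its concatenation
  is the composition for the maps of \<open>f\<close>, and the lengths minus one form the
  composition for the maps of \<open>g\<close>, with the lowering already accounted for. The term |I
  - T| |T| in the sign comes from the normalisation (-1)^{k(q-1)}: the maps of \<open>g\<close> are
  applied after those of \<open>f\<close> have raised the degree from q to q + |T|. The pairs s < t
  are of two kinds. Those inside one factor of I give the excess of the exponent epsilon in the
  composition of A-infinity morphisms over the quadratic exponent gamma. Those in different factors,
  together with the Koszul signs of later maps of \<open>g\<close> passing earlier maps of
  \<open>f\<close>, are the mixed terms in the exponent gamma of I.\<close>

lemma lin_mapsI: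
  assumes "\<And>x. x \<in> carrier M \<Longrightarrow> u x \<in> carrier N"
    and "\<And>x y. \<lbrakk>x \<in> carrier M; y \<in> carrier M\<rbrakk> \<Longrightarrow> u (x \<oplus>\<^bsub>M\<^esub> y) = u x \<oplus>\<^bsub>N\<^esub> u y"
    and "\<And>c x. \<lbrakk>c \<in> carrier K; x \<in> carrier M\<rbrakk> \<Longrightarrow> u (c \<odot>\<^bsub>M\<^esub> x) = c \<odot>\<^bsub>N\<^esub> u x"
  shows "u \<in> lin_maps K M N"
  using assms by (auto simp: lin_maps_def)

lemma lin_maps_closed: "\<lbrakk>u \<in> lin_maps K M N; x \<in> carrier M\<rbrakk> \<Longrightarrow> u x \<in> carrier N"
  and lin_maps_add: "\<lbrakk>u \<in> lin_maps K M N; x \<in> carrier M; y \<in> carrier M\<rbrakk>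
    \<Longrightarrow> u (x \<oplus>\<^bsub>M\<^esub> y) = u x \<oplus>\<^bsub>N\<^esub> u y"
  and lin_maps_smult: "\<lbrakk>u \<in> lin_maps K M N; c \<in> carrier K; x \<in> carrier M\<rbrakk>
    \<Longrightarrow> u (c \<odot>\<^bsub>M\<^esub> x) = c \<odot>\<^bsub>N\<^esub> u x"
  by (auto simp: lin_maps_def)

lemma lin_maps_comp:
  "\<lbrakk>u \<in> lin_maps K M N; v \<in> lin_maps K N P\<rbrakk> \<Longrightarrow> (\<lambda>x. v (u x)) \<in> lin_maps K M P"
  by (auto simp: lin_maps_def Pi_iff)

lemma module_abelian_group: "module K M \<Longrightarrow> abelian_group M"
  and module_abelian_monoid: "module K M \<Longrightarrow> abelian_monoid M"
  and module_cring: "module K M \<Longrightarrow> cring K"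
  by (auto simp: module_def abelian_group_def)

text \<open>Homogeneity under the scalar 0 gives this without cancelling in \<open>N\<close>;
  \<open>lin_maps_minus\<close> uses the scalar -1 in the same way.\<close>

lemma lin_maps_zero:
  assumes "u \<in> lin_maps K M N" "module K M" "module K N"
  shows "u \<zero>\<^bsub>M\<^esub> = \<zero>\<^bsub>N\<^esub>"
proof -
  interpret M: module K M by fact
  interpret N: module K N by fact
  have "u \<zero>\<^bsub>M\<^esub> = u (\<zero>\<^bsub>K\<^esub> \<odot>\<^bsub>M\<^esub> \<zero>\<^bsub>M\<^esub>)" by simp
  also have "\<dots> = \<zero>\<^bsub>K\<^esub> \<odot>\<^bsub>N\<^esub> u \<zero>\<^bsub>M\<^esub>" using assms(1) by (intro lin_maps_smult) auto
  also have "\<dots> = \<zero>\<^bsub>N\<^esub>" using lin_maps_closed[OF assms(1)] by simp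
  finally show ?thesis .
qed

lemma lin_maps_minus:
  assumes "u \<in> lin_maps K M N" "module K M" "module K N" "x \<in> carrier M"
  shows "u (\<ominus>\<^bsub>M\<^esub> x) = \<ominus>\<^bsub>N\<^esub> u x"
proof -
  interpret M: module K M by fact
  interpret N: module K N by fact
  have "\<ominus>\<^bsub>M\<^esub> x = (\<ominus>\<^bsub>K\<^esub> \<one>\<^bsub>K\<^esub>) \<odot>\<^bsub>M\<^esub> x"
    using assms(4) by (simp add: M.smult_l_minus)
  then have "u (\<ominus>\<^bsub>M\<^esub> x) = (\<ominus>\<^bsub>K\<^esub> \<one>\<^bsub>K\<^esub>) \<odot>\<^bsub>N\<^esub> u x"
    using assms by (simp add: lin_maps_smult)
  then show ?thesis using lin_maps_closed[OF assms(1,4)] by (simp add: N.smult_l_minus)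
qed

lemma lin_maps_finsum:
  assumes "u \<in> lin_maps K M N" "module K M" "module K N" "h \<in> S \<rightarrow> carrier M"
  shows "u (\<Oplus>\<^bsub>M\<^esub>s\<in>S. h s) = (\<Oplus>\<^bsub>N\<^esub>s\<in>S. u (h s))"
proof -
  interpret M: module K M by fact
  interpret N: module K N by fact
  show ?thesis using assms(4)
  proof (induction S rule: infinite_finite_induct)
    case (insert s S)
    then have "(\<lambda>s. u (h s)) \<in> S \<rightarrow> carrier N" "h \<in> S \<rightarrow> carrier M" "u (h s) \<in> carrier N" "h s \<in> carrier M"
      using lin_maps_closed[OF assms(1)] by (auto simp: Pi_iff)
    with insert assms(1) show ?case
      by (simp add: lin_maps_add M.finsum_closed)
  qed (use assms in \<open>auto simp: lin_maps_zero\<close>)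
qed

subsection \<open>Signs\<close>

lemma signed_closed: "\<lbrakk>module K M; x \<in> carrier M\<rbrakk> \<Longrightarrow> signed M e x \<in> carrier M"
  by (simp add: signed_def abelian_group.a_inv_closed[OF module_abelian_group])

lemma signed_signed:
  "\<lbrakk>module K M; x \<in> carrier M\<rbrakk> \<Longrightarrow> signed M e (signed M e' x) = signed M (e + e') x"
  by (simp add: signed_def abelian_group.a_inv_closed[OF module_abelian_group]
      abelian_group.minus_minus[OF module_abelian_group])

lemma signed_cong: "even (e - e') \<Longrightarrow> signed M e x = signed M e' x"
  by (auto simp: signed_def)

lemma signed_0: "signed M 0 x = x"
  by (simp add: signed_def)

lemma signed_lin_maps:
  assumes "module K M"
  shows "signed M e \<in> lin_maps K M M"
proof -
  interpret module K M by fact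
  show ?thesis
    by (rule lin_mapsI) (auto simp: signed_def M.minus_add smult_r_minus)
qed

lemma signed_zero:
  fixes K :: "'k ring"
  assumes "module K M"
  shows "signed M e \<zero>\<^bsub>M\<^esub> = \<zero>\<^bsub>M\<^esub>"
  by (rule lin_maps_zero[OF signed_lin_maps[OF assms] assms assms])

lemma signed_finsum:
  fixes K :: "'k ring"
  assumes "module K M" "h \<in> S \<rightarrow> carrier M"
  shows "signed M e (\<Oplus>\<^bsub>M\<^esub>s\<in>S. h s) = (\<Oplus>\<^bsub>M\<^esub>s\<in>S. signed M e (h s))"
  by (rule lin_maps_finsum[OF signed_lin_maps[OF assms(1)] assms(1) assms(1) assms(2)])

lemma lin_maps_signed:
  "\<lbrakk>u \<in> lin_maps K M N; module K M; module K N; x \<in> carrier M\<rbrakk>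
    \<Longrightarrow> u (signed M e x) = signed N e (u x)"
  by (simp add: signed_def lin_maps_minus)

section \<open>Finite sums\<close>

lemma (in abelian_monoid) finsum_Sigma:
  assumes "finite S" "\<And>s. s \<in> S \<Longrightarrow> finite (T s)"
    and "\<And>s t. \<lbrakk>s \<in> S; t \<in> T s\<rbrakk> \<Longrightarrow> h s t \<in> carrier G"
  shows "(\<Oplus>s\<in>S. \<Oplus>t\<in>T s. h s t) = (\<Oplus>p\<in>Sigma S T. h (fst p) (snd p))"
  using assms
proof (induction S rule: finite_induct)
  case (insert s S)
  have eq: "Sigma (insert s S) T = Pair s ` T s \<union> Sigma S T" by auto
  have "(\<Oplus>p\<in>Sigma (insert s S) T. h (fst p) (snd p))
      = (\<Oplus>p\<in>Pair s ` T s. h (fst p) (snd p)) \<oplus> (\<Oplus>p\<in>Sigma S T. h (fst p) (snd p))"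
    unfolding eq using insert by (intro finsum_Un_disjoint) auto
  also have "(\<Oplus>p\<in>Pair s ` T s. h (fst p) (snd p)) = (\<Oplus>t\<in>T s. h s t)"
    using insert by (subst finsum_reindex) (auto simp: inj_on_def)
  also have "(\<Oplus>p\<in>Sigma S T. h (fst p) (snd p)) = (\<Oplus>s\<in>S. \<Oplus>t\<in>T s. h s t)"
    using insert by auto
  finally show ?case
    using insert by (simp add: Pi_iff finsum_closed)
qed simp

lemma (in abelian_monoid) finsum_reindex_bij:
  assumes "bij_betw p S T" "\<And>t. t \<in> T \<Longrightarrow> h t \<in> carrier G"
  shows "(\<Oplus>t\<in>T. h t) = (\<Oplus>s\<in>S. h (p s))"
proof -
  have "(\<Oplus>t\<in>p ` S. h t) = (\<Oplus>s\<in>S. h (p s))"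
    using assms by (intro finsum_reindex) (auto simp: bij_betw_def)
  then show ?thesis using assms(1) by (simp add: bij_betw_def)
qed

lemma finsum_cong_mod:
  assumes "module K M" "S = T" "\<And>s. s \<in> T \<Longrightarrow> h s \<in> carrier M" "\<And>s. s \<in> T \<Longrightarrow> g s = h s"
  shows "(\<Oplus>\<^bsub>M\<^esub>s\<in>S. g s) = (\<Oplus>\<^bsub>M\<^esub>s\<in>T. h s)"
  using assms by (intro abelian_monoid.finsum_cong'[OF module_abelian_monoid]) auto

section \<open>Free modules and quotient modules\<close>

lemma free_module_simps:
  "x \<in> carrier (free_module K W) \<longleftrightarrow> (\<forall>w. x w \<in> carrier K) \<and> (\<forall>w. w \<notin> W \<longrightarrow> x w = \<zero>\<^bsub>K\<^esub>)
     \<and> finite {w. x w \<noteq> \<zero>\<^bsub>K\<^esub>}"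
  "\<zero>\<^bsub>free_module K W\<^esub> = (\<lambda>w. \<zero>\<^bsub>K\<^esub>)"
  "x \<oplus>\<^bsub>free_module K W\<^esub> y = (\<lambda>w. x w \<oplus>\<^bsub>K\<^esub> y w)"
  "c \<odot>\<^bsub>free_module K W\<^esub> x = (\<lambda>w. c \<otimes>\<^bsub>K\<^esub> x w)"
  by (auto simp: free_module_def)

lemma module_free_module:
  assumes "cring K"
  shows "module K (free_module K W)"
proof -
  interpret cring K by fact
  let ?F = "free_module K W"
  have fin: "finite {w. z w \<noteq> \<zero>\<^bsub>K\<^esub>}"
    if "finite {w. x w \<noteq> \<zero>\<^bsub>K\<^esub>}" "finite {w. y w \<noteq> \<zero>\<^bsub>K\<^esub>}"
      "\<And>w. \<lbrakk>x w = \<zero>\<^bsub>K\<^esub>; y w = \<zero>\<^bsub>K\<^esub>\<rbrakk> \<Longrightarrow> z w = \<zero>\<^bsub>K\<^esub>" for x y z :: "'b \<Rightarrow> 'a"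
    by (rule finite_subset[OF _ finite_UnI[OF that(1,2)]]) (use that(3) in auto)
  show ?thesis
  proof (rule moduleI)
    show "abelian_group ?F"
    proof (rule abelian_groupI)
      show "\<exists>y\<in>carrier ?F. y \<oplus>\<^bsub>?F\<^esub> x = \<zero>\<^bsub>?F\<^esub>" if "x \<in> carrier ?F" for x
      proof
        show "(\<lambda>w. \<ominus>\<^bsub>K\<^esub> x w) \<in> carrier ?F"
          using that fin[of x x "\<lambda>w. \<ominus>\<^bsub>K\<^esub> x w"] by (auto simp: free_module_simps)
        show "(\<lambda>w. \<ominus>\<^bsub>K\<^esub> x w) \<oplus>\<^bsub>?F\<^esub> x = \<zero>\<^bsub>?F\<^esub>"
          using that by (auto simp: free_module_simps l_neg)
      qed
      show "x \<oplus>\<^bsub>?F\<^esub> y \<in> carrier ?F" if "x \<in> carrier ?F" "y \<in> carrier ?F" for x y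
        using that fin[of x y "\<lambda>w. x w \<oplus>\<^bsub>K\<^esub> y w"] by (auto simp: free_module_simps)
    qed (auto simp: free_module_simps a_ac)
    show "c \<odot>\<^bsub>?F\<^esub> x \<in> carrier ?F" if "c \<in> carrier K" "x \<in> carrier ?F" for c x
      using that fin[of x x "\<lambda>w. c \<otimes>\<^bsub>K\<^esub> x w"] by (auto simp: free_module_simps)
  qed (auto simp: free_module_simps l_distr r_distr m_assoc intro: is_cring)
qed

lemma basis_vec_closed:
  assumes "cring K" "w \<in> W"
  shows "basis_vec K w \<in> carrier (free_module K W)"
proof -
  interpret cring K by fact
  have "finite {v. basis_vec K w v \<noteq> \<zero>\<^bsub>K\<^esub>}"
    by (rule finite_subset[of _ "{w}"]) (auto simp: basis_vec_def)
  then show ?thesis using assms by (auto simp: free_module_simps basis_vec_def)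
qed

text \<open>Induction on the size of the support: overwriting one nonzero coefficient by zero splits
  off a multiple of a basis vector and leaves a smaller support.\<close>

lemma free_module_induct:
  assumes "cring K" "x \<in> carrier (free_module K W)"
    and zero: "P \<zero>\<^bsub>free_module K W\<^esub>"
    and step: "\<And>c w y. \<lbrakk>c \<in> carrier K; w \<in> W; y \<in> carrier (free_module K W); P y\<rbrakk>
      \<Longrightarrow> P ((c \<odot>\<^bsub>free_module K W\<^esub> basis_vec K w) \<oplus>\<^bsub>free_module K W\<^esub> y)"
  shows "P x"
  using assms(2)
proof (induction "card {w. x w \<noteq> \<zero>\<^bsub>K\<^esub>}" arbitrary: x)
  case 0
  then have "x = \<zero>\<^bsub>free_module K W\<^esub>" by (auto simp: free_module_simps)
  then show ?case using zero by simp
next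
  case (Suc n)
  interpret cring K by fact
  from Suc.hyps(2) have "{w. x w \<noteq> \<zero>\<^bsub>K\<^esub>} \<noteq> {}" by (metis card.empty nat.distinct(1))
  then obtain w where w: "x w \<noteq> \<zero>\<^bsub>K\<^esub>" by auto
  let ?y = "x(w := \<zero>\<^bsub>K\<^esub>)"
  have eq: "{v. ?y v \<noteq> \<zero>\<^bsub>K\<^esub>} = {v. x v \<noteq> \<zero>\<^bsub>K\<^esub>} - {w}" by auto
  have fin: "finite {v. x v \<noteq> \<zero>\<^bsub>K\<^esub>}" using Suc.prems by (auto simp: free_module_simps)
  have y: "?y \<in> carrier (free_module K W)"
    using Suc.prems eq by (auto simp: free_module_simps)
  have "n = card {v. ?y v \<noteq> \<zero>\<^bsub>K\<^esub>}"
    using Suc.hyps(2) w fin unfolding eq by simp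
  then have "P ?y" using Suc.hyps(1) y by blast
  moreover have "w \<in> W" "x w \<in> carrier K" using w Suc.prems by (auto simp: free_module_simps)
  moreover have "x = (x w \<odot>\<^bsub>free_module K W\<^esub> basis_vec K w) \<oplus>\<^bsub>free_module K W\<^esub> ?y"
    using Suc.prems by (auto simp: free_module_simps basis_vec_def)
  ultimately show ?case using step[of "x w" w ?y] y by metis
qed

text \<open>The sum that \<open>tensor_lift\<close> evaluates on a representative, split off so that
  linearity is settled on the free module before independence of the representative is at
  issue.\<close>

definition lin_ext :: "'k ring \<Rightarrow> ('k, 'b) module \<Rightarrow> ('w \<Rightarrow> 'b) \<Rightarrow> ('w \<Rightarrow> 'k) \<Rightarrow> 'b" where
  "lin_ext K N \<phi> x = (\<Oplus>\<^bsub>N\<^esub>w\<in>{w. x w \<noteq> \<zero>\<^bsub>K\<^esub>}. x w \<odot>\<^bsub>N\<^esub> \<phi> w)"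

lemma lin_ext_superset:
  assumes "module K N" "x \<in> carrier (free_module K W)" "\<phi> \<in> W \<rightarrow> carrier N"
    and "finite S" "{w. x w \<noteq> \<zero>\<^bsub>K\<^esub>} \<subseteq> S" "S \<subseteq> W"
  \<comment> \<open>In a sum of two vectors coefficients may cancel, so supports do not add up.
    Allowing extra words with coefficient zero lets all sums in the proof of additivity run over one
    finite set.\<close>
  shows "lin_ext K N \<phi> x = (\<Oplus>\<^bsub>N\<^esub>w\<in>S. x w \<odot>\<^bsub>N\<^esub> \<phi> w)"
proof -
  interpret N: module K N by fact
  show ?thesis unfolding lin_ext_def
    by (rule N.add.finprod_mono_neutral_cong_left)
      (use assms in \<open>auto simp: free_module_simps Pi_iff subset_iff\<close>)
qed

lemma lin_ext_lin_maps:
  assumes "module K N" "\<phi> \<in> W \<rightarrow> carrier N"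
  shows "lin_ext K N \<phi> \<in> lin_maps K (free_module K W) N"
proof (rule lin_mapsI)
  interpret N: module K N by fact
  note sup = lin_ext_superset[OF assms(1) _ assms(2)]
  let ?F = "free_module K W"
  interpret F: module K ?F by (rule module_free_module[OF module_cring[OF assms(1)]])
  let ?s = "\<lambda>x. {w. x w \<noteq> \<zero>\<^bsub>K\<^esub>}"
  show "lin_ext K N \<phi> x \<in> carrier N" if "x \<in> carrier ?F" for x
    unfolding lin_ext_def using that assms(2) by (intro N.finsum_closed) (auto simp: free_module_simps)
  show "lin_ext K N \<phi> (x \<oplus>\<^bsub>?F\<^esub> y) = lin_ext K N \<phi> x \<oplus>\<^bsub>N\<^esub> lin_ext K N \<phi> y"
    if xy: "x \<in> carrier ?F" "y \<in> carrier ?F" for x y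
  proof -
    let ?S = "?s x \<union> ?s y"
    have S: "finite ?S" "?S \<subseteq> W" and W: "\<And>w. w \<in> ?S \<Longrightarrow> \<phi> w \<in> carrier N"
      and xyw: "\<And>w. x w \<in> carrier K" "\<And>w. y w \<in> carrier K"
      using xy assms(2) by (auto simp: free_module_simps)
    have "lin_ext K N \<phi> (x \<oplus>\<^bsub>?F\<^esub> y) = (\<Oplus>\<^bsub>N\<^esub>w\<in>?S. (x \<oplus>\<^bsub>?F\<^esub> y) w \<odot>\<^bsub>N\<^esub> \<phi> w)"
      using S xy by (intro sup F.a_closed) (auto simp: free_module_simps)
    also have "\<dots> = (\<Oplus>\<^bsub>N\<^esub>w\<in>?S. x w \<odot>\<^bsub>N\<^esub> \<phi> w \<oplus>\<^bsub>N\<^esub> y w \<odot>\<^bsub>N\<^esub> \<phi> w)"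
      using W xyw by (intro finsum_cong_mod[OF assms(1)]) (auto simp: free_module_simps N.smult_l_distr)
    also have "\<dots> = (\<Oplus>\<^bsub>N\<^esub>w\<in>?S. x w \<odot>\<^bsub>N\<^esub> \<phi> w) \<oplus>\<^bsub>N\<^esub> (\<Oplus>\<^bsub>N\<^esub>w\<in>?S. y w \<odot>\<^bsub>N\<^esub> \<phi> w)"
      using W xyw by (intro N.finsum_addf) auto
    also have "\<dots> = lin_ext K N \<phi> x \<oplus>\<^bsub>N\<^esub> lin_ext K N \<phi> y"
      using S xy by (simp add: sup[where S = ?S])
    finally show ?thesis .
  qed
  show "lin_ext K N \<phi> (c \<odot>\<^bsub>?F\<^esub> x) = c \<odot>\<^bsub>N\<^esub> lin_ext K N \<phi> x"
    if cx: "c \<in> carrier K" "x \<in> carrier ?F" for c x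
  proof -
    have S: "finite (?s x)" "?s x \<subseteq> W" and W: "\<And>w. w \<in> ?s x \<Longrightarrow> \<phi> w \<in> carrier N"
      and xw: "\<And>w. x w \<in> carrier K"
      using cx assms(2) by (auto simp: free_module_simps)
    have "lin_ext K N \<phi> (c \<odot>\<^bsub>?F\<^esub> x) = (\<Oplus>\<^bsub>N\<^esub>w\<in>?s x. (c \<odot>\<^bsub>?F\<^esub> x) w \<odot>\<^bsub>N\<^esub> \<phi> w)"
      using S cx by (intro sup F.smult_closed) (auto simp: free_module_simps)
    also have "\<dots> = (\<Oplus>\<^bsub>N\<^esub>w\<in>?s x. c \<odot>\<^bsub>N\<^esub> (x w \<odot>\<^bsub>N\<^esub> \<phi> w))"
      using W xw cx by (intro finsum_cong_mod[OF assms(1)]) (auto simp: free_module_simps N.smult_assoc1)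
    also have "\<dots> = c \<odot>\<^bsub>N\<^esub> lin_ext K N \<phi> x"
      unfolding lin_ext_def using W xw cx S by (subst N.finsum_smult_ldistr) auto
    finally show ?thesis .
  qed
qed

lemma lin_ext_basis_vec:
  assumes "module K N" "\<phi> w \<in> carrier N"
  shows "lin_ext K N \<phi> (basis_vec K w) = \<phi> w"
proof -
  interpret N: module K N by fact
  have "lin_ext K N \<phi> (basis_vec K w) = (\<Oplus>\<^bsub>N\<^esub>v\<in>{w}. basis_vec K w v \<odot>\<^bsub>N\<^esub> \<phi> v)"
    using assms
    by (intro lin_ext_superset[where W = "{w}"] basis_vec_closed N.is_cring) (auto simp: basis_vec_def)
  then show ?thesis using assms by (simp add: basis_vec_def)
qed

lemma submodule_submodule_span:
  assumes "module K M" "S \<subseteq> carrier M"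
  shows "submodule (submodule_span K M S) K M"
proof -
  interpret module K M by fact
  have mem: "x \<in> submodule_span K M S \<longleftrightarrow> (\<forall>H. submodule H K M \<longrightarrow> S \<subseteq> H \<longrightarrow> x \<in> H)" for x
    by (auto simp: submodule_span_def)
  have c: "submodule_span K M S \<subseteq> carrier M"
    using carrier_is_submodule assms(2) by (auto simp: submodule_span_def)
  show ?thesis
  proof (rule submoduleI[OF c])
    show "\<zero>\<^bsub>M\<^esub> \<in> submodule_span K M S"
      unfolding mem by (metis M.r_neg M.a_inv_closed subset_iff submoduleE all_not_in_conv)
  qed (auto simp: mem submoduleE)
qed

lemma submodule_span_superset: "S \<subseteq> submodule_span K M S"
  by (auto simp: submodule_span_def)

lemma submodule_span_minimal: "\<lbrakk>submodule H K M; S \<subseteq> H\<rbrakk> \<Longrightarrow> submodule_span K M S \<subseteq> H"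
  by (auto simp: submodule_span_def)

text \<open>Together with \<open>submodule_span_minimal\<close> this shows that a linear map killing
  a set of generators kills their span.\<close>

lemma submodule_kernel:
  assumes "module K M" "module K N" "u \<in> lin_maps K M N"
  shows "submodule {x \<in> carrier M. u x = \<zero>\<^bsub>N\<^esub>} K M"
proof -
  interpret M: module K M by fact
  interpret N: module K N by fact
  show ?thesis
    by (rule M.submoduleI)
      (use assms in \<open>auto simp: lin_maps_zero lin_maps_minus lin_maps_add lin_maps_smult\<close>)
qed

lemma submodule_abelian_subgroup:
  assumes "module K M" "submodule H K M"
  shows "abelian_subgroup H M"
  using assms by (auto intro!: abelian_subgroupI3 additive_subgroup.intro
      simp: submodule_def module_abelian_group)

lemma quot_module_simps:
  "carrier (quot_module M H) = a_rcosets\<^bsub>M\<^esub> H" "\<zero>\<^bsub>quot_module M H\<^esub> = H"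
  "X \<oplus>\<^bsub>quot_module M H\<^esub> Y = X <+>\<^bsub>M\<^esub> Y"
  "c \<odot>\<^bsub>quot_module M H\<^esub> X = (\<Union>x\<in>X. H +>\<^bsub>M\<^esub> (c \<odot>\<^bsub>M\<^esub> x))"
  by (auto simp: quot_module_def)

context
  fixes K :: "'k ring" and M :: "('k, 'a) module" and H
  assumes M: "module K M" and H: "submodule H K M"
begin

interpretation M: module K M by (rule M)
interpretation H: abelian_subgroup H M by (rule submodule_abelian_subgroup[OF M H])

lemma quot_module_carrier: "X \<in> carrier (quot_module M H) \<longleftrightarrow> (\<exists>x\<in>carrier M. X = H +>\<^bsub>M\<^esub> x)"
  by (auto simp: quot_module_simps A_RCOSETS_def')

text \<open>The action on the quotient is a union over all representatives \<open>y\<close> of the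
  coset. The cosets in this union coincide because \<open>H\<close> contains the multiple by
  \<open>c\<close> of the difference of \<open>y\<close> and \<open>x\<close>.\<close>

lemma coset_smult:
  assumes "c \<in> carrier K" "x \<in> carrier M"
  shows "c \<odot>\<^bsub>quot_module M H\<^esub> (H +>\<^bsub>M\<^esub> x) = H +>\<^bsub>M\<^esub> (c \<odot>\<^bsub>M\<^esub> x)"
proof -
  have *: "H +>\<^bsub>M\<^esub> (c \<odot>\<^bsub>M\<^esub> y) = H +>\<^bsub>M\<^esub> (c \<odot>\<^bsub>M\<^esub> x)" if y: "y \<in> H +>\<^bsub>M\<^esub> x" for y
  proof -
    have yc: "y \<in> carrier M" using y assms(2) H.a_elemrcos_carrier by blast
    have "y \<oplus>\<^bsub>M\<^esub> \<ominus>\<^bsub>M\<^esub> x \<in> H" using y yc assms H.a_rcos_module by blast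
    then have "c \<odot>\<^bsub>M\<^esub> (y \<oplus>\<^bsub>M\<^esub> \<ominus>\<^bsub>M\<^esub> x) \<in> H"
      using M.submoduleE(4)[OF H] assms(1) by blast
    then have "c \<odot>\<^bsub>M\<^esub> y \<oplus>\<^bsub>M\<^esub> \<ominus>\<^bsub>M\<^esub> (c \<odot>\<^bsub>M\<^esub> x) \<in> H"
      using assms yc by (simp add: M.smult_r_distr M.smult_r_minus)
    then have "c \<odot>\<^bsub>M\<^esub> y \<in> H +>\<^bsub>M\<^esub> (c \<odot>\<^bsub>M\<^esub> x)"
      using assms yc by (simp add: H.a_rcos_module)
    then show ?thesis
      using H.a_repr_independence'[of "c \<odot>\<^bsub>M\<^esub> y" "c \<odot>\<^bsub>M\<^esub> x"] assms by auto
  qed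
  moreover have "x \<in> H +>\<^bsub>M\<^esub> x" using assms H.a_rcos_self by blast
  ultimately show ?thesis unfolding quot_module_simps by blast
qed

lemma coset_lin_maps: "(\<lambda>x. H +>\<^bsub>M\<^esub> x) \<in> lin_maps K M (quot_module M H)"
  by (rule lin_mapsI) (auto simp: quot_module_carrier coset_smult quot_module_simps(3) H.a_rcos_sum)

lemma module_quot_module: "module K (quot_module M H)"
proof -
  let ?Q = "quot_module M H"
  let ?c = "\<lambda>x. H +>\<^bsub>M\<^esub> x"
  have cl: "?c x \<in> carrier ?Q" if "x \<in> carrier M" for x using that quot_module_carrier by blast
  have add: "?c x \<oplus>\<^bsub>?Q\<^esub> ?c y = ?c (x \<oplus>\<^bsub>M\<^esub> y)" if "x \<in> carrier M" "y \<in> carrier M" for x y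
    using lin_maps_add[OF coset_lin_maps that] by simp
  have zero: "\<zero>\<^bsub>?Q\<^esub> = ?c \<zero>\<^bsub>M\<^esub>" by (simp add: quot_module_simps H.a_subset)
  have "abelian_group ?Q"
  proof (rule abelian_groupI)
    show "\<exists>y\<in>carrier ?Q. y \<oplus>\<^bsub>?Q\<^esub> X = \<zero>\<^bsub>?Q\<^esub>" if X: "X \<in> carrier ?Q" for X
    proof -
      from X obtain x where x: "x \<in> carrier M" "X = ?c x" using quot_module_carrier by blast
      then have "?c (\<ominus>\<^bsub>M\<^esub> x) \<oplus>\<^bsub>?Q\<^esub> X = \<zero>\<^bsub>?Q\<^esub>" by (simp add: add M.l_neg zero)
      then show ?thesis using x cl[of "\<ominus>\<^bsub>M\<^esub> x"] by auto
    qed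
  qed (auto simp: quot_module_carrier add zero M.a_ac cl)
  then show ?thesis
    by (intro moduleI module_cring[OF M])
      (auto simp: quot_module_carrier coset_smult add cl M.smult_l_distr M.smult_r_distr M.smult_assoc1)
qed

end

section \<open>Tensor powers\<close>

lemma words_iff:
  "w \<in> words A n m \<longleftrightarrow> length w = n \<and> wdeg w = m \<and> (\<forall>x\<in>set w. snd x \<in> carrier (A (fst x)))"
  by (auto simp: words_def)

lemma wdeg_simps [simp]:
  "wdeg [] = 0" "wdeg (x # w) = fst x + wdeg w" "wdeg (u @ v) = wdeg u + wdeg v"
  by (auto simp: wdeg_def)

text \<open>The two equations mirror the two families in \<open>tensor_gens\<close>, so the linear
  extension of such a map vanishes on every generator.\<close>

definition multilinear ::
  "'k ring \<Rightarrow> ('k, 'a) graded \<Rightarrow> nat \<Rightarrow> int \<Rightarrow> ('k, 'b) module \<Rightarrow> ('a word \<Rightarrow> 'b) \<Rightarrow> bool" where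
  "multilinear K A n m N \<phi> \<longleftrightarrow> \<phi> \<in> words A n m \<rightarrow> carrier N
     \<and> (\<forall>u p a b v. u @ (p, a) # v \<in> words A n m \<longrightarrow> b \<in> carrier (A p) \<longrightarrow>
          \<phi> (u @ (p, a \<oplus>\<^bsub>A p\<^esub> b) # v) = \<phi> (u @ (p, a) # v) \<oplus>\<^bsub>N\<^esub> \<phi> (u @ (p, b) # v))
     \<and> (\<forall>u p a c v. u @ (p, a) # v \<in> words A n m \<longrightarrow> c \<in> carrier K \<longrightarrow>
          \<phi> (u @ (p, c \<odot>\<^bsub>A p\<^esub> a) # v) = c \<odot>\<^bsub>N\<^esub> \<phi> (u @ (p, a) # v))"

lemma multilinearD:
  assumes "multilinear K A n m N \<phi>"
  shows "\<phi> \<in> words A n m \<rightarrow> carrier N"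
    and "\<lbrakk>u @ (p, a) # v \<in> words A n m; b \<in> carrier (A p)\<rbrakk> \<Longrightarrow>
      \<phi> (u @ (p, a \<oplus>\<^bsub>A p\<^esub> b) # v) = \<phi> (u @ (p, a) # v) \<oplus>\<^bsub>N\<^esub> \<phi> (u @ (p, b) # v)"
    and "\<lbrakk>u @ (p, a) # v \<in> words A n m; c \<in> carrier K\<rbrakk> \<Longrightarrow>
      \<phi> (u @ (p, c \<odot>\<^bsub>A p\<^esub> a) # v) = c \<odot>\<^bsub>N\<^esub> \<phi> (u @ (p, a) # v)"
  using assms by (auto simp: multilinear_def)

context
  fixes K :: "'k ring" and A :: "('k, 'a) graded"
  assumes K: "cring K" and A: "\<And>n. module K (A n)"
begin

interpretation W: module K "word_module K A n m" for n m
  unfolding word_module_def by (rule module_free_module[OF K])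

lemma basis_vec_word: "w \<in> words A n m \<Longrightarrow> basis_vec K w \<in> carrier (word_module K A n m)"
  unfolding word_module_def by (rule basis_vec_closed[OF K])

lemma words_replace:
  assumes "u @ (p, a) # v \<in> words A n m"
  shows "b \<in> carrier (A p) \<Longrightarrow> u @ (p, a \<oplus>\<^bsub>A p\<^esub> b) # v \<in> words A n m"
    and "b \<in> carrier (A p) \<Longrightarrow> u @ (p, b) # v \<in> words A n m"
    and "c \<in> carrier K \<Longrightarrow> u @ (p, c \<odot>\<^bsub>A p\<^esub> a) # v \<in> words A n m"
  using assms module.smult_closed[OF A] abelian_monoid.a_closed[OF module_abelian_monoid[OF A]]
  by (auto simp: words_iff)

lemma tensor_gens_carrier: "tensor_gens K A n m \<subseteq> carrier (word_module K A n m)"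
proof
  fix g
  assume "g \<in> tensor_gens K A n m"
  then show "g \<in> carrier (word_module K A n m)"
    unfolding tensor_gens_def
  proof (elim UnE CollectE exE conjE)
    fix u v p a b
    assume g: "g = basis_vec K (u @ (p, a \<oplus>\<^bsub>A p\<^esub> b) # v) \<ominus>\<^bsub>word_module K A n m\<^esub>
        (basis_vec K (u @ (p, a) # v) \<oplus>\<^bsub>word_module K A n m\<^esub> basis_vec K (u @ (p, b) # v))"
      and w: "u @ (p, a) # v \<in> words A n m" and b: "b \<in> carrier (A p)"
    show ?thesis unfolding g
      by (intro W.M.minus_closed W.M.a_closed basis_vec_word w words_replace(1,2)[OF w b])
  next
    fix u v p a c
    assume g: "g = basis_vec K (u @ (p, c \<odot>\<^bsub>A p\<^esub> a) # v) \<ominus>\<^bsub>word_module K A n m\<^esub>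
        (c \<odot>\<^bsub>word_module K A n m\<^esub> basis_vec K (u @ (p, a) # v))"
      and w: "u @ (p, a) # v \<in> words A n m" and c: "c \<in> carrier K"
    show ?thesis unfolding g
      by (intro W.M.minus_closed W.smult_closed basis_vec_word w c words_replace(3)[OF w c])
  qed
qed

lemma tensor_gens_add:
  "\<lbrakk>u @ (p, a) # v \<in> words A n m; b \<in> carrier (A p)\<rbrakk> \<Longrightarrow>
    basis_vec K (u @ (p, a \<oplus>\<^bsub>A p\<^esub> b) # v) \<ominus>\<^bsub>word_module K A n m\<^esub>
      (basis_vec K (u @ (p, a) # v) \<oplus>\<^bsub>word_module K A n m\<^esub> basis_vec K (u @ (p, b) # v))
    \<in> tensor_gens K A n m"
  unfolding tensor_gens_def by (intro UnI1 CollectI exI conjI) (rule refl)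

lemma tensor_gens_smult:
  "\<lbrakk>u @ (p, a) # v \<in> words A n m; c \<in> carrier K\<rbrakk> \<Longrightarrow>
    basis_vec K (u @ (p, c \<odot>\<^bsub>A p\<^esub> a) # v) \<ominus>\<^bsub>word_module K A n m\<^esub>
      (c \<odot>\<^bsub>word_module K A n m\<^esub> basis_vec K (u @ (p, a) # v))
    \<in> tensor_gens K A n m"
  unfolding tensor_gens_def by (intro UnI2 CollectI exI conjI) (rule refl)

lemma submodule_tensor_rels: "submodule (tensor_rels K A n m) K (word_module K A n m)"
  unfolding tensor_rels_def
  by (intro submodule_submodule_span tensor_gens_carrier W.module_axioms)

lemma abelian_subgroup_tensor_rels: "abelian_subgroup (tensor_rels K A n m) (word_module K A n m)"
  by (rule submodule_abelian_subgroup[OF W.module_axioms submodule_tensor_rels])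

interpretation R: abelian_subgroup "tensor_rels K A n m" "word_module K A n m" for n m
  by (rule abelian_subgroup_tensor_rels)

lemma module_tensor_power: "module K (tensor_power K A n m)"
  unfolding tensor_power_def by (rule module_quot_module[OF W.module_axioms submodule_tensor_rels])

abbreviation tcoset :: "nat \<Rightarrow> int \<Rightarrow> ('a word \<Rightarrow> 'k) \<Rightarrow> ('k, 'a) tensor" where
  "tcoset n m x \<equiv> tensor_rels K A n m +>\<^bsub>word_module K A n m\<^esub> x"

lemma tcoset_lin_maps: "tcoset n m \<in> lin_maps K (word_module K A n m) (tensor_power K A n m)"
  unfolding tensor_power_def by (rule coset_lin_maps[OF W.module_axioms submodule_tensor_rels])

lemma pure_tensor_word: "w \<in> words A n m \<Longrightarrow> pure_tensor K A w = tcoset n m (basis_vec K w)"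
  by (auto simp: pure_tensor_def words_iff)

lemma tcoset_eqI:
  assumes "x \<ominus>\<^bsub>word_module K A n m\<^esub> y \<in> tensor_gens K A n m"
    and "x \<in> carrier (word_module K A n m)" "y \<in> carrier (word_module K A n m)"
  shows "tcoset n m x = tcoset n m y"
proof -
  have "x \<ominus>\<^bsub>word_module K A n m\<^esub> y \<in> tensor_rels K A n m"
    unfolding tensor_rels_def by (rule subsetD[OF submodule_span_superset assms(1)])
  then have "x \<in> tcoset n m y"
    using R.a_rcos_module[OF assms(3,2)] unfolding a_minus_def by (rule iffD2[rotated])
  then show ?thesis using R.a_repr_independence'[OF _ assms(3)] by simp
qed

lemma pure_tensor_closed: "w \<in> words A n m \<Longrightarrow> pure_tensor K A w \<in> carrier (tensor_power K A n m)"
  by (simp add: pure_tensor_word lin_maps_closed[OF tcoset_lin_maps] basis_vec_word)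

lemma multilinear_pure_tensor: "multilinear K A n m (tensor_power K A n m) (pure_tensor K A)"
proof -
  have "pure_tensor K A (u @ (p, a \<oplus>\<^bsub>A p\<^esub> b) # v)
      = pure_tensor K A (u @ (p, a) # v) \<oplus>\<^bsub>tensor_power K A n m\<^esub> pure_tensor K A (u @ (p, b) # v)"
    if w: "u @ (p, a) # v \<in> words A n m" and b: "b \<in> carrier (A p)" for u p a b v
  proof -
    note ws = w words_replace(1,2)[OF w b]
    have "tcoset n m (basis_vec K (u @ (p, a \<oplus>\<^bsub>A p\<^esub> b) # v))
      = tcoset n m (basis_vec K (u @ (p, a) # v)
          \<oplus>\<^bsub>word_module K A n m\<^esub> basis_vec K (u @ (p, b) # v))"
      by (rule tcoset_eqI) (intro tensor_gens_add w b W.M.a_closed basis_vec_word ws)+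
    then show ?thesis
      using ws by (simp add: pure_tensor_word[where n = n and m = m]
          lin_maps_add[OF tcoset_lin_maps] basis_vec_word)
  qed
  moreover have "pure_tensor K A (u @ (p, c \<odot>\<^bsub>A p\<^esub> a) # v)
      = c \<odot>\<^bsub>tensor_power K A n m\<^esub> pure_tensor K A (u @ (p, a) # v)"
    if w: "u @ (p, a) # v \<in> words A n m" and c: "c \<in> carrier K" for u p a c v
  proof -
    note ws = w words_replace(3)[OF w c]
    have "tcoset n m (basis_vec K (u @ (p, c \<odot>\<^bsub>A p\<^esub> a) # v))
      = tcoset n m (c \<odot>\<^bsub>word_module K A n m\<^esub> basis_vec K (u @ (p, a) # v))"
      by (rule tcoset_eqI) (intro tensor_gens_smult w c W.smult_closed basis_vec_word ws)+
    then show ?thesis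
      using ws c by (simp add: pure_tensor_word[where n = n and m = m]
          lin_maps_smult[OF tcoset_lin_maps] basis_vec_word)
  qed
  ultimately show ?thesis
    by (auto simp: multilinear_def pure_tensor_closed)
qed

text \<open>The kernel of \<open>lin_ext K N \<phi>\<close> is a submodule containing the
  generators, hence all relations. Thus the extension is constant on a coset, its image there is a
  singleton, and \<open>the_elem\<close> returns the common value.\<close>

lemma tensor_lift_tcoset:
  assumes N: "module K N" and \<phi>: "multilinear K A n m N \<phi>"
    and x: "x \<in> carrier (word_module K A n m)"
  shows "tensor_lift K N \<phi> (tcoset n m x) = lin_ext K N \<phi> x"
proof -
  let ?F = "word_module K A n m" and ?L = "lin_ext K N \<phi>"
  interpret N: module K N by (rule N)
  have L: "?L \<in> lin_maps K ?F N"
    unfolding word_module_def by (rule lin_ext_lin_maps[OF N multilinearD(1)[OF \<phi>]])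
  have basis: "?L (basis_vec K w) = \<phi> w" "\<phi> w \<in> carrier N" if "w \<in> words A n m" for w
    using funcset_mem[OF multilinearD(1)[OF \<phi>] that] lin_ext_basis_vec[where \<phi> = \<phi>, OF N] by blast+
  note Lm = lin_maps_minus[OF L W.module_axioms N] lin_maps_add[OF L] lin_maps_smult[OF L]
  have "?L g = \<zero>\<^bsub>N\<^esub>" if "g \<in> tensor_gens K A n m" for g
    using that unfolding tensor_gens_def
  proof (elim UnE CollectE exE conjE)
    fix u v p a b
    assume g: "g = basis_vec K (u @ (p, a \<oplus>\<^bsub>A p\<^esub> b) # v) \<ominus>\<^bsub>?F\<^esub>
        (basis_vec K (u @ (p, a) # v) \<oplus>\<^bsub>?F\<^esub> basis_vec K (u @ (p, b) # v))"
      and w: "u @ (p, a) # v \<in> words A n m" and b: "b \<in> carrier (A p)"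
    note ws = w words_replace(1,2)[OF w b]
    note bs = ws[THEN basis_vec_word] ws[THEN basis(2)]
    show ?thesis unfolding g a_minus_def
      using ws bs by (simp add: Lm basis(1) W.M.a_inv_closed W.M.a_closed multilinearD(2)[OF \<phi> w b] N.M.r_neg N.M.a_closed)
  next
    fix u v p a c
    assume g: "g = basis_vec K (u @ (p, c \<odot>\<^bsub>A p\<^esub> a) # v) \<ominus>\<^bsub>?F\<^esub>
        (c \<odot>\<^bsub>?F\<^esub> basis_vec K (u @ (p, a) # v))"
      and w: "u @ (p, a) # v \<in> words A n m" and c: "c \<in> carrier K"
    note ws = w words_replace(3)[OF w c]
    note bs = ws[THEN basis_vec_word] ws[THEN basis(2)]
    show ?thesis unfolding g a_minus_def
      using ws bs c by (simp add: Lm basis(1) W.M.a_inv_closed W.smult_closed multilinearD(3)[OF \<phi> w c] N.M.r_neg)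
  qed
  then have "tensor_gens K A n m \<subseteq> {y \<in> carrier ?F. ?L y = \<zero>\<^bsub>N\<^esub>}"
    using tensor_gens_carrier by blast
  then have rels: "tensor_rels K A n m \<subseteq> {y \<in> carrier ?F. ?L y = \<zero>\<^bsub>N\<^esub>}"
    unfolding tensor_rels_def
    by (rule submodule_span_minimal[OF submodule_kernel[OF W.module_axioms N L]])
  have "?L y = ?L x" if y: "y \<in> tcoset n m x" for y
  proof -
    obtain h where h: "h \<in> tensor_rels K A n m" "y = h \<oplus>\<^bsub>?F\<^esub> x"
      using y unfolding a_r_coset_def' by blast
    from subsetD[OF rels h(1)] have "h \<in> carrier ?F" "?L h = \<zero>\<^bsub>N\<^esub>" by simp_all
    with h x lin_maps_closed[OF L x] show ?thesis by (simp add: Lm)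
  qed
  moreover have "x \<in> tcoset n m x" using x by (rule R.a_rcos_self)
  ultimately have "?L ` tcoset n m x = {?L x}"
    by blast
  then show ?thesis unfolding tensor_lift_def lin_ext_def[abs_def] by simp
qed

lemma tensor_power_cases:
  assumes "X \<in> carrier (tensor_power K A n m)"
  obtains x where "x \<in> carrier (word_module K A n m)" "X = tcoset n m x"
  using assms quot_module_carrier[OF W.module_axioms submodule_tensor_rels]
  unfolding tensor_power_def by blast

lemma tensor_lift_lin_maps:
  assumes N: "module K N" and \<phi>: "multilinear K A n m N \<phi>"
  shows "tensor_lift K N \<phi> \<in> lin_maps K (tensor_power K A n m) N"
proof -
  have L: "lin_ext K N \<phi> \<in> lin_maps K (word_module K A n m) N"
    unfolding word_module_def by (rule lin_ext_lin_maps[OF N multilinearD(1)[OF \<phi>]])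
  note lift = tensor_lift_tcoset[OF N \<phi>]
  show ?thesis
  proof (rule lin_mapsI)
    show "tensor_lift K N \<phi> X \<in> carrier N" if "X \<in> carrier (tensor_power K A n m)" for X
      using that by (rule tensor_power_cases) (simp add: lift lin_maps_closed[OF L])
    show "tensor_lift K N \<phi> (X \<oplus>\<^bsub>tensor_power K A n m\<^esub> Y)
        = tensor_lift K N \<phi> X \<oplus>\<^bsub>N\<^esub> tensor_lift K N \<phi> Y"
      if X: "X \<in> carrier (tensor_power K A n m)" and Y: "Y \<in> carrier (tensor_power K A n m)" for X Y
    proof -
      obtain x where x: "x \<in> carrier (word_module K A n m)" "X = tcoset n m x"
        using X by (rule tensor_power_cases)
      obtain y where y: "y \<in> carrier (word_module K A n m)" "Y = tcoset n m y"
        using Y by (rule tensor_power_cases)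
      show ?thesis using x y
        by (simp add: lift lin_maps_add[OF L] lin_maps_add[OF tcoset_lin_maps, symmetric])
    qed
    show "tensor_lift K N \<phi> (c \<odot>\<^bsub>tensor_power K A n m\<^esub> X) = c \<odot>\<^bsub>N\<^esub> tensor_lift K N \<phi> X"
      if c: "c \<in> carrier K" and X: "X \<in> carrier (tensor_power K A n m)" for c X
      using X by (rule tensor_power_cases)
        (simp add: c lift lin_maps_smult[OF L] lin_maps_smult[OF tcoset_lin_maps, symmetric])
  qed
qed

lemma tensor_lift_pure_tensor:
  assumes N: "module K N" and \<phi>: "multilinear K A n m N \<phi>" and w: "w \<in> words A n m"
  shows "tensor_lift K N \<phi> (pure_tensor K A w) = \<phi> w"
  using tensor_lift_tcoset[OF N \<phi> basis_vec_word[OF w]] lin_ext_basis_vec[of K N \<phi> w]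
    multilinearD(1)[OF \<phi>] N w by (auto simp: pure_tensor_word)

text \<open>Composed with the coset map, both sides are linear on a free module whose basis vectors
  go to the pure tensors.\<close>

lemma tensor_power_eqI:
  assumes N: "module K N" and u: "u \<in> lin_maps K (tensor_power K A n m) N"
    and v: "v \<in> lin_maps K (tensor_power K A n m) N"
    and eq: "\<And>w. w \<in> words A n m \<Longrightarrow> u (pure_tensor K A w) = v (pure_tensor K A w)"
    and X: "X \<in> carrier (tensor_power K A n m)"
  shows "u X = v X"
proof -
  let ?F = "word_module K A n m"
  note T = module_tensor_power[of n m]
  obtain x where x: "x \<in> carrier ?F" "X = tcoset n m x"
    using X by (rule tensor_power_cases)
  note u' = lin_maps_comp[OF tcoset_lin_maps u] and v' = lin_maps_comp[OF tcoset_lin_maps v]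
  have "u (tcoset n m x) = v (tcoset n m x)"
    using K x(1)[unfolded word_module_def]
  proof (rule free_module_induct, fold word_module_def)
    show "u (tcoset n m \<zero>\<^bsub>?F\<^esub>) = v (tcoset n m \<zero>\<^bsub>?F\<^esub>)"
      using lin_maps_zero[OF u' W.module_axioms N] lin_maps_zero[OF v' W.module_axioms N] by simp
    show "u (tcoset n m (c \<odot>\<^bsub>?F\<^esub> basis_vec K w \<oplus>\<^bsub>?F\<^esub> y)) = v (tcoset n m (c \<odot>\<^bsub>?F\<^esub> basis_vec K w \<oplus>\<^bsub>?F\<^esub> y))"
      if "c \<in> carrier K" "w \<in> words A n m" "y \<in> carrier ?F" "u (tcoset n m y) = v (tcoset n m y)" for c w y
      using that eq[OF that(2)] lin_maps_add[OF u', of "c \<odot>\<^bsub>?F\<^esub> basis_vec K w" y]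
        lin_maps_add[OF v', of "c \<odot>\<^bsub>?F\<^esub> basis_vec K w" y]
        lin_maps_smult[OF u', of c "basis_vec K w"] lin_maps_smult[OF v', of c "basis_vec K w"]
      by (simp add: basis_vec_word pure_tensor_word)
  qed
  with x show ?thesis by simp
qed

text \<open>With linearity in one slot phrased as membership in \<open>lin_maps\<close>, sums and
  signs inside a letter move out by the general lemmas on linear maps.\<close>

lemma pure_tensor_letter_lin_maps:
  assumes "\<And>x. x \<in> set (u @ v) \<Longrightarrow> snd x \<in> carrier (A (fst x))"
    and "n = Suc (length u + length v)" "m = wdeg u + p + wdeg v"
  shows "(\<lambda>a. pure_tensor K A (u @ (p, a) # v)) \<in> lin_maps K (A p) (tensor_power K A n m)"
proof -
  have "u @ (p, a) # v \<in> words A n m" if "a \<in> carrier (A p)" for a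
    using assms that by (auto simp: words_iff)
  then show ?thesis
    by (intro lin_mapsI pure_tensor_closed multilinearD[OF multilinear_pure_tensor]) auto
qed

end

section \<open>Tensor products of maps\<close>

abbreviation word_ok :: "('k, 'a) graded \<Rightarrow> 'a word \<Rightarrow> bool" where
  "word_ok A w \<equiv> \<forall>x\<in>set w. snd x \<in> carrier (A (fst x))"

abbreviation arity :: "('k, 'a, 'b) factor list \<Rightarrow> nat" where
  "arity us \<equiv> sum_list (map fst us)"

abbreviation fdeg :: "('k, 'a, 'b) factor list \<Rightarrow> int" where
  "fdeg us \<equiv> sum_list (map (\<lambda>(r, e, u). e) us)"

definition linear_factor ::
  "'k ring \<Rightarrow> ('k, 'a) graded \<Rightarrow> ('k, 'b) graded \<Rightarrow> ('k, 'a, 'b) factor \<Rightarrow> bool" where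
  "linear_factor K A B = (\<lambda>(r, e, u). \<forall>p. u p \<in> lin_maps K (tensor_power K A r p) (B (p + e)))"

lemma multilinearI:
  assumes "\<And>w. w \<in> words A n m \<Longrightarrow> \<phi> w \<in> carrier N"
    and "\<And>u p v. \<lbrakk>word_ok A (u @ v); n = Suc (length u + length v); m = wdeg u + p + wdeg v\<rbrakk>
      \<Longrightarrow> (\<lambda>a. \<phi> (u @ (p, a) # v)) \<in> lin_maps K (A p) N"
  shows "multilinear K A n m N \<phi>"
proof -
  have *: "(\<lambda>a. \<phi> (u @ (p, a) # v)) \<in> lin_maps K (A p) N" "a \<in> carrier (A p)"
    if "u @ (p, a) # v \<in> words A n m" for u p a v
    using that assms(2)[of u v p] by (auto simp: words_iff)
  show ?thesis unfolding multilinear_def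
    using lin_maps_add[OF *(1)] lin_maps_smult[OF *(1)] *(2) assms(1) by blast
qed

lemma wdeg_take_drop: "wdeg (take r w) + wdeg (drop r w) = wdeg w"
  by (metis append_take_drop_id wdeg_simps(3))

text \<open>Only degrees enter the Koszul exponent. It therefore stays constant while a letter
  varies in one degree, and a signed pure tensor remains linear in that letter.\<close>

lemma koszul_cong: "map fst w = map fst w' \<Longrightarrow> koszul us w = koszul us w'"
proof (induction us w arbitrary: w' rule: koszul.induct)
  case (2 r e u us w)
  have "wdeg (take r w) = wdeg (take r w')"
    by (simp add: wdeg_def take_map[symmetric] "2.prems")
  moreover have "koszul us (drop r w) = koszul us (drop r w')"
    by (rule "2.IH") (simp add: drop_map[symmetric] "2.prems")
  ultimately show ?case by simp
qed simp

lemma length_tensor_word [simp]: "length (tensor_word K A us w) = length us"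
  by (induction K A us w rule: tensor_word.induct) auto

context
  fixes K :: "'k ring" and A :: "('k, 'a) graded" and B :: "('k, 'b) graded"
  assumes K: "cring K" and A: "\<And>n. module K (A n)" and B: "\<And>n. module K (B n)"
begin

lemma tensor_word_ok:
  "\<lbrakk>\<forall>u\<in>set us. linear_factor K A B u; word_ok A w; length w = arity us\<rbrakk>
    \<Longrightarrow> word_ok B (tensor_word K A us w) \<and> wdeg (tensor_word K A us w) = wdeg w + fdeg us"
proof (induction us arbitrary: w)
  case (Cons x us)
  obtain r e u where x: "x = (r, e, u)" by (cases x)
  have u: "u q \<in> lin_maps K (tensor_power K A r q) (B (q + e))" for q
    using Cons.prems(1) by (simp add: x linear_factor_def)
  have "take r w \<in> words A r (wdeg (take r w))"
    using Cons.prems by (auto simp: words_iff x dest: in_set_takeD)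
  then have "u (wdeg (take r w)) (pure_tensor K A (take r w)) \<in> carrier (B (wdeg (take r w) + e))"
    by (rule lin_maps_closed[OF u pure_tensor_closed[OF K A]])
  moreover have "word_ok B (tensor_word K A us (drop r w))
      \<and> wdeg (tensor_word K A us (drop r w)) = wdeg (drop r w) + fdeg us"
    using Cons.prems by (intro Cons.IH) (auto simp: x dest: in_set_dropD)
  ultimately show ?case using wdeg_take_drop[of r w] by (auto simp: x)
qed (auto simp: wdeg_def)

lemma tensor_word_words:
  "\<lbrakk>\<forall>u\<in>set us. linear_factor K A B u; w \<in> words A (arity us) q\<rbrakk>
    \<Longrightarrow> tensor_word K A us w \<in> words B (length us) (q + fdeg us)"
  using tensor_word_ok[of us w] by (auto simp: words_iff)

text \<open>The prefix \<open>z\<close> collects the outputs of factors already passed. The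
  induction moves right until some factor consumes the varying letter; there the map is a composite
  of three linear ones: forming the input tensor, applying the factor, inserting its value as a
  letter.\<close>

lemma pure_tensor_tensor_word_lin_maps:
  assumes "\<forall>x\<in>set us. linear_factor K A B x" "word_ok A (u @ v)" "word_ok B z"
    and "arity us = Suc (length u + length v)"
  shows "(\<lambda>a. pure_tensor K B (z @ tensor_word K A us (u @ (p, a) # v)))
    \<in> lin_maps K (A p) (tensor_power K B (length z + length us) (wdeg z + (wdeg u + p + wdeg v + fdeg us)))"
  using assms
proof (induction us arbitrary: u z)
  case (Cons x us)
  obtain r e t where x: "x = (r, e, t)" by (cases x)
  have t: "t q \<in> lin_maps K (tensor_power K A r q) (B (q + e))" for q
    using Cons.prems(1) by (simp add: x linear_factor_def)
  show ?case
  proof (cases "length u < r")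
    case True
    \<comment> \<open>The first factor takes \<open>r\<close> letters: all of \<open>u\<close>, the
      varying letter, and \<open>r - length u - 1\<close> letters of \<open>v\<close>.\<close>
    define v1 v2 where "v1 = take (r - length u - 1) v" and "v2 = drop (r - length u - 1) v"
    have v: "v = v1 @ v2" by (simp add: v1_def v2_def)
    have len: "length v1 = r - length u - 1" "length v2 = arity us"
      using Cons.prems(4) True by (auto simp: v1_def v2_def x)
    have take: "take r (u @ (p, a) # v) = u @ (p, a) # v1" and drop: "drop r (u @ (p, a) # v) = v2" for a
      using True len by (auto simp: v take_Cons' drop_Cons')
    let ?D = "wdeg u + p + wdeg v1"
    have "(\<lambda>a. pure_tensor K A (u @ (p, a) # v1)) \<in> lin_maps K (A p) (tensor_power K A r ?D)"
      using Cons.prems True len by (intro pure_tensor_letter_lin_maps[OF K A]) (auto simp: v)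
    then have L: "(\<lambda>a. t ?D (pure_tensor K A (u @ (p, a) # v1))) \<in> lin_maps K (A p) (B (?D + e))"
      using t by (rule lin_maps_comp)
    have ok: "word_ok B (tensor_word K A us v2)
        \<and> wdeg (tensor_word K A us v2) = wdeg v2 + fdeg us"
      using Cons.prems len by (intro tensor_word_ok) (auto simp: v)
    have "(\<lambda>y. pure_tensor K B (z @ (?D + e, y) # tensor_word K A us v2)) \<in> lin_maps K (B (?D + e))
        (tensor_power K B (length z + length (x # us)) (wdeg z + (wdeg u + p + wdeg v + fdeg (x # us))))"
      using ok Cons.prems by (intro pure_tensor_letter_lin_maps[OF K B]) (auto simp: x v)
    from lin_maps_comp[OF L this] show ?thesis
      by (simp add: x take drop add.assoc del: take_append drop_append)
  next
    case False
    have take: "take r (u @ (p, a) # v) = take r u" and drop: "drop r (u @ (p, a) # v) = drop r u @ (p, a) # v" for a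
      using False by auto
    let ?y = "(wdeg (take r u) + e, t (wdeg (take r u)) (pure_tensor K A (take r u)))"
    have "take r u \<in> words A r (wdeg (take r u))"
      using Cons.prems False by (auto simp: words_iff x dest: in_set_takeD)
    then have y: "snd ?y \<in> carrier (B (fst ?y))"
      using lin_maps_closed[OF t pure_tensor_closed[OF K A]] by simp
    have "(\<lambda>a. pure_tensor K B ((z @ [?y]) @ tensor_word K A us (drop r u @ (p, a) # v)))
      \<in> lin_maps K (A p) (tensor_power K B (length (z @ [?y]) + length us)
          (wdeg (z @ [?y]) + (wdeg (drop r u) + p + wdeg v + fdeg us)))"
      using y Cons.prems False
      by (intro Cons.IH) (auto simp: x dest: in_set_dropD)
    moreover have "wdeg u = wdeg (take r u) + wdeg (drop r u)"
      by (simp add: wdeg_take_drop)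
    ultimately show ?thesis by (simp add: x take drop ac_simps del: take_append drop_append)
  qed
qed simp

lemma multilinear_tensor_word:
  assumes us: "\<forall>x\<in>set us. linear_factor K A B x"
  defines "N q \<equiv> tensor_power K B (length us) (q + fdeg us)"
  shows "multilinear K A (arity us) q (N q)
    (\<lambda>w. signed (N q) (koszul us w) (pure_tensor K B (tensor_word K A us w)))"
proof (rule multilinearI)
  have N: "module K (N q)" unfolding N_def by (rule module_tensor_power[OF K B])
  show "signed (N q) (koszul us w) (pure_tensor K B (tensor_word K A us w)) \<in> carrier (N q)"
    if "w \<in> words A (arity us) q" for w
    using that tensor_word_words[OF us] pure_tensor_closed[OF K B]
    by (intro signed_closed[OF N]) (auto simp: N_def)
  show "(\<lambda>a. signed (N q) (koszul us (u @ (p, a) # v)) (pure_tensor K B (tensor_word K A us (u @ (p, a) # v))))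
      \<in> lin_maps K (A p) (N q)"
    if "word_ok A (u @ v)" "arity us = Suc (length u + length v)" "q = wdeg u + p + wdeg v" for u p v
  proof -
    \<comment> \<open>\<open>undefined\<close> is a dummy letter of the same degree; it frees the
      exponent from \<open>a\<close>, so that the sign is one fixed linear map.\<close>
    have eq: "koszul us (u @ (p, a) # v) = koszul us (u @ (p, undefined) # v)" for a
      by (rule koszul_cong) simp
    have "(\<lambda>a. pure_tensor K B (tensor_word K A us (u @ (p, a) # v))) \<in> lin_maps K (A p) (N q)"
      using pure_tensor_tensor_word_lin_maps[OF us, of u v "[]" p] that by (simp add: N_def)
    from lin_maps_comp[OF this signed_lin_maps[OF N]] show ?thesis by (subst eq)
  qed
qed

lemma tensor_map_lin_maps:
  assumes "\<forall>x\<in>set us. linear_factor K A B x" "n = arity us" "s = length us" "m = q + fdeg us"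
  shows "tensor_map K A B us q \<in> lin_maps K (tensor_power K A n q) (tensor_power K B s m)"
  unfolding tensor_map_def Let_def assms(2-)
  by (intro tensor_lift_lin_maps[OF K A] module_tensor_power[OF K B] multilinear_tensor_word assms(1))

lemma tensor_map_pure_tensor:
  assumes "\<forall>x\<in>set us. linear_factor K A B x" "w \<in> words A (arity us) q"
  shows "tensor_map K A B us q (pure_tensor K A w)
    = signed (tensor_power K B (length us) (q + fdeg us)) (koszul us w)
        (pure_tensor K B (tensor_word K A us w))"
  unfolding tensor_map_def Let_def
  by (rule tensor_lift_pure_tensor[OF K A module_tensor_power[OF K B]
        multilinear_tensor_word[OF assms(1)] assms(2)])

end

section \<open>Inversions and shuffles\<close>

abbreviation count_less :: "nat \<Rightarrow> nat list \<Rightarrow> nat" where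
  "count_less x ys \<equiv> length (filter (\<lambda>y. y < x) ys)"

fun inversions :: "nat list \<Rightarrow> nat" where
  "inversions [] = 0"
| "inversions (x # xs) = count_less x xs + inversions xs"

lemma inversions_swap: "b < a \<Longrightarrow> inversions (us @ a # b # vs) = Suc (inversions (us @ b # a # vs))"
  by (induction us) auto

text \<open>If the tail has no inversions, then some entry of it lies below \<open>x\<close>, and so
  does its first entry: otherwise that first entry would itself be inverted with the smaller
  one.\<close>

lemma descent_if_inversions:
  "inversions xs \<noteq> 0 \<Longrightarrow> \<exists>us a b vs. xs = us @ a # b # vs \<and> b < a"
proof (induction xs)
  case (Cons x xs)
  show ?case
  proof (cases "inversions xs = 0")
    case False
    with Cons.IH obtain us a b vs where "xs = us @ a # b # vs" "b < a" by blast
    then have "x # xs = (x # us) @ a # b # vs \<and> b < a" by simp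
    then show ?thesis by blast
  next
    case True
    with Cons.prems have "filter (\<lambda>y. y < x) xs \<noteq> []" by auto
    then obtain z where z: "z \<in> set xs" "z < x" by (auto simp: filter_empty_conv)
    then obtain y ys where xs: "xs = y # ys" by (cases xs) auto
    have "y < x"
    proof (rule ccontr)
      assume "\<not> y < x"
      with z xs have "z \<in> set (filter (\<lambda>v. v < y) ys)" by auto
      then have "count_less y ys \<noteq> 0" by force
      with True xs show False by simp
    qed
    then have "x # xs = [] @ x # y # ys \<and> y < x" by (simp add: xs)
    then show ?thesis by blast
  qed
qed simp

lemma inversions_sorted: "inversions xs = 0 \<Longrightarrow> sorted xs"
  by (induction xs) (auto simp: filter_empty_conv not_less)

lemma permute_list_inj:
  assumes "distinct I" "\<sigma> permutes {..<length I}" "\<tau> permutes {..<length I}"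
    and "permute_list \<sigma> I = permute_list \<tau> I"
  shows "\<sigma> = \<tau>"
proof
  fix i
  show "\<sigma> i = \<tau> i"
  proof (cases "i < length I")
    case True
    then have "I ! \<sigma> i = I ! \<tau> i"
      using assms by (metis permute_list_nth)
    moreover have "\<sigma> i < length I" "\<tau> i < length I"
      using True assms(2,3) permutes_in_image by fastforce+
    ultimately show ?thesis using assms(1) nth_eq_iff_index_eq by blast
  next
    case False
    then show ?thesis using assms(2,3) by (simp add: permutes_def)
  qed
qed

text \<open>Bubble sort: exchanging the neighbours at a descent removes exactly one inversion and
  flips the parity of the permutation. Without inversions the permuted list is \<open>I\<close>, and
  distinctness forces the identity.\<close>

lemma evenperm_iff_even_inversions:
  assumes I: "sorted_wrt (<) I" and "\<sigma> permutes {..<length I}"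
  shows "evenperm \<sigma> \<longleftrightarrow> even (inversions (permute_list \<sigma> I))"
  using assms(2)
proof (induction "inversions (permute_list \<sigma> I)" arbitrary: \<sigma> rule: less_induct)
  case less
  have dist: "distinct I" using I strict_sorted_iff by blast
  show ?case
  proof (cases "inversions (permute_list \<sigma> I) = 0")
    case True
    then have "permute_list \<sigma> I = I"
      using inversions_sorted[OF True] I less.prems dist
      by (intro sorted_distinct_set_unique) (auto simp: strict_sorted_iff)
    then have "\<sigma> = id"
      using permute_list_inj[OF dist less.prems permutes_id] by simp
    then show ?thesis using True by simp
  next
    case False
    then obtain us a b vs where eq: "permute_list \<sigma> I = us @ a # b # vs" and ab: "b < a"
      using descent_if_inversions by blast
    define i where "i = length us"
    let ?\<tau> = "Transposition.transpose i (Suc i)"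
    have len: "length I = length us + Suc (Suc (length vs))"
      using arg_cong[OF eq, of length] by simp
    then have \<tau>: "?\<tau> permutes {..<length I}"
      by (intro permutes_swap_id) (auto simp: i_def)
    \<comment> \<open>Composing with the transposition on the right exchanges positions of the
      already permuted list, not values of \<open>I\<close>.\<close>
    have "permute_list (\<sigma> \<circ> ?\<tau>) I = permute_list ?\<tau> (us @ a # b # vs)"
      using permute_list_compose[OF \<tau>, of \<sigma>] eq by simp
    also have "\<dots> = us @ b # a # vs"
    proof (rule nth_equalityI)
      fix j
      assume "j < length (permute_list ?\<tau> (us @ a # b # vs))"
      moreover have "j < i \<or> j = i \<or> j = Suc i \<or> (\<exists>k. j = i + Suc (Suc k))"
        by presburger
      ultimately show "permute_list ?\<tau> (us @ a # b # vs) ! j = (us @ b # a # vs) ! j"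
        by (elim disjE exE)
          (auto simp: permute_list_def i_def Transposition.transpose_def nth_append simp del: upt_Suc)
    qed simp
    finally have eq': "permute_list (\<sigma> \<circ> ?\<tau>) I = us @ b # a # vs" .
    have "evenperm (\<sigma> \<circ> ?\<tau>) \<longleftrightarrow> even (inversions (permute_list (\<sigma> \<circ> ?\<tau>) I))"
      using less.hyps[of "\<sigma> \<circ> ?\<tau>"] inversions_swap[OF ab, of us vs] permutes_compose[OF \<tau> less.prems]
      by (simp add: eq eq')
    moreover have "evenperm (\<sigma> \<circ> ?\<tau>) \<longleftrightarrow> \<not> evenperm \<sigma>"
      using less.prems \<tau> by (simp add: evenperm_comp evenperm_swap permutes_imp_permutation[of "{..<length I}"])
    ultimately show ?thesis
      using inversions_swap[OF ab, of us vs] unfolding eq eq' by fastforce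
  qed
qed

section \<open>Lowering the entries of a tuple\<close>

fun hat_list :: "nat list \<Rightarrow> nat list" where
  "hat_list [] = []"
| "hat_list (x # xs) = (x - count_less x xs) # hat_list xs"

lemma card_shift:
  "card {r. Suc s < r \<and> r < Suc n \<and> P r} = card {r. s < r \<and> r < n \<and> P (Suc r)}"
proof -
  have "{r. Suc s < r \<and> r < Suc n \<and> P r} = Suc ` {r. s < r \<and> r < n \<and> P (Suc r)}"
    (is "?L = ?R")
  proof (rule Set.set_eqI)
    show "r \<in> ?L \<longleftrightarrow> r \<in> ?R" for r by (cases r) auto
  qed
  then show ?thesis by (simp add: card_image)
qed

lemma card_shift_0: "card {r. 0 < r \<and> r < Suc n \<and> P r} = card {r. r < n \<and> P (Suc r)}"
proof -
  have "{r. 0 < r \<and> r < Suc n \<and> P r} = Suc ` {r. r < n \<and> P (Suc r)}"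
    (is "?L = ?R")
  proof (rule Set.set_eqI)
    show "r \<in> ?L \<longleftrightarrow> r \<in> ?R" for r by (cases r) auto
  qed
  then show ?thesis by (simp add: card_image)
qed

text \<open>Entries to the right of the head are those of the tail, so \<open>hat\<close> has a
  structural recursion free of index sets.\<close>

lemma hat_eq_hat_list: "hat J = hat_list J"
proof (induction J)
  case (Cons x J)
  have "hat (x # J) = (x - count_less x J) # hat J"
    by (simp add: hat_def upt_conv_Cons map_Suc_upt[symmetric] card_shift card_shift_0
        length_filter_conv_card del: upt_Suc)
  then show ?case using Cons by simp
qed (simp add: hat_def)

lemma length_hat_list [simp]: "length (hat_list J) = length J"
  by (induction J) auto

lemma drop_hat_list: "drop m (hat_list J) = hat_list (drop m J)"
  by (induction J arbitrary: m) (auto simp: drop_Cons')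

lemma count_less_distinct: "distinct zs \<Longrightarrow> count_less x zs = card {z \<in> set zs. z < x}"
  by (metis distinct_card distinct_filter set_filter)

lemma count_less_le: "distinct zs \<Longrightarrow> count_less x zs \<le> x"
proof -
  assume "distinct zs"
  moreover have "card {z \<in> set zs. z < x} \<le> card {..<x}" by (intro card_mono) auto
  ultimately show ?thesis by (simp add: count_less_distinct)
qed

text \<open>Beyond the entries below \<open>x\<close>, only the \<open>y - x - 1\<close> values
  strictly between \<open>x\<close> and \<open>y\<close> can be counted for \<open>y\<close>.
  Written with sums, to avoid truncated subtraction.\<close>

lemma count_less_mono:
  assumes "distinct zs" "x < y" "x \<notin> set zs"
  shows "count_less y zs + x + 1 \<le> count_less x zs + y"
proof -
  have "card {z \<in> set zs. z < y} \<le> card ({z \<in> set zs. z < x} \<union> {x<..<y})"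
    using assms by (intro card_mono) (auto, metis linorder_neqE_nat)
  also have "\<dots> \<le> card {z \<in> set zs. z < x} + card {x<..<y}" by (rule card_Un_le)
  finally show ?thesis using assms by (simp add: count_less_distinct)
qed

text \<open>For \<open>x < y\<close> the strict gap in \<open>count_less_mono\<close> survives. For
  \<open>y < x\<close> the entry \<open>y\<close> itself is counted for \<open>x\<close>, which uses
  up that gap by one and leaves only the weak inequality that is needed.\<close>

lemma hat_list_step:
  assumes "distinct (x # y # zs)"
  shows "x - count_less x (y # zs) < y - count_less y zs \<longleftrightarrow> x < y"
proof (cases "x < y")
  case True
  then show ?thesis
    using count_less_mono[of zs x y] count_less_le[of zs x] assms by auto
next
  case False
  then have "y < x" using assms by auto
  then show ?thesis
    using count_less_mono[of zs y x] count_less_le[of zs y] assms by auto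
qed

text \<open>Strict increase is a condition on neighbours, and \<open>hat_list_step\<close> shows
  that lowering preserves each comparison of neighbours in both directions.\<close>

lemma sorted_take_hat_list:
  "distinct J \<Longrightarrow> sorted_wrt (<) (take m (hat_list J)) \<longleftrightarrow> sorted_wrt (<) (take m J)"
proof (induction J arbitrary: m)
  case (Cons x J)
  show ?case
  proof (cases J)
    case (Cons y zs)
    then obtain "m = 0 \<or> m = 1 \<or> (\<exists>k. m = Suc (Suc k))" by (metis One_nat_def nat.exhaust)
    then show ?thesis
    proof (elim disjE exE)
      fix k assume m: "m = Suc (Suc k)"
      have "sorted_wrt (<) (take (Suc k) (hat_list J)) \<longleftrightarrow> sorted_wrt (<) (take (Suc k) J)"
        using Cons.prems by (intro Cons.IH) simp
      then show ?thesis
        using hat_list_step[of x y zs] Cons.prems m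
        by (simp add: Cons sorted_wrt2 transp_on_less del: sorted_wrt.simps filter.simps)
    qed auto
  qed (auto simp: take_Cons')
qed simp

lemma hat_list_sorted: "sorted_wrt (<) T \<Longrightarrow> hat_list T = T"
proof (induction T)
  case (Cons x T)
  then have "filter (\<lambda>y. y < x) T = []" by (auto simp: filter_empty_conv)
  with Cons show ?case by simp
qed simp

text \<open>Inside an increasing part nothing smaller stands to the right, so the left part is
  lowered by entries of \<open>T\<close> alone and \<open>T\<close> stays as it is.\<close>

lemma hat_list_append_sorted:
  "\<lbrakk>sorted_wrt (<) S; sorted_wrt (<) T\<rbrakk> \<Longrightarrow> hat_list (S @ T) = map (\<lambda>s. s - count_less s T) S @ T"
proof (induction S)
  case (Cons x S)
  then have "filter (\<lambda>y. y < x) S = []" by (auto simp: filter_empty_conv)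
  with Cons show ?case by simp
qed (simp add: hat_list_sorted)

text \<open>Lowering looks only to the right, hence commutes with dropping a prefix; the right half
  of a cut is then the full prefix of \<open>drop m J\<close>.\<close>

lemma cuts_hat:
  assumes "distinct J"
  shows "cuts (hat J) = cuts J"
proof -
  have "sorted_wrt (<) (drop m (hat_list J)) \<longleftrightarrow> sorted_wrt (<) (drop m J)" for m
    using sorted_take_hat_list[of "drop m J" "length J"] assms by (simp add: drop_hat_list)
  then show ?thesis using assms by (simp add: cuts_def hat_eq_hat_list sorted_take_hat_list)
qed

section \<open>Permutations with a cut as subsets of the tuple\<close>

abbreviation slist :: "nat set \<Rightarrow> nat list" where
  "slist \<equiv> sorted_list_of_set"

text \<open>Both halves are increasing, so each is the sorted list of its set, and the right set
  alone determines the left one and the cut.\<close>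

lemma cut_parts:
  assumes I: "sorted_wrt (<) I" and \<sigma>: "\<sigma> permutes {..<length I}"
    and m: "m \<in> cuts (hat (permute_list \<sigma> I))"
  defines "T \<equiv> set (drop m (permute_list \<sigma> I))"
  shows "drop m (permute_list \<sigma> I) = slist T" "take m (permute_list \<sigma> I) = slist (set I - T)"
    and "length I - m = card T" "m \<le> length I" "T \<subseteq> set I"
proof -
  let ?J = "permute_list \<sigma> I"
  have dist: "distinct ?J" and dI: "distinct I" using I \<sigma> by (auto simp: strict_sorted_iff)
  then have *: "m \<le> length I" "sorted_wrt (<) (take m ?J)" "sorted_wrt (<) (drop m ?J)"
    using m by (auto simp: cuts_hat) (auto simp: cuts_def)
  then show "drop m ?J = slist T" "m \<le> length I"
    unfolding T_def by (auto simp: strict_sorted_iff sorted_list_of_set.idem_if_sorted_distinct)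
  have "set (take m ?J) \<inter> T = {}" "set (take m ?J) \<union> T = set ?J"
    using dist unfolding T_def by (auto simp: set_take_disj_set_drop_if_distinct dest: in_set_takeD in_set_dropD)
      (metis append_take_drop_id set_append Un_iff)
  then have "set I - T = set (take m ?J)" using \<sigma> by auto
  then show "take m ?J = slist (set I - T)"
    using *(2) by (auto simp: strict_sorted_iff sorted_list_of_set.idem_if_sorted_distinct)
  show "length I - m = card T" unfolding T_def
    using distinct_card[OF distinct_drop[OF dist, of m]] by simp
  show "T \<subseteq> set I" unfolding T_def using \<sigma> by (auto dest: in_set_dropD)
qed

text \<open>A set determines both halves by \<open>cut_parts\<close>, so the permuted list, so the
  permutation, as the entries are distinct. Conversely, \<open>T\<close> is reached by listing its
  complement, then \<open>T\<close>, and cutting between them.\<close>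

lemma shuffle_bij:
  assumes I: "sorted_wrt (<) I"
  shows "bij_betw (\<lambda>p. set (drop (snd p) (permute_list (fst p) I)))
    (SIGMA \<sigma>:{\<sigma>. \<sigma> permutes {..<length I}}. cuts (hat (permute_list \<sigma> I))) (Pow (set I))"
    (is "bij_betw ?h ?P _")
proof (rule bij_betw_imageI)
  have dI: "distinct I" using I strict_sorted_iff by blast
  show "inj_on ?h ?P"
  proof (rule inj_onI)
    fix p p' assume p: "p \<in> ?P" "p' \<in> ?P" and eq: "?h p = ?h p'"
    obtain \<sigma> m \<sigma>' m' where pp: "p = (\<sigma>, m)" "p' = (\<sigma>', m')" by (cases p, cases p') auto
    have \<sigma>: "\<sigma> permutes {..<length I}" "m \<in> cuts (hat (permute_list \<sigma> I))"
      and \<sigma>': "\<sigma>' permutes {..<length I}" "m' \<in> cuts (hat (permute_list \<sigma>' I))"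
      using p by (auto simp: pp)
    note c = cut_parts[OF I \<sigma>] and c' = cut_parts[OF I \<sigma>']
    have "m = m'" using c(3,4) c'(3,4) eq by (simp add: pp)
    moreover have "permute_list \<sigma> I = permute_list \<sigma>' I"
      using c(1,2) c'(1,2) eq by (metis append_take_drop_id fst_conv pp snd_conv)
    ultimately show "p = p'"
      using permute_list_inj[OF dI \<sigma>(1) \<sigma>'(1)] by (simp add: pp)
  qed
  show "?h ` ?P = Pow (set I)"
  proof (intro equalityI subsetI)
    fix T assume "T \<in> Pow (set I)"
    then have T: "T \<subseteq> set I" "finite T" using finite_subset by auto
    let ?L = "slist (set I - T) @ slist T"
    have "set ?L = set I" "distinct ?L" using T by auto
    then have "mset ?L = mset I" using dI set_eq_iff_mset_eq_distinct by blast
    then obtain \<sigma> where \<sigma>: "\<sigma> permutes {..<length I}" "permute_list \<sigma> I = ?L"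
      by (metis mset_eq_permutation)
    let ?m = "card (set I - T)"
    have "?m \<in> cuts ?L" using T by (auto simp: cuts_def)
    then have "?m \<in> cuts (hat (permute_list \<sigma> I))"
      using cuts_hat[of ?L] \<open>distinct ?L\<close> \<sigma>(2) by simp
    then have mem: "(\<sigma>, ?m) \<in> ?P" using \<sigma> by auto
    have "?h (\<sigma>, ?m) = T" using \<sigma>(2) T by simp
    then show "T \<in> ?h ` ?P" using image_eqI[OF _ mem, of T ?h] by simp
  next
    fix T assume "T \<in> ?h ` ?P"
    then obtain \<sigma> m where "\<sigma> permutes {..<length I}" "m \<in> cuts (hat (permute_list \<sigma> I))"
      "T = set (drop m (permute_list \<sigma> I))" by auto
    then show "T \<in> Pow (set I)" using cut_parts(5)[OF I] by blast
  qed
qed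

section \<open>Increasing tuples and their blocks\<close>

abbreviation width :: "nat list \<Rightarrow> nat" where
  "width ns \<equiv> sum_list (map Suc ns)"

text \<open>
  \<open>joins 0 ns\<close> is the tuple whose induced map is, up to sign,
  $f_{n_1}\otimes\dots\otimes f_{n_r}$: it lists the positions \<open>i\<close> for which the tensor factors
  \<open>i\<close> and \<open>i + 1\<close> are arguments of the same $f_{n_j}$.
\<close>

fun joins :: "nat \<Rightarrow> nat list \<Rightarrow> nat list" where
  "joins a [] = []"
| "joins a (n # ns) = [Suc a..<Suc a + n] @ joins (Suc (a + n)) ns"

text \<open>The exponent gamma, as the sum of products over pairs of entries. Zeros contribute
  nothing, so it may be taken over a whole composition instead of over the blocks of its
  tuple.\<close>

fun pairsum :: "nat list \<Rightarrow> nat" where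
  "pairsum [] = 0"
| "pairsum (n # ns) = n * sum_list ns + pairsum ns"

lemma joins_bounds: "x \<in> set (joins a ns) \<Longrightarrow> a < x \<and> x < a + width ns"
  by (induction ns arbitrary: a) fastforce+

lemma sorted_joins: "sorted_wrt (<) (joins a ns)"
  by (induction ns arbitrary: a) (auto simp: sorted_wrt_append dest: joins_bounds)

lemma length_joins [simp]: "length (joins a ns) = sum_list ns"
  by (induction ns arbitrary: a) auto

lemma joins_append: "joins a (ns @ ms) = joins a ns @ joins (a + width ns) ms"
  by (induction ns arbitrary: a) (auto simp: add_ac)

text \<open>By induction on the number of positions. If \<open>Suc a\<close> is in \<open>T\<close>,
  the first part of the composition found for the later positions grows by one input; otherwise a
  part with a single input, entry 0, is put in front.\<close>

lemma joins_surj: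
  "T \<subseteq> {a<..<a + Suc N} \<Longrightarrow> \<exists>ns. ns \<noteq> [] \<and> width ns = Suc N \<and> set (joins a ns) = T"
proof (induction N arbitrary: a T)
  case 0
  then have "T = {}" by fastforce
  then have "set (joins a [0]) = T" by simp
  then show ?case by (intro exI[of _ "[0]"]) auto
next
  case (Suc N)
  have "T - {Suc a} \<subseteq> {Suc a<..<Suc a + Suc N}" using Suc.prems by auto
  then obtain ns where ns: "ns \<noteq> []" "width ns = Suc N" "set (joins (Suc a) ns) = T - {Suc a}"
    using Suc.IH by blast
  show ?case
  proof (cases "Suc a \<in> T")
    case True
    obtain n r where r: "ns = n # r" using ns(1) by (cases ns) auto
    have "joins a (Suc n # r) = Suc a # joins (Suc a) (n # r)"
      by (simp add: upt_conv_Cons)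
    then have "set (joins a (Suc n # r)) = insert (Suc a) (set (joins (Suc a) (n # r)))" by simp
    then have "set (joins a (Suc n # r)) = T" using ns(3) True unfolding r by auto
    then show ?thesis using ns(2) r by (intro exI[of _ "Suc n # r"]) auto
  next
    case False
    then have "set (joins a (0 # ns)) = T" using ns(3) by simp
    then show ?thesis using ns(2) by (intro exI[of _ "0 # ns"]) auto
  qed
qed

section \<open>Recovering a composition from the blocks of its tuple\<close>

lemma blocks_upt_append:
  assumes "J = [] \<or> i + Suc n < hd J"
  shows "blocks ([i..<i + Suc n] @ J) = [i..<i + Suc n] # blocks J"
  using assms
proof (induction n arbitrary: i)
  case 0
  have "hd (hd (blocks J)) = hd J" if "J \<noteq> []"
    using that by (cases J) (auto split: list.splits)
  with 0 show ?case by (cases J) (auto split: list.splits)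
next
  case (Suc n)
  have "[i..<i + Suc (Suc n)] @ J = i # ([Suc i..<Suc i + Suc n] @ J)"
    by (simp add: upt_conv_Cons del: upt_Suc)
  moreover have "blocks ([Suc i..<Suc i + Suc n] @ J) = [Suc i..<Suc i + Suc n] # blocks J"
    using Suc.prems by (intro Suc.IH) auto
  ultimately show ?case by (simp add: upt_conv_Cons del: upt_Suc)
qed

text \<open>The boundary \<open>Suc (a + n)\<close> after a part is never listed by
  \<open>joins\<close>, so runs of different parts cannot merge; an entry 0 yields no block.\<close>

lemma blocks_joins_Cons:
  "blocks (joins a (n # ns)) =
    (if n = 0 then blocks (joins (Suc a) ns) else [Suc a..<Suc a + n] # blocks (joins (Suc (a + n)) ns))"
proof (cases n)
  case (Suc m)
  have "joins (Suc (a + n)) ns = [] \<or> Suc a + Suc m < hd (joins (Suc (a + n)) ns)"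
    using joins_bounds[of "hd (joins (Suc (a + n)) ns)" "Suc (a + n)" ns] Suc
    by (cases "joins (Suc (a + n)) ns") auto
  from blocks_upt_append[OF this] show ?thesis using Suc by (simp del: upt_Suc)
qed simp

text \<open>Distances measured from a moving origin \<open>l\<close>: after a block the origin
  becomes the position behind its last entry, which absorbs the \<open>- 1\<close> in
  \<open>gaps\<close> and makes the first gap, with origin 0, no exception.\<close>

fun gaps_from :: "nat \<Rightarrow> nat list list \<Rightarrow> nat list" where
  "gaps_from l [] = []"
| "gaps_from l (b # bs) = (hd b - l) # gaps_from (Suc (last b)) bs"

lemma gaps_eq: "gaps bs = gaps_from 0 bs"
proof -
  have len: "length (gaps_from l bs) = length bs" for l
    by (induction bs arbitrary: l) auto
  have "gaps_from l bs ! i = (if i = 0 then hd (bs ! 0) - l else hd (bs ! i) - last (bs ! (i - 1)) - 1)"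
    if "i < length bs" for i l
    using that
  proof (induction bs arbitrary: i l)
    case (Cons b bs)
    then show ?case by (cases i) (auto simp: nth_Cons')
  qed simp
  then show ?thesis by (intro nth_equalityI) (auto simp: gaps_def len)
qed

lemma hd_blocks:
  assumes "blocks J = b # bs"
  shows "hd b = hd J" "J \<noteq> []"
  using assms by (cases J; auto split: list.splits if_splits)+

text \<open>The zeros that \<open>joins\<close> forgets come back from the gaps, a gap
  \<open>k\<close> giving \<open>k - 1\<close> of them; those at the end come back from the total
  width.\<close>

lemma indices_joins:
  fixes a ns
  defines "J \<equiv> joins a ns"
  shows "concat (map2 (\<lambda>k b. replicate (k - 1) 0 @ [length b]) (gaps_from a (blocks J)) (blocks J))
     @ replicate (width ns - sum_list (gaps_from a (blocks J)) - length J) 0 = ns"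
  unfolding J_def
proof (induction ns arbitrary: a)
  case (Cons n ns)
  show ?case
  proof (cases "n = 0")
    case False
    then have "last [Suc a..<Suc a + n] = a + n" "hd [Suc a..<Suc a + n] = Suc a" by (auto simp del: upt_Suc)
    then show ?thesis
      using Cons.IH[of "Suc (a + n)"] False by (simp add: blocks_joins_Cons del: joins.simps(2))
  next
    case True
    note IH = Cons.IH[of "Suc a"]
    show ?thesis
    proof (cases "blocks (joins (Suc a) ns)")
      case Nil
      then have "joins (Suc a) ns = []"
        by (cases "joins (Suc a) ns") (auto split: list.splits if_splits)
      with IH Nil True show ?thesis by (simp add: blocks_joins_Cons)
    next
      case (Cons b bs)
      \<comment> \<open>A leading zero lengthens the first gap by one. This bound keeps the
        subtractions untruncated, so exactly one more zero is produced.\<close>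
      have "Suc a < hd b"
        using hd_blocks[OF Cons] joins_bounds[of "hd (joins (Suc a) ns)" "Suc a" ns] by simp
      then have "hd b - a = Suc (Suc (hd b - Suc (Suc a)))" "hd b - Suc a = Suc (hd b - Suc (Suc a))"
        by auto
      with IH Cons True show ?thesis by (simp add: blocks_joins_Cons)
    qed
  qed
qed simp

lemma induced_indices_joins: "induced_indices (width ns) (joins 0 ns) = ns"
  using indices_joins[of 0 ns] by (simp add: induced_indices_def gaps_eq)

lemma length_blocks_joins: "map length (blocks (joins a ns)) = filter (\<lambda>n. n \<noteq> 0) ns"
  by (induction ns arbitrary: a) (auto simp: blocks_joins_Cons simp del: joins.simps(2))

text \<open>The weight \<open>h\<close> is the identity for gamma and the successor for
  epsilon.\<close>

lemma sum_nth_drop: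
  "(\<Sum>i<length ns - 1. int (h (ns ! i) * sum_list (drop (i + 1) ns)))
    = (case ns of [] \<Rightarrow> 0 | n # ms \<Rightarrow> int (h n * sum_list ms)
        + (\<Sum>i<length ms - 1. int (h (ms ! i) * sum_list (drop (i + 1) ms))))"
proof (cases ns)
  case (Cons n ms)
  show ?thesis
  proof (cases ms)
    case (Cons m ls)
    with \<open>ns = n # ms\<close> show ?thesis by (simp add: sum.lessThan_Suc_shift del: sum.lessThan_Suc)
  qed (simp add: Cons)
qed simp

lemma pairsum_eq: "(\<Sum>i<length ns - 1. int (ns ! i * sum_list (drop (i + 1) ns))) = int (pairsum ns)"
  by (induction ns) (simp, subst sum_nth_drop[where h = "\<lambda>n. n"], simp)

lemma pairsum_filter: "pairsum (filter (\<lambda>n. n \<noteq> 0) ns) = pairsum ns"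
proof (induction ns)
  case (Cons n ns)
  have "sum_list (filter (\<lambda>n. n \<noteq> 0) ns) = sum_list ns" by (induction ns) auto
  with Cons show ?case by simp
qed simp

lemma induced_gamma_joins: "induced_gamma (joins a ns) = int (pairsum ns)"
  using pairsum_eq[of "map length (blocks (joins a ns))"]
  unfolding induced_gamma_def Let_def length_blocks_joins pairsum_filter .

lemma ainf_eps_Cons: "ainf_eps (n # ns) = int (Suc n * sum_list ns) + ainf_eps ns"
  unfolding ainf_eps_def by (subst sum_nth_drop[where h = "\<lambda>n. n + 1"]) simp

lemma ainf_eps_Nil: "ainf_eps [] = 0"
  by (simp add: ainf_eps_def)

section \<open>Refinements\<close>

text \<open>The compositions of \<open>Suc N\<close>: they index the terms of the component
  \<open>N\<close> of the composite, with outer map of index \<open>length ns - 1\<close>.\<close>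

definition refine :: "nat \<Rightarrow> nat list set" where
  "refine N = {ns. ns \<noteq> [] \<and> width ns = Suc N}"

abbreviation refinements :: "nat list \<Rightarrow> nat list list set" where
  "refinements Ns \<equiv> listset (map refine Ns)"

abbreviation outer :: "nat list list \<Rightarrow> nat list" where
  "outer nss \<equiv> map (\<lambda>ns. length ns - 1) nss"

text \<open>
  For a refinement \<open>nss\<close>, \<open>joins a (concat nss)\<close> is the part \<open>T\<close> indexing
  $\widetilde f$, and \<open>all_seps a nss\<close> is its complement: the boundaries between consecutive
  parts inside one list of \<open>nss\<close>.
\<close>

fun seps :: "nat \<Rightarrow> nat list \<Rightarrow> nat list" where
  "seps a (n # m # ns) = Suc (a + n) # seps (Suc (a + n)) (m # ns)"
| "seps a _ = []"

fun all_seps :: "nat \<Rightarrow> nat list list \<Rightarrow> nat list" where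
  "all_seps a [] = []"
| "all_seps a (ns # nss) = seps a ns @ all_seps (a + width ns) nss"

lemma width_eq: "width ns = sum_list ns + length ns"
  by (induction ns) auto

lemma refine_sum: "ns \<in> refine N \<Longrightarrow> N = (length ns - 1) + sum_list ns"
  by (cases ns) (auto simp: refine_def width_eq)

lemma refinements_ConsE:
  assumes "nss \<in> refinements (N # Ns)"
  obtains ns nss' where "nss = ns # nss'" "ns \<in> refine N" "nss' \<in> refinements Ns"
    "ns \<noteq> []" "width ns = Suc N"
  using assms by (auto simp: set_Cons_def refine_def)

lemma width_refinements: "nss \<in> refinements Ns \<Longrightarrow> width (concat nss) = width Ns"
proof (induction Ns arbitrary: nss)
  case (Cons N Ns)
  from Cons.prems show ?case by (rule refinements_ConsE) (simp add: Cons.IH)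
qed simp

text \<open>Each map of \<open>f\<close> has one output, and these outputs are the inputs of the
  maps of \<open>g\<close>.\<close>

lemma width_outer: "nss \<in> refinements Ns \<Longrightarrow> width (outer nss) = length (concat nss)"
proof (induction Ns arbitrary: nss)
  case (Cons N Ns)
  from Cons.prems show ?case by (rule refinements_ConsE) (simp add: Cons.IH[simplified])
qed simp

lemma length_refinements: "nss \<in> refinements Ns \<Longrightarrow> length nss = length Ns"
proof (induction Ns arbitrary: nss)
  case (Cons N Ns)
  from Cons.prems show ?case by (rule refinements_ConsE) (simp add: Cons.IH)
qed simp

lemma finite_refine: "finite (refine N)"
proof (rule finite_subset)
  have "x \<le> N" if "x \<in> set ns" "width ns = Suc N" for x ns
    using member_le_sum_list[of "Suc x" "map Suc ns"] that by force
  then show "refine N \<subseteq> {ns. set ns \<subseteq> {..N} \<and> length ns \<le> Suc N}"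
    by (auto simp: refine_def width_eq)
qed (rule finite_lists_length_le, simp)

lemma seps_bounds: "x \<in> set (seps a ns) \<Longrightarrow> a < x \<and> x < a + width ns"
  by (induction a ns rule: seps.induct) auto

lemma all_seps_bounds: "x \<in> set (all_seps a nss) \<Longrightarrow> a < x \<and> x < a + width (concat nss)"
proof (induction a nss rule: all_seps.induct)
  case (2 a ns nss)
  then show ?case using seps_bounds[of x a ns] by auto
qed simp

lemma sorted_seps: "sorted_wrt (<) (seps a ns)"
  by (induction a ns rule: seps.induct) (auto dest: seps_bounds)

lemma sorted_all_seps: "sorted_wrt (<) (all_seps a nss)"
  by (induction a nss rule: all_seps.induct)
    (auto simp: sorted_wrt_append sorted_seps dest!: seps_bounds all_seps_bounds)

text \<open>Each interior position of a composition either ends a part or lies inside one.\<close>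

lemma seps_joins:
  assumes "ns \<noteq> []"
  shows "set (seps a ns) \<inter> set (joins a ns) = {}"
    and "set (seps a ns) \<union> set (joins a ns) = {a<..<a + width ns}"
proof -
  have "set (seps a ns) \<inter> set (joins a ns) = {} \<and>
      set (seps a ns) \<union> set (joins a ns) = {a<..<a + width ns}"
    using assms
  proof (induction a ns rule: seps.induct)
    case (1 a n m ns)
    define J where "J = joins (Suc (a + n)) (m # ns)"
    define S where "S = seps (Suc (a + n)) (m # ns)"
    have J: "joins a (n # m # ns) = [Suc a..<Suc a + n] @ J" by (simp add: J_def)
    have S: "seps a (n # m # ns) = Suc (a + n) # S" by (simp add: S_def)
    have IH: "set S \<inter> set J = {}" "set S \<union> set J = {Suc (a + n)<..<Suc (a + n) + width (m # ns)}"
      using 1 unfolding J_def S_def by auto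
    have w: "a + width (n # m # ns) = Suc (a + n) + width (m # ns)" by simp
    have b: "\<forall>x\<in>set S. Suc (a + n) < x" "\<forall>x\<in>set J. Suc (a + n) < x" using IH(2) by auto
    have "set (seps a (n # m # ns)) \<inter> set (joins a (n # m # ns)) = {}"
      unfolding J S using IH(1) b by fastforce
    moreover have "set (seps a (n # m # ns)) \<union> set (joins a (n # m # ns))
        = {Suc (a + n)} \<union> {a<..<Suc a + n} \<union> (set S \<union> set J)"
      unfolding J S by auto
    moreover have "{Suc (a + n)} \<union> {a<..<Suc a + n} \<union> (set S \<union> set J) = {a<..<a + width (n # m # ns)}"
    proof -
      have "{Suc (a + n)} \<union> {a<..<Suc a + n} \<union> {Suc (a + n)<..<Suc (a + n) + k} = {a<..<Suc (a + n) + k}"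
        if "0 < k" for k using that by auto
      from this[of "width (m # ns)"] show ?thesis unfolding IH(2) w by simp
    qed
    ultimately show ?case by metis
  qed auto
  then show "set (seps a ns) \<inter> set (joins a ns) = {}"
    "set (seps a ns) \<union> set (joins a ns) = {a<..<a + width ns}" by auto
qed

text \<open>The positions between two consecutive lists of \<open>nss\<close> are neither separators
  nor joins, and they are exactly those that \<open>joins a Ns\<close> omits as well.\<close>

lemma all_seps_joins:
  assumes "nss \<in> refinements Ns"
  shows "set (all_seps a nss) = set (joins a Ns) - set (joins a (concat nss))"
    and "set (joins a (concat nss)) \<subseteq> set (joins a Ns)"
proof -
  have "set (all_seps a nss) \<inter> set (joins a (concat nss)) = {} \<and>
      set (all_seps a nss) \<union> set (joins a (concat nss)) = set (joins a Ns)"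
    using assms
  proof (induction Ns arbitrary: a nss)
    case (Cons N Ns)
    from Cons.prems obtain ns nss' where nss: "nss = ns # nss'" "ns \<in> refine N" "nss' \<in> refinements Ns"
      and ns: "ns \<noteq> []" "width ns = Suc N"
      by (rule refinements_ConsE)
    note IH = Cons.IH[OF nss(3), of "a + Suc N"]
    have bS: "\<forall>x\<in>set (all_seps (a + Suc N) nss'). a + Suc N < x"
      and bJ: "\<forall>x\<in>set (joins (a + Suc N) (concat nss')). a + Suc N < x"
      using all_seps_bounds joins_bounds by blast+
    have g: "set (seps a ns) \<inter> set (joins a ns) = {}"
      "set (seps a ns) \<union> set (joins a ns) = {a<..<a + Suc N}"
      using seps_joins[OF ns(1), of a] ns(2) by auto
    then have sb: "\<forall>x\<in>set (seps a ns). x < a + Suc N" "\<forall>x\<in>set (joins a ns). x < a + Suc N"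
      by auto
    have "set (joins a (N # Ns)) = {a<..<a + Suc N} \<union> set (joins (a + Suc N) Ns)" by auto
    then show ?case
      unfolding nss(1) using IH g bS bJ sb ns(2)
      by (simp add: joins_append) fastforce
  qed simp
  then show "set (all_seps a nss) = set (joins a Ns) - set (joins a (concat nss))"
    "set (joins a (concat nss)) \<subseteq> set (joins a Ns)" by auto
qed

lemma refinement_lists:
  fixes a
  assumes "nss \<in> refinements Ns"
  defines "T \<equiv> set (joins a (concat nss))"
  shows "slist T = joins a (concat nss)" "slist (set (joins a Ns) - T) = all_seps a nss"
    and "card T = sum_list (concat nss)"
proof -
  show 1: "slist T = joins a (concat nss)"
    unfolding T_def using sorted_joins[of a "concat nss"]
    by (simp add: strict_sorted_iff sorted_list_of_set.idem_if_sorted_distinct)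
  show "slist (set (joins a Ns) - T) = all_seps a nss"
    unfolding T_def using all_seps_joins(1)[OF assms(1), of a, symmetric] sorted_all_seps[of a nss]
    by (simp add: strict_sorted_iff sorted_list_of_set.idem_if_sorted_distinct)
  show "card T = sum_list (concat nss)"
    by (metis 1 length_joins sorted_list_of_set.length_sorted_key_list_of_set)
qed

text \<open>The joins together with the total width recover the concatenated list, and the widths
  prescribed by \<open>Ns\<close> fix where it is cut into lists. Every subset is reached by
  treating the positions inside each part of \<open>Ns\<close> separately.\<close>

lemma refinements_bij:
  "bij_betw (\<lambda>nss. set (joins a (concat nss))) (refinements Ns) (Pow (set (joins a Ns)))"
proof (rule bij_betw_imageI)
  have joins_inj: "ns = ms" if "set (joins a ns) = set (joins a ms)" "width ns = width ms" for ns ms a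
  proof -
    have "joins a ns = joins a ms"
      using that(1) sorted_joins by (metis strict_sorted_equal)
    then show ?thesis using indices_joins[of a ns] indices_joins[of a ms] that(2) by simp
  qed
  have concat_inj: "nss = mss" if "nss \<in> refinements Ns" "mss \<in> refinements Ns" "concat nss = concat mss"
    for nss mss Ns
    using that
  proof (induction Ns arbitrary: nss mss)
    case (Cons N Ns)
    obtain ns nss' where nss: "nss = ns # nss'" "ns \<in> refine N" "nss' \<in> refinements Ns"
      using Cons.prems(1) by (rule refinements_ConsE)
    obtain ms mss' where mss: "mss = ms # mss'" "ms \<in> refine N" "mss' \<in> refinements Ns"
      using Cons.prems(2) by (rule refinements_ConsE)
    have w: "width ns = width ms" using nss(2) mss(2) by (simp add: refine_def)
    from Cons.prems(3) have eq: "ns @ concat nss' = ms @ concat mss'" by (simp add: nss mss)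
    then obtain us where "ns = ms @ us \<or> ms = ns @ us"
      by (auto simp: append_eq_append_conv2)
    \<comment> \<open>Every entry has positive width, so a list and a prefix of it have equal width
      only if they coincide.\<close>
    then have "us = []" "ns = ms" using w by (cases us; auto)+
    with eq Cons.IH nss mss show ?case by auto
  qed simp
  show "inj_on (\<lambda>nss. set (joins a (concat nss))) (refinements Ns)"
    by (rule inj_onI) (metis joins_inj concat_inj width_refinements)
  have surj: "\<exists>nss\<in>refinements Ns. set (joins a (concat nss)) = T" if "T \<subseteq> set (joins a Ns)" for T Ns a
    using that
  proof (induction Ns arbitrary: a T)
    case (Cons N Ns)
    let ?U = "T \<inter> {a<..<a + Suc N}" and ?V = "T \<inter> {a + Suc N<..}"
    obtain ns where ns: "ns \<noteq> []" "width ns = Suc N" "set (joins a ns) = ?U"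
      using joins_surj[of ?U a N] by auto
    have J: "set (joins a (N # Ns)) = {a<..<a + Suc N} \<union> set (joins (a + Suc N) Ns)" by auto
    have "?V \<subseteq> set (joins (a + Suc N) Ns)" using Cons.prems J by auto
    then obtain nss where nss: "nss \<in> refinements Ns" "set (joins (a + Suc N) (concat nss)) = ?V"
      using Cons.IH by blast
    \<comment> \<open>The position \<open>a + Suc N\<close> ends the first part, so it is not in
      \<open>T\<close> and nothing is lost.\<close>
    have "T = ?U \<union> ?V" using Cons.prems joins_bounds[of _ "a + Suc N" Ns] unfolding J by blast
    then have "set (joins a (concat (ns # nss))) = T" using ns nss by (simp add: joins_append)
    moreover have "ns # nss \<in> refinements (N # Ns)" using ns nss by (auto simp: refine_def set_Cons_def)
    ultimately show ?case by blast
  qed simp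
  show "(\<lambda>nss. set (joins a (concat nss))) ` refinements Ns = Pow (set (joins a Ns))"
  proof (intro equalityI subsetI)
    fix T assume "T \<in> Pow (set (joins a Ns))"
    then show "T \<in> (\<lambda>nss. set (joins a (concat nss))) ` refinements Ns"
      using surj[of T a Ns] by blast
  qed (use all_seps_joins(2) in blast)
qed

section \<open>Parity of the signs\<close>

text \<open>
  \<open>inv_in\<close> and \<open>inv_all\<close> count the inversions of a shuffle; \<open>moment ns\<close> is
  $\sum_b b\,n_b$ with \<open>b\<close> starting at 0, by which \<open>ainf_eps\<close> exceeds \<open>pairsum\<close>;
  \<open>crossing\<close> is the Koszul sign from moving the outer maps past the inner ones.
\<close>

fun moment :: "nat list \<Rightarrow> nat" where
  "moment [] = 0"
| "moment (n # ns) = sum_list ns + moment ns"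

fun inv_in :: "nat list \<Rightarrow> nat" where
  "inv_in [] = 0"
| "inv_in (n # ns) = n * length ns + inv_in ns"

fun inv_all :: "nat list list \<Rightarrow> nat" where
  "inv_all [] = 0"
| "inv_all (ns # nss) = inv_in ns + sum_list ns * sum_list (outer nss) + inv_all nss"

fun crossing :: "nat list list \<Rightarrow> nat" where
  "crossing [] = 0"
| "crossing (ns # nss) = sum_list ns * sum_list (outer nss) + crossing nss"

section \<open>Inversions and lowered entries for a refinement\<close>

lemma inversions_append:
  "inversions (xs @ ys) = inversions xs + inversions ys + (\<Sum>x\<leftarrow>xs. count_less x ys)"
  by (induction xs) auto

lemma inversions_sorted_0: "sorted_wrt (<) xs \<Longrightarrow> inversions xs = 0"
proof (induction xs)
  case (Cons x xs)
  then have "filter (\<lambda>y. y < x) xs = []" by (auto simp: filter_empty_conv)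
  with Cons show ?case by simp
qed simp

lemma length_seps [simp]: "length (seps a ns) = length ns - 1"
  by (induction a ns rule: seps.induct) auto

lemma length_all_seps [simp]: "length (all_seps a nss) = sum_list (outer nss)"
  by (induction a nss rule: all_seps.induct) auto

lemma count_less_joins_block:
  assumes "a + width ns \<le> x"
  shows "count_less x (joins a (ns @ ms)) = sum_list ns + count_less x (joins (a + width ns) ms)"
proof -
  have "filter (\<lambda>y. y < x) (joins a ns) = joins a ns"
    using assms joins_bounds by (force simp: filter_id_conv)
  then show ?thesis by (simp add: joins_append)
qed

text \<open>From one separator to the next one passes \<open>m + 1\<close> positions and
  \<open>m\<close> joins, so lowered separators are consecutive. The number \<open>c\<close> stands
  for joins before position \<open>a\<close>; the joins of \<open>ms\<close> lie too far right to be
  counted.\<close>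

lemma seps_counts:
  assumes "ns \<noteq> []" "c \<le> a"
  shows "map (\<lambda>s. s - (c + count_less s (joins a (ns @ ms)))) (seps a ns)
      = [Suc (a - c)..<Suc (a - c) + (length ns - 1)]"
    and "(\<Sum>s\<leftarrow>seps a ns. count_less s (joins a (ns @ ms))) = inv_in ns"
proof -
  have "map (\<lambda>s. s - (c + count_less s (joins a (ns @ ms)))) (seps a ns)
      = [Suc (a - c)..<Suc (a - c) + (length ns - 1)]
    \<and> (\<Sum>s\<leftarrow>seps a ns. count_less s (joins a (ns @ ms))) = inv_in ns"
    using assms
  proof (induction a ns arbitrary: c rule: seps.induct)
    case (1 a n m ns)
    let ?a = "Suc (a + n)" and ?S = "seps (Suc (a + n)) (m # ns)"
    have rec: "count_less x (joins a ((n # m # ns) @ ms)) = n + count_less x (joins ?a ((m # ns) @ ms))"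
      if "?a \<le> x" for x
      using count_less_joins_block[of a "[n]" x "m # ns @ ms"] that by simp
    have first: "count_less ?a (joins ?a ((m # ns) @ ms)) = 0"
      using joins_bounds[of _ ?a "(m # ns) @ ms"] by (force simp: filter_empty_conv)
    have S: "?a \<le> x" if "x \<in> set ?S" for x using seps_bounds[OF that] by simp
    have *: "map (\<lambda>s. s - (c + n + count_less s (joins ?a ((m # ns) @ ms)))) ?S
        = [Suc (?a - (c + n))..<Suc (?a - (c + n)) + (length (m # ns) - 1)]"
      "(\<Sum>s\<leftarrow>?S. count_less s (joins ?a ((m # ns) @ ms))) = inv_in (m # ns)"
      using "1.IH"[of "c + n"] "1.prems" by auto
    have ac: "?a - (c + n) = Suc (a - c)" using "1.prems" by simp
    have m1: "map (\<lambda>s. s - (c + count_less s (joins a ((n # m # ns) @ ms)))) ?S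
        = map (\<lambda>s. s - (c + n + count_less s (joins ?a ((m # ns) @ ms)))) ?S"
      by (rule map_cong[OF refl]) (simp only: rec[OF S] add.assoc)
    have m2: "map (\<lambda>s. count_less s (joins a ((n # m # ns) @ ms))) ?S
        = map (\<lambda>s. n + count_less s (joins ?a ((m # ns) @ ms))) ?S"
      by (rule map_cong[OF refl]) (simp only: rec[OF S])
    have c0: "count_less ?a (joins a ((n # m # ns) @ ms)) = n"
      using rec[OF order_refl] first by (simp only: add_0_right)
    have upt: "[Suc (a - c)..<Suc (a - c) + (length (n # m # ns) - 1)]
        = Suc (a - c) # [Suc (Suc (a - c))..<Suc (Suc (a - c)) + (length (m # ns) - 1)]"
      by (simp add: upt_conv_Cons del: upt_Suc)
    have "map (\<lambda>s. s - (c + count_less s (joins a ((n # m # ns) @ ms)))) (seps a (n # m # ns))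
        = [Suc (a - c)..<Suc (a - c) + (length (n # m # ns) - 1)]"
      unfolding seps.simps list.map c0 m1 *(1) ac upt ..
    moreover have "(\<Sum>s\<leftarrow>seps a (n # m # ns). count_less s (joins a ((n # m # ns) @ ms)))
        = n + (\<Sum>s\<leftarrow>?S. n + count_less s (joins ?a ((m # ns) @ ms)))"
      unfolding seps.simps list.map c0 m2 by simp
    then have "(\<Sum>s\<leftarrow>seps a (n # m # ns). count_less s (joins a ((n # m # ns) @ ms)))
        = inv_in (n # m # ns)"
      unfolding sum_list_addf *(2) by (simp add: sum_list_triv)
    ultimately show ?case by blast
  qed auto
  then show "map (\<lambda>s. s - (c + count_less s (joins a (ns @ ms)))) (seps a ns)
      = [Suc (a - c)..<Suc (a - c) + (length ns - 1)]"
    "(\<Sum>s\<leftarrow>seps a ns. count_less s (joins a (ns @ ms))) = inv_in ns" by auto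
qed

text \<open>This identifies the lowered tuple indexing the maps of \<open>g\<close>. Each list
  contributes a run of consecutive integers, and the position that ends the list becomes the
  boundary between two runs.\<close>

lemma all_seps_counts:
  assumes "nss \<in> refinements Ns" "c \<le> a"
  shows "map (\<lambda>s. s - (c + count_less s (joins a (concat nss)))) (all_seps a nss)
      = joins (a - c) (outer nss)"
    and "(\<Sum>s\<leftarrow>all_seps a nss. count_less s (joins a (concat nss))) = inv_all nss"
proof -
  have "map (\<lambda>s. s - (c + count_less s (joins a (concat nss)))) (all_seps a nss) = joins (a - c) (outer nss)
    \<and> (\<Sum>s\<leftarrow>all_seps a nss. count_less s (joins a (concat nss))) = inv_all nss"
    using assms
  proof (induction Ns arbitrary: a c nss)
    case (Cons N Ns)
    from Cons.prems(1) obtain ns nss' where nss: "nss = ns # nss'" "nss' \<in> refinements Ns"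
      and ns: "ns \<noteq> []" "width ns = Suc N"
      by (rule refinements_ConsE)
    let ?a = "a + width ns" and ?c = "c + sum_list ns"
    let ?S = "all_seps ?a nss'"
    have "?c \<le> ?a" using Cons.prems(2) by (simp add: width_eq)
    note IH = Cons.IH[OF nss(2) this]
    have rec: "count_less x (joins a (concat nss)) = sum_list ns + count_less x (joins ?a (concat nss'))"
      if "x \<in> set ?S" for x
      using count_less_joins_block[of a ns x "concat nss'"] all_seps_bounds[OF that] by (simp add: nss)
    have m1: "map (\<lambda>s. s - (c + count_less s (joins a (concat nss)))) ?S
        = map (\<lambda>s. s - (?c + count_less s (joins ?a (concat nss')))) ?S"
      by (rule map_cong[OF refl]) (simp only: rec add.assoc)
    have m2: "map (\<lambda>s. count_less s (joins a (concat nss))) ?S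
        = map (\<lambda>s. sum_list ns + count_less s (joins ?a (concat nss'))) ?S"
      by (rule map_cong[OF refl]) (simp only: rec)
    \<comment> \<open>Width minus number of joins is \<open>length ns\<close>: its separators and
      the one position that ends it.\<close>
    have "?a - ?c = Suc (a - c + (length ns - 1))"
      using Cons.prems(2) ns(1) by (cases ns) (auto simp: width_eq)
    then have IH1: "map (\<lambda>s. s - (?c + count_less s (joins ?a (concat nss')))) ?S
        = joins (Suc (a - c + (length ns - 1))) (outer nss')"
      using IH by simp
    have con: "concat nss = ns @ concat nss'" by (simp add: nss)
    have sep: "all_seps a nss = seps a ns @ ?S" by (simp add: nss)
    have "map (\<lambda>s. s - (c + count_less s (joins a (concat nss)))) (all_seps a nss)
        = joins (a - c) (outer nss)"
      using m1 IH1 seps_counts(1)[OF ns(1) Cons.prems(2), of "concat nss'", folded con]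
      by (simp add: nss(1) del: concat.simps upt_Suc)
    moreover have "(\<Sum>s\<leftarrow>all_seps a nss. count_less s (joins a (concat nss)))
        = inv_in ns + (\<Sum>s\<leftarrow>?S. sum_list ns + count_less s (joins ?a (concat nss')))"
      unfolding sep map_append sum_list_append m2
        seps_counts(2)[OF ns(1) Cons.prems(2), of "concat nss'", folded con] ..
    then have "(\<Sum>s\<leftarrow>all_seps a nss. count_less s (joins a (concat nss))) = inv_all nss"
      using IH by (simp add: sum_list_addf sum_list_triv nss(1) mult.commute)
    ultimately show ?case by blast
  qed simp
  then show "map (\<lambda>s. s - (c + count_less s (joins a (concat nss)))) (all_seps a nss)
      = joins (a - c) (outer nss)"
    "(\<Sum>s\<leftarrow>all_seps a nss. count_less s (joins a (concat nss))) = inv_all nss" by auto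
qed

lemma inversions_refinement:
  assumes "nss \<in> refinements Ns"
  shows "inversions (all_seps a nss @ joins a (concat nss)) = inv_all nss"
  using all_seps_counts(2)[OF assms, of 0 a]
  by (simp add: inversions_append inversions_sorted_0 sorted_joins sorted_all_seps)

text \<open>Of the pairs of a separator and a join in one list, \<open>inv_in\<close> counts those
  with the join first and \<open>moment\<close> the others.\<close>

lemma moment_inv_in: "inv_in ns + moment ns = (length ns - 1) * sum_list ns"
proof (induction ns)
  case (Cons n ns)
  then show ?case by (cases ns) (auto simp: algebra_simps)
qed simp

lemma ainf_eps_eq: "ainf_eps ns = int (pairsum ns + moment ns)"
  by (induction ns) (auto simp: ainf_eps_Nil ainf_eps_Cons algebra_simps)

lemma pairsum_append: "pairsum (ns @ ms) = pairsum ns + pairsum ms + sum_list ns * sum_list ms"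
  by (induction ns) (auto simp: algebra_simps)

lemma sum_refinements:
  "nss \<in> refinements Ns \<Longrightarrow> sum_list Ns = sum_list (outer nss) + sum_list (concat nss)"
proof (induction Ns arbitrary: nss)
  case (Cons N Ns)
  from Cons.prems show ?case
    by (rule refinements_ConsE) (use Cons.IH refine_sum in fastforce)
qed simp

text \<open>On one side stand gamma of the whole tuple and the epsilons of the expanded factors; on
  the other the shuffle, the degree shift, gamma for \<open>g\<close> and for \<open>f\<close>, and
  the Koszul crossings. Adding a list changes the difference by an even number.\<close>

lemma sign_parity:
  assumes "nss \<in> refinements Ns"
  shows "even (int (pairsum Ns) + (\<Sum>ns\<leftarrow>nss. ainf_eps ns)
    - int (inv_all nss + sum_list (outer nss) * sum_list (concat nss) + pairsum (outer nss)
        + pairsum (concat nss) + crossing nss))"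
  using assms
proof (induction Ns arbitrary: nss)
  case (Cons N Ns)
  from Cons.prems obtain ns nss' where nss: "nss = ns # nss'" "ns \<in> refine N" "nss' \<in> refinements Ns"
    by (rule refinements_ConsE)
  define M t where "M = length ns - 1" and "t = sum_list ns"
  define M' t' where "M' = sum_list (outer nss')" and "t' = sum_list (concat nss')"
  have N: "N = M + t" using refine_sum[OF nss(2)] by (simp add: M_def t_def)
  have s: "sum_list Ns = M' + t'" using sum_refinements[OF nss(3)] by (simp add: M'_def t'_def)
  have mi: "inv_in ns + moment ns = M * t" using moment_inv_in by (simp add: M_def t_def)
  \<comment> \<open>The mixed terms of \<open>pairsum (N # Ns)\<close> cancel against those of the
    product of sums. The term \<open>t * M'\<close> is then left twice, from \<open>inv_all\<close>
    and from \<open>crossing\<close>, and the rest is governed by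
    \<open>moment_inv_in\<close>.\<close>
  have eq: "int (pairsum (N # Ns)) + (\<Sum>ns\<leftarrow>nss. ainf_eps ns)
      - int (inv_all nss + sum_list (outer nss) * sum_list (concat nss) + pairsum (outer nss)
          + pairsum (concat nss) + crossing nss)
    = (int (pairsum Ns) + (\<Sum>ns\<leftarrow>nss'. ainf_eps ns)
      - int (inv_all nss' + M' * t' + pairsum (outer nss')
          + pairsum (concat nss') + crossing nss'))
      - 2 * int (t * M' + inv_in ns) + (int (inv_in ns + moment ns) - int (M * t))"
    by (simp add: nss(1) N s pairsum_append ainf_eps_eq M_def[symmetric] t_def[symmetric]
        M'_def[symmetric] t'_def[symmetric] algebra_simps del: One_nat_def)
  show ?case unfolding eq
    by (rule dvd_add[OF dvd_diff[OF Cons.IH[OF nss(3), folded M'_def t'_def] dvd_triv_left]])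
      (simp only: mi diff_self dvd_0_right)
qed (simp add: ainf_eps_Nil)

section \<open>Composition of families over shuffles\<close>

text \<open>Valid for arbitrary families: \<open>shuffle_bij\<close> turns the sum over permutations
  and cuts into one over subsets, and the sign of the permutation becomes the inversion count of the
  two sorted lists put together.\<close>

lemma family_comp_shuffles:
  fixes Z :: "nat \<Rightarrow> int \<Rightarrow> ('k, 'z) module" and G :: "('y, 'z) family" and F :: "('x, 'y) family"
    and n q x
  assumes I: "sorted_wrt (<) I"
  defines "M \<equiv> Z (n - length I) (q + int (length I))"
  defines "summand T \<equiv> G (n - card T) (q + int (card T))
      (map (\<lambda>s. s - count_less s (slist T)) (slist (set I - T))) (F n q (slist T) x)"
  assumes M: "module K M" and cl: "\<And>T. T \<subseteq> set I \<Longrightarrow> summand T \<in> carrier M"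
  shows "family_comp Z G F n q I x
    = (\<Oplus>\<^bsub>M\<^esub>T\<in>Pow (set I). signed M (int (inversions (slist (set I - T) @ slist T))) (summand T))"
proof -
  interpret M: abelian_monoid M by (rule module_abelian_monoid[OF M])
  let ?H = "\<lambda>T. signed M (int (inversions (slist (set I - T) @ slist T))) (summand T)"
  let ?P = "{\<sigma>. \<sigma> permutes {..<length I}}"
  let ?C = "\<lambda>\<sigma>. cuts (hat (permute_list \<sigma> I))"
  let ?T = "\<lambda>\<sigma> m. set (drop m (permute_list \<sigma> I))"
  let ?h = "\<lambda>\<sigma> m. signed M (if evenperm \<sigma> then 0 else 1)
      (G (n - (length I - m)) (q + int (length I - m)) (take m (hat (permute_list \<sigma> I)))
        (F n q (drop m (hat (permute_list \<sigma> I))) x))"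
  have H: "?H T \<in> carrier M" if "T \<subseteq> set I" for T using signed_closed[OF M cl[OF that]] .
  have eq: "?h \<sigma> m = ?H (?T \<sigma> m)" if \<sigma>: "\<sigma> \<in> ?P" and m: "m \<in> ?C \<sigma>" for \<sigma> m
  proof -
    define U where "U = ?T \<sigma> m"
    have \<sigma>': "\<sigma> permutes {..<length I}" using \<sigma> by simp
    note c = cut_parts[OF I \<sigma>' m, folded U_def]
    have pl: "permute_list \<sigma> I = slist (set I - U) @ slist U"
      using c(1,2) by (metis append_take_drop_id)
    have len: "length (slist (set I - U)) = m"
      using arg_cong[OF c(2), of length] c(4) by simp
    have hat: "hat (permute_list \<sigma> I)
        = map (\<lambda>s. s - count_less s (slist U)) (slist (set I - U)) @ slist U"
      unfolding hat_eq_hat_list by (subst pl) (rule hat_list_append_sorted, auto)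
    have "take m (hat (permute_list \<sigma> I)) = map (\<lambda>s. s - count_less s (slist U)) (slist (set I - U))"
      and "drop m (hat (permute_list \<sigma> I)) = slist U"
      unfolding hat using len by auto
    then have "?h \<sigma> m = signed M (if evenperm \<sigma> then 0 else 1) (summand U)"
      unfolding summand_def c(3) by simp
    also have "\<dots> = ?H U"
      using evenperm_iff_even_inversions[OF I \<sigma>'] by (intro signed_cong) (auto simp: pl)
    finally show ?thesis unfolding U_def .
  qed
  have T: "?T \<sigma> m \<subseteq> set I" if "\<sigma> \<in> ?P" "m \<in> ?C \<sigma>" for \<sigma> m
    using cut_parts(5)[OF I] that by blast
  have "finite ?P" by (rule finite_permutations) simp
  moreover have "finite (?C \<sigma>)" for \<sigma>
    by (rule finite_subset[of _ "{..length (hat (permute_list \<sigma> I))}"]) (auto simp: cuts_def)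
  ultimately have "(\<Oplus>\<^bsub>M\<^esub>\<sigma>\<in>?P. \<Oplus>\<^bsub>M\<^esub>m\<in>?C \<sigma>. ?h \<sigma> m)
      = (\<Oplus>\<^bsub>M\<^esub>p\<in>Sigma ?P ?C. ?h (fst p) (snd p))"
    using eq H T by (intro M.finsum_Sigma) auto
  also have "\<dots> = (\<Oplus>\<^bsub>M\<^esub>p\<in>Sigma ?P ?C. ?H (?T (fst p) (snd p)))"
  proof (rule finsum_cong_mod[OF M refl])
    fix p assume "p \<in> Sigma ?P ?C"
    then have p: "fst p \<in> ?P" "snd p \<in> ?C (fst p)" by auto
    show "?H (?T (fst p) (snd p)) \<in> carrier M" by (rule H[OF T[OF p]])
    show "?h (fst p) (snd p) = ?H (?T (fst p) (snd p))" by (rule eq[OF p])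
  qed
  also have "\<dots> = (\<Oplus>\<^bsub>M\<^esub>T\<in>Pow (set I). ?H T)"
    by (rule M.finsum_reindex_bij[OF shuffle_bij[OF I], symmetric]) (use H in auto)
  finally show ?thesis unfolding family_comp_def Let_def M_def .
qed

section \<open>The induced family\<close>

lemma joins_eq_Nil: "joins 0 ns = [] \<Longrightarrow> ns = replicate (width ns) 0"
proof -
  assume "joins 0 ns = []"
  then have "sum_list ns = 0" using length_joins[of 0 ns] by simp
  then have "set ns \<subseteq> {0}" "width ns = length ns" by (auto simp: width_eq)
  then show ?thesis by (metis replicate_eqI singletonD subsetD)
qed

text \<open>One formula covers two clauses of \<open>induced\<close>: for the empty tuple all
  entries are 0 and the exponent vanishes. The clause with value zero cannot apply, since joins lie
  strictly between 0 and \<open>n\<close>.\<close>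

lemma induced_joins:
  assumes "width ns = n"
  shows "induced K A B f n q (joins 0 ns) X
    = signed (tensor_power K B (n - sum_list ns) (q + int (sum_list ns)))
        (int (sum_list ns) * (q - 1) + int (pairsum ns)) (tensor_map K A B (map (mor_factor f) ns) q X)"
proof (cases "joins 0 ns = []")
  case True
  then have ns: "ns = replicate n 0" using joins_eq_Nil assms by metis
  have "sum_list (replicate n 0) = (0::nat)" "pairsum (replicate n 0) = 0" by (induction n) auto
  then show ?thesis using True unfolding ns by (simp add: induced_def Let_def signed_0 sum_list_replicate)
next
  case False
  then have "hd (joins 0 ns) \<noteq> 0" "last (joins 0 ns) \<noteq> n"
    using joins_bounds[of "hd (joins 0 ns)" 0 ns] joins_bounds[of "last (joins 0 ns)" 0 ns] assms
    by auto
  moreover have "induced_indices n (joins 0 ns) = ns"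
    using induced_indices_joins[of ns] unfolding assms .
  ultimately show ?thesis
    using False by (simp add: induced_def Let_def induced_gamma_joins)
qed

lemma ex_joins:
  assumes "sorted_wrt (<) I" "set I \<subseteq> {0<..<n}"
  obtains ns where "I = joins 0 ns" "width ns = n"
proof (cases n)
  case 0
  then show ?thesis using assms that[of "[]"] by auto
next
  case (Suc N)
  then obtain ns where "width ns = Suc N" "set (joins 0 ns) = set I"
    using joins_surj[of "set I" 0 N] assms(2) by auto
  then show ?thesis
    using that[of ns] strict_sorted_equal[OF assms(1) sorted_joins] Suc by metis
qed

definition linear_maps ::
  "'k ring \<Rightarrow> ('k, 'a) graded \<Rightarrow> ('k, 'b) graded \<Rightarrow> ('k, 'a, 'b) maps \<Rightarrow> bool" where
  "linear_maps K A B f \<longleftrightarrow> (\<forall>n q. f n q \<in> lin_maps K (tensor_power K A (n + 1) q) (B (q + int n)))"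

lemma linear_mor_factors:
  "linear_maps K A B f \<Longrightarrow> \<forall>x\<in>set (map (mor_factor f) ns). linear_factor K A B x"
  by (auto simp: linear_maps_def linear_factor_def mor_factor_def)

lemma arity_mor_factor [simp]: "arity (map (mor_factor f) ns) = width ns"
  by (induction ns) (auto simp: mor_factor_def)

lemma fst_comp_mor_factor [simp]: "fst \<circ> mor_factor f = Suc"
  by (auto simp: mor_factor_def)

lemma sum_list_degree_mor_factor [simp]:
  "sum_list (map ((\<lambda>(r, e, u). e) \<circ> mor_factor f) ns) = int (sum_list ns)"
  by (induction ns) (auto simp: mor_factor_def)

lemma fdeg_mor_factor [simp]: "fdeg (map (mor_factor f) ns) = int (sum_list ns)"
  by (induction ns) (auto simp: mor_factor_def)

lemma zero_lin_maps:
  assumes "module K N"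
  shows "(\<lambda>x. \<zero>\<^bsub>N\<^esub>) \<in> lin_maps K M N"
proof -
  interpret N: module K N by fact
  show ?thesis by (rule lin_mapsI) auto
qed

lemma finsum_lin_maps:
  assumes N: "module K N" and "finite S" and h: "\<And>s. s \<in> S \<Longrightarrow> h s \<in> lin_maps K M N"
  shows "(\<lambda>x. \<Oplus>\<^bsub>N\<^esub>s\<in>S. h s x) \<in> lin_maps K M N"
proof -
  interpret N: module K N by (rule N)
  note c = lin_maps_closed[OF h]
  show ?thesis
  proof (rule lin_mapsI)
    fix x y c assume x: "x \<in> carrier M"
    show "(\<Oplus>\<^bsub>N\<^esub>s\<in>S. h s x) \<in> carrier N" using c x by (intro N.finsum_closed) auto
    show "(\<Oplus>\<^bsub>N\<^esub>s\<in>S. h s (x \<oplus>\<^bsub>M\<^esub> y)) = (\<Oplus>\<^bsub>N\<^esub>s\<in>S. h s x) \<oplus>\<^bsub>N\<^esub> (\<Oplus>\<^bsub>N\<^esub>s\<in>S. h s y)"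
      if y: "y \<in> carrier M"
    proof -
      have "(\<Oplus>\<^bsub>N\<^esub>s\<in>S. h s (x \<oplus>\<^bsub>M\<^esub> y)) = (\<Oplus>\<^bsub>N\<^esub>s\<in>S. h s x \<oplus>\<^bsub>N\<^esub> h s y)"
        using c x y lin_maps_add[OF h] by (intro finsum_cong_mod[OF N]) auto
      then show ?thesis using c x y by (subst (asm) N.finsum_addf) auto
    qed
    show "(\<Oplus>\<^bsub>N\<^esub>s\<in>S. h s (c \<odot>\<^bsub>M\<^esub> x)) = c \<odot>\<^bsub>N\<^esub> (\<Oplus>\<^bsub>N\<^esub>s\<in>S. h s x)" if k: "c \<in> carrier K"
    proof -
      have "(\<Oplus>\<^bsub>N\<^esub>s\<in>S. h s (c \<odot>\<^bsub>M\<^esub> x)) = (\<Oplus>\<^bsub>N\<^esub>s\<in>S. c \<odot>\<^bsub>N\<^esub> h s x)"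
        using c x k lin_maps_smult[OF h]
        by (intro finsum_cong_mod[OF N]) auto
      then show ?thesis
        using c x k assms(2)
        by (subst N.finsum_smult_ldistr) auto
    qed
  qed
qed

lemma le_last:
  fixes L :: "nat list"
  shows "i \<in> set L \<Longrightarrow> sorted_wrt (<) L \<Longrightarrow> i \<le> last L"
  by (induction L) (auto intro: less_imp_le)

context
  fixes K :: "'k ring" and A :: "('k, 'a) graded" and B :: "('k, 'b) graded" and f :: "('k, 'a, 'b) maps"
  assumes K: "cring K" and A: "\<And>n. module K (A n)" and B: "\<And>n. module K (B n)"
    and f: "linear_maps K A B f"
begin

lemma tensor_map_mor_lin_maps:
  assumes "n = width ns" "s = length ns" "m = q + int (sum_list ns)"
  shows "tensor_map K A B (map (mor_factor f) ns) q
    \<in> lin_maps K (tensor_power K A n q) (tensor_power K B s m)"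
  by (rule tensor_map_lin_maps[OF K A B linear_mor_factors[OF f]])
    (simp_all only: assms arity_mor_factor fdeg_mor_factor length_map)

lemma induced_lin_maps:
  assumes I: "sorted_wrt (<) I" and le: "\<forall>i\<in>set I. i \<le> n"
    and m: "m = q + int (length I)"
  shows "induced K A B f n q I \<in> lin_maps K (tensor_power K A n q) (tensor_power K B (n - length I) m)"
proof (cases "I \<noteq> [] \<and> (hd I = 0 \<or> last I = n)")
  case True
  then have "induced K A B f n q I = (\<lambda>X. \<zero>\<^bsub>tensor_power K B (n - length I) m\<^esub>)"
    by (auto simp: induced_def Let_def m)
  then show ?thesis using zero_lin_maps[OF module_tensor_power[OF K B]] by simp
next
  case False
  have "0 < i \<and> i < n" if i: "i \<in> set I" for i
  proof -
    obtain j J where J: "I = j # J" using i by (cases I) auto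
    then have "0 < j" using False by simp
    moreover have "j \<le> i" using i I J by auto
    moreover have "i \<le> last I" using i I by (rule le_last)
    moreover have "last I \<le> n" "last I \<noteq> n" using False J le by auto
    ultimately show ?thesis by linarith
  qed
  then have "set I \<subseteq> {0<..<n}" by auto
  then obtain ns where ns: "I = joins 0 ns" "width ns = n" using ex_joins[OF I] by blast
  have "tensor_map K A B (map (mor_factor f) ns) q
      \<in> lin_maps K (tensor_power K A n q) (tensor_power K B (n - length I) m)"
    using ns m by (intro tensor_map_mor_lin_maps) (auto simp: width_eq)
  note lin_maps_comp[OF this signed_lin_maps[OF module_tensor_power[OF K B]]]
  moreover have "induced K A B f n q I = (\<lambda>X. signed (tensor_power K B (n - length I) m)
      (int (sum_list ns) * (q - 1) + int (pairsum ns)) (tensor_map K A B (map (mor_factor f) ns) q X))"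
    unfolding ns(1) m by (rule ext) (simp add: induced_joins[OF ns(2)])
  ultimately show ?thesis by simp
qed

end

section \<open>Composition of morphisms\<close>

lemma signed_finsum_signed:
  fixes K :: "'k ring"
  assumes M: "module K M" and h: "\<And>s. s \<in> S \<Longrightarrow> h s \<in> carrier M"
  shows "signed M e (\<Oplus>\<^bsub>M\<^esub>s\<in>S. signed M (e' s) (h s)) = (\<Oplus>\<^bsub>M\<^esub>s\<in>S. signed M (e + e' s) (h s))"
proof -
  have "signed M e (\<Oplus>\<^bsub>M\<^esub>s\<in>S. signed M (e' s) (h s))
      = (\<Oplus>\<^bsub>M\<^esub>s\<in>S. signed M e (signed M (e' s) (h s)))"
    using h signed_closed[OF M] by (intro signed_finsum[OF M]) auto
  also have "\<dots> = (\<Oplus>\<^bsub>M\<^esub>s\<in>S. signed M (e + e' s) (h s))"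
    by (rule finsum_cong_mod[OF M refl]) (simp_all only: signed_signed[OF M h] signed_closed[OF M h])
  finally show ?thesis .
qed

lemma tensor_word_append:
  "arity us \<le> length w \<Longrightarrow> tensor_word K A (us @ vs) w
    = tensor_word K A us (take (arity us) w) @ tensor_word K A vs (drop (arity us) w)"
proof (induction us arbitrary: w)
  case (Cons x us)
  obtain r e u where x: "x = (r, e, u)" by (cases x)
  show ?case using Cons.IH[of "drop r w"] Cons.prems
    by (simp add: x take_drop drop_drop min_def add.commute)
qed simp

lemma koszul_append:
  "arity us \<le> length w \<Longrightarrow> koszul (us @ vs) w
    = koszul us (take (arity us) w) + koszul vs (drop (arity us) w)
      + fdeg vs * wdeg (take (arity us) w)"
proof (induction us arbitrary: w)
  case (Cons x us)
  obtain r e u where x: "x = (r, e, u)" by (cases x)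
  have "wdeg (take (r + arity us) w) = wdeg (take r w) + wdeg (take (arity us) (drop r w))"
    by (metis take_add wdeg_simps(3))
  then show ?case using Cons.IH[of "drop r w"] Cons.prems
    by (simp add: x take_drop drop_drop min_def algebra_simps)
qed simp

text \<open>The sign picked up when every factor of the composite is expanded separately: its
  epsilon and the Koszul sign of its maps of \<open>f\<close> on its own inputs. Signs between
  different factors are not included.\<close>

fun refinement_sign :: "('k, 'a, 'b) maps \<Rightarrow> nat list list \<Rightarrow> 'a word \<Rightarrow> int" where
  "refinement_sign f [] w = 0"
| "refinement_sign f (ns # nss) w =
     ainf_eps ns + koszul (map (mor_factor f) ns) (take (width ns) w)
       + refinement_sign f nss (drop (width ns) w)"

lemma finite_refinements: "finite (refinements Ns)"
proof (induction Ns)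
  case (Cons N Ns)
  have "refinements (N # Ns) = (\<lambda>(ns, nss). ns # nss) ` (refine N \<times> refinements Ns)"
    by (auto simp: set_Cons_def)
  then show ?case using Cons finite_refine by simp
qed simp

text \<open>The outer index \<open>m\<close> is one less than the length of the list, so the double
  sum in \<open>ainf_comp\<close> is a single sum over \<open>refine\<close>.\<close>

lemma compositions_bij:
  "bij_betw snd (SIGMA m:{..n}. compositions (m + 1) (n - m)) (refine n)"
proof (rule bij_betw_imageI)
  show "inj_on snd (SIGMA m:{..n}. compositions (m + 1) (n - m))"
    by (rule inj_onI) (auto simp: compositions_def)
  show "snd ` (SIGMA m:{..n}. compositions (m + 1) (n - m)) = refine n"
  proof (intro equalityI subsetI)
    fix ns assume "ns \<in> refine n"
    then have "length ns - 1 \<le> n" "length ns = length ns - 1 + 1" "sum_list ns = n - (length ns - 1)"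
      using refine_sum[of ns n] by (auto simp: refine_def)
    then have "(length ns - 1, ns) \<in> (SIGMA m:{..n}. compositions (m + 1) (n - m))"
      unfolding compositions_def by blast
    then show "ns \<in> snd ` (SIGMA m:{..n}. compositions (m + 1) (n - m))"
      by (metis image_eqI snd_conv)
  qed (auto simp: compositions_def refine_def width_eq)
qed

lemma finite_compositions: "finite (compositions r s)"
  by (rule finite_subset[OF _ finite_lists_length_eq[of "{..s}" r]])
    (auto simp: compositions_def member_le_sum_list)

lemma refinements_Cons_bij:
  "bij_betw (\<lambda>p. fst p # snd p) (refine N \<times> refinements Ns) (refinements (N # Ns))"
  by (rule bij_betw_imageI) (auto simp: inj_on_def set_Cons_def image_iff)

text \<open>Membership, unlike the test on first and last entry in \<open>induced\<close>, passes
  easily to subsets and complements.\<close>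

lemma in_tuple_bounds:
  fixes L :: "nat list"
  assumes "sorted_wrt (<) L" "\<forall>i\<in>set L. i \<le> n"
  shows "L \<noteq> [] \<and> (hd L = 0 \<or> last L = n) \<longleftrightarrow> 0 \<in> set L \<or> n \<in> set L"
proof
  assume "0 \<in> set L \<or> n \<in> set L"
  then show "L \<noteq> [] \<and> (hd L = 0 \<or> last L = n)"
  proof
    assume "0 \<in> set L"
    then show ?thesis using assms(1) by (cases L) auto
  next
    assume n: "n \<in> set L"
    then have "n \<le> last L" using assms(1) by (rule le_last)
    moreover have L: "L \<noteq> []" using n by auto
    moreover have "last L \<le> n" using assms(2) last_in_set[OF L] by blast
    ultimately show ?thesis by simp
  qed
qed (use hd_in_set last_in_set in metis)

text \<open>Lowering keeps the tuple within the bounds for \<open>n - card T\<close> factors and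
  keeps its ends: an entry 0 has nothing below it, and an entry \<open>n\<close> outside
  \<open>T\<close> exceeds all of \<open>T\<close>, so it drops by exactly
  \<open>card T\<close>.\<close>

lemma shuffled_tuple:
  assumes I: "sorted_wrt (<) I" "\<forall>i\<in>set I. i \<le> n" and T: "T \<subseteq> set I"
  defines "J \<equiv> map (\<lambda>s. s - count_less s (slist T)) (slist (set I - T))"
  shows "sorted_wrt (<) J" "\<forall>i\<in>set J. i \<le> n - card T" "length J + card T = length I"
    and "0 \<in> set I - T \<Longrightarrow> 0 \<in> set J" "n \<in> set I - T \<Longrightarrow> n - card T \<in> set J"
proof -
  have fin: "finite T" using T finite_subset by auto
  let ?S = "slist (set I - T)"
  have "J = take (length ?S) (hat_list (?S @ slist T))"
    unfolding J_def by (subst hat_list_append_sorted) auto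
  moreover have "distinct (?S @ slist T)" using fin by auto
  ultimately show "sorted_wrt (<) J" using sorted_take_hat_list[of "?S @ slist T" "length ?S"] by simp
  show "length J + card T = length I"
  proof -
    have "length J = card (set I) - card T" unfolding J_def using fin T by (simp add: card_Diff_subset)
    moreover have "card T \<le> card (set I)" using T by (intro card_mono) auto
    moreover have "card (set I) = length I" using I(1) by (simp add: strict_sorted_iff distinct_card)
    ultimately show ?thesis by simp
  qed
  have all: "count_less m (slist T) = card T" if "\<forall>t\<in>T. t < m" for m
  proof -
    have "filter (\<lambda>y. y < m) (slist T) = slist T" using that fin by (simp add: filter_id_conv)
    then show ?thesis by simp
  qed
  show "\<forall>i\<in>set J. i \<le> n - card T"
  proof
    fix i assume "i \<in> set J"
    then obtain s where s: "s \<in> set I" "s \<notin> T" "i = s - count_less s (slist T)"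
      unfolding J_def by auto
    \<comment> \<open>\<open>Suc n\<close> lies strictly above every entry, which makes
      \<open>count_less_mono\<close> applicable even to \<open>s = n\<close>.\<close>
    have "\<forall>t\<in>T. t < Suc n" using I(2) T by (auto simp: less_Suc_eq_le)
    then have "count_less (Suc n) (slist T) = card T" by (rule all)
    moreover have "s < Suc n" using I(2) s(1) by (simp add: less_Suc_eq_le)
    ultimately have "card T + s \<le> count_less s (slist T) + n"
      using count_less_mono[of "slist T" s "Suc n"] s(2) fin by simp
    then show "i \<le> n - card T"
      using s(3) count_less_le[of "slist T" s] by simp
  qed
  show "0 \<in> set J" if "0 \<in> set I - T" using that unfolding J_def by force
  show "n - card T \<in> set J" if n: "n \<in> set I - T"
  proof -
    have "\<forall>t\<in>T. t < n" using I(2) T n by (metis DiffD2 le_neq_implies_less subsetD)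
    then show ?thesis using n all[of n] unfolding J_def by force
  qed
qed

section \<open>Expansion of the composite on pure tensors\<close>

context
  fixes K :: "'k ring" and A :: "('k, 'a) graded" and B :: "('k, 'b) graded" and C :: "('k, 'c) graded"
    and f :: "('k, 'a, 'b) maps" and g :: "('k, 'b, 'c) maps"
  assumes K: "cring K" and A: "\<And>n. module K (A n)" and B: "\<And>n. module K (B n)"
    and C: "\<And>n. module K (C n)"
    and f: "linear_maps K A B f" and g: "linear_maps K B C g"
begin

abbreviation "factors_f \<equiv> map (mor_factor f)"
abbreviation "factors_g \<equiv> map (mor_factor g)"
abbreviation "factors_gf \<equiv> map (mor_factor (ainf_comp K A B C g f))"

abbreviation "word_f ns w \<equiv> tensor_word K A (factors_f ns) w"
abbreviation "word_g ns w \<equiv> tensor_word K B (factors_g ns) w"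
abbreviation "word_gf ns w \<equiv> tensor_word K A (factors_gf ns) w"

lemma g_lin: "g n q \<in> lin_maps K (tensor_power K B (Suc n) q) (C (q + int n))"
  using g by (auto simp: linear_maps_def)

lemma word_f_ok:
  assumes "word_ok A w" "length w = width ns"
  shows "word_ok B (word_f ns w)" "wdeg (word_f ns w) = wdeg w + int (sum_list ns)"
  using tensor_word_ok[OF K A B linear_mor_factors[OF f], of w ns] assms by auto

lemma word_g_ok:
  assumes "word_ok B w" "length w = width ns"
  shows "word_ok C (word_g ns w)" "wdeg (word_g ns w) = wdeg w + int (sum_list ns)"
  using tensor_word_ok[OF K B C linear_mor_factors[OF g], of w ns] assms by auto

definition comp_term :: "nat list \<Rightarrow> int \<Rightarrow> ('k, 'a) tensor \<Rightarrow> 'c" where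
  "comp_term ns p X = g (length ns - 1) (p + int (sum_list ns)) (tensor_map K A B (factors_f ns) p X)"

lemma comp_term_lin_maps:
  assumes "ns \<in> refine N"
  shows "comp_term ns p \<in> lin_maps K (tensor_power K A (Suc N) p) (C (p + int N))"
proof -
  have l: "width ns = Suc N" "length ns = Suc (length ns - 1)" using assms by (auto simp: refine_def)
  have "tensor_map K A B (factors_f ns) p \<in> lin_maps K (tensor_power K A (Suc N) p)
      (tensor_power K B (Suc (length ns - 1)) (p + int (sum_list ns)))"
    using l by (intro tensor_map_mor_lin_maps[OF K A B f]) auto
  from lin_maps_comp[OF this g_lin] show ?thesis
    using refine_sum[OF assms] by (simp add: comp_term_def[abs_def] add.assoc add.commute)
qed

lemma ainf_comp_refine:
  assumes X: "X \<in> carrier (tensor_power K A (Suc N) p)"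
  shows "ainf_comp K A B C g f N p X
    = (\<Oplus>\<^bsub>C (p + int N)\<^esub>ns\<in>refine N. signed (C (p + int N)) (ainf_eps ns) (comp_term ns p X))"
proof -
  let ?M = "C (p + int N)"
  interpret M: abelian_monoid ?M by (rule module_abelian_monoid[OF C])
  let ?S = "\<lambda>m. compositions (m + 1) (N - m)"
  let ?h = "\<lambda>ns. signed ?M (ainf_eps ns) (comp_term ns p X)"
  have h: "?h ns \<in> carrier ?M" if "ns \<in> refine N" for ns
    by (rule signed_closed[OF C lin_maps_closed[OF comp_term_lin_maps[OF that] X]])
  have sub: "ns \<in> refine N" if "m \<in> {..N}" "ns \<in> ?S m" for m ns
    using that by (auto simp: compositions_def refine_def width_eq)
  have "ainf_comp K A B C g f N p X = (\<Oplus>\<^bsub>?M\<^esub>m\<in>{..N}. \<Oplus>\<^bsub>?M\<^esub>ns\<in>?S m. ?h ns)"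
    unfolding ainf_comp_def
  proof (intro finsum_cong_mod[OF C] refl)
    fix m assume m: "m \<in> {..N}"
    show "(\<Oplus>\<^bsub>?M\<^esub>ns\<in>?S m. ?h ns) \<in> carrier ?M"
      using h sub[OF m] by (intro M.finsum_closed) auto
    fix ns assume ns: "ns \<in> ?S m"
    show "?h ns \<in> carrier ?M" using h[OF sub[OF m ns]] .
    show "signed ?M (ainf_eps ns) (g m (p + int (N - m)) (tensor_map K A B (factors_f ns) p X)) = ?h ns"
      using ns by (auto simp: compositions_def comp_term_def)
  qed
  also have "\<dots> = (\<Oplus>\<^bsub>?M\<^esub>x\<in>Sigma {..N} ?S. ?h (snd x))"
    using h sub by (intro M.finsum_Sigma) (auto simp: finite_compositions)
  also have "\<dots> = (\<Oplus>\<^bsub>?M\<^esub>ns\<in>refine N. ?h ns)"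
    by (rule M.finsum_reindex_bij[OF compositions_bij h, symmetric])
  finally show ?thesis .
qed

lemma linear_maps_ainf_comp: "linear_maps K A C (ainf_comp K A B C g f)"
proof -
  have "ainf_comp K A B C g f N p \<in> lin_maps K (tensor_power K A (Suc N) p) (C (p + int N))" for N p
  proof -
    have "(\<lambda>X. \<Oplus>\<^bsub>C (p + int N)\<^esub>ns\<in>refine N. signed (C (p + int N)) (ainf_eps ns) (comp_term ns p X))
        \<in> lin_maps K (tensor_power K A (Suc N) p) (C (p + int N))" (is "?u \<in> _")
      by (intro finsum_lin_maps[OF C finite_refine] lin_maps_comp[OF comp_term_lin_maps signed_lin_maps[OF C]])
    \<comment> \<open>The two functions agree only on the carrier, so linearity is carried over
      clause by clause, using that the carrier is closed under the operations.\<close>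
    moreover have "ainf_comp K A B C g f N p X = ?u X" if "X \<in> carrier (tensor_power K A (Suc N) p)" for X
      using ainf_comp_refine[OF that] .
    ultimately show ?thesis
      unfolding lin_maps_def
      using abelian_monoid.a_closed[OF module_abelian_monoid[OF module_tensor_power[OF K A]]]
        module.smult_closed[OF module_tensor_power[OF K A]]
      by (auto simp: Pi_iff)
  qed
  then show ?thesis by (simp add: linear_maps_def)
qed

lemma refinement_words:
  assumes "nss \<in> refinements Ns" "word_ok A w" "length w = width Ns"
  shows "word_ok C (word_g (outer nss) (word_f (concat nss) w))"
    and "wdeg (word_g (outer nss) (word_f (concat nss) w)) = wdeg w + int (sum_list Ns)"
    and "length (word_g (outer nss) (word_f (concat nss) w)) = length Ns"
proof -
  have l: "length w = width (concat nss)" using assms width_refinements by metis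
  have l': "length (word_f (concat nss) w) = width (outer nss)"
    using width_outer[OF assms(1)] by simp
  note 1 = word_f_ok[OF assms(2) l]
  show "word_ok C (word_g (outer nss) (word_f (concat nss) w))"
    "wdeg (word_g (outer nss) (word_f (concat nss) w)) = wdeg w + int (sum_list Ns)"
    using word_g_ok[OF 1(1) l'] 1(2) sum_refinements[OF assms(1)] by auto
  show "length (word_g (outer nss) (word_f (concat nss) w)) = length Ns"
    using length_refinements[OF assms(1)] by simp
qed

text \<open>Later maps of \<open>g\<close> pass outputs of \<open>f\<close> instead of letters of
  \<open>w\<close>; their degree is higher by \<open>sum_list ns\<close>, and this excess is the
  source of \<open>crossing\<close>.\<close>

lemma refinement_word_Cons:
  assumes ns: "ns \<in> refine N" and w: "width ns \<le> length w"
  defines "w1 \<equiv> take (width ns) w" and "w2 \<equiv> drop (width ns) w"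
  assumes ok: "word_ok A w"
  shows "word_g (outer (ns # nss)) (word_f (concat (ns # nss)) w)
    = (wdeg w1 + int N, g (length ns - 1) (wdeg w1 + int (sum_list ns)) (pure_tensor K B (word_f ns w1)))
      # word_g (outer nss) (word_f (concat nss) w2)"
    and "koszul (factors_g (outer (ns # nss))) (word_f (concat (ns # nss)) w)
      = int (sum_list (outer nss)) * (wdeg w1 + int (sum_list ns)) + koszul (factors_g (outer nss)) (word_f (concat nss) w2)"
proof -
  have len: "length ns = Suc (length ns - 1)" using ns by (auto simp: refine_def)
  have app: "word_f (concat (ns # nss)) w = word_f ns w1 @ word_f (concat nss) w2"
    using tensor_word_append[of "factors_f ns" w K A "factors_f (concat nss)"] w by (simp add: w1_def w2_def)
  have tk: "take (Suc (length ns - 1)) (word_f ns w1 @ word_f (concat nss) w2) = word_f ns w1"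
    and dr: "drop (Suc (length ns - 1)) (word_f ns w1 @ word_f (concat nss) w2) = word_f (concat nss) w2"
    unfolding len[symmetric] by simp_all
  have "word_ok A w1" "length w1 = width ns" using ok w by (auto simp: w1_def dest: in_set_takeD)
  then have deg: "wdeg (word_f ns w1) = wdeg w1 + int (sum_list ns)" by (rule word_f_ok)
  have N: "int N = int (length ns - 1) + int (sum_list ns)" using refine_sum[OF ns] by simp
  have mf: "mor_factor g (length ns - 1) = (Suc (length ns - 1), int (length ns - 1), g (length ns - 1))"
    by (simp add: mor_factor_def)
  show "word_g (outer (ns # nss)) (word_f (concat (ns # nss)) w)
    = (wdeg w1 + int N, g (length ns - 1) (wdeg w1 + int (sum_list ns)) (pure_tensor K B (word_f ns w1)))
      # word_g (outer nss) (word_f (concat nss) w2)"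
    unfolding app list.map mf tensor_word.simps tk dr deg N by simp
  show "koszul (factors_g (outer (ns # nss))) (word_f (concat (ns # nss)) w)
      = int (sum_list (outer nss)) * (wdeg w1 + int (sum_list ns)) + koszul (factors_g (outer nss)) (word_f (concat nss) w2)"
    unfolding app list.map mf koszul.simps tk dr deg fdeg_mor_factor ..
qed

text \<open>Past the inputs of the first factor move the later maps of \<open>f\<close> and of
  \<open>g\<close>, of total degree \<open>sum_list Ns\<close> as in the composite. What remains is
  the degree of later maps of \<open>g\<close> times that of the first maps of \<open>f\<close>. The
  epsilons are subtracted because \<open>refinement_sign\<close> contains them.\<close>

lemma koszul_refinement:
  assumes "nss \<in> refinements Ns" "word_ok A w" "length w = width Ns"
  shows "koszul (factors_f (concat nss)) w + koszul (factors_g (outer nss)) (word_f (concat nss) w)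
    = koszul (factors_gf Ns) w + refinement_sign f nss w - (\<Sum>ns\<leftarrow>nss. ainf_eps ns) + int (crossing nss)"
  using assms
proof (induction Ns arbitrary: nss w)
  case (Cons N Ns)
  from Cons.prems(1) obtain ns nss' where nss: "nss = ns # nss'" "ns \<in> refine N" "nss' \<in> refinements Ns"
    and ns: "ns \<noteq> []" "width ns = Suc N"
    by (rule refinements_ConsE)
  let ?w1 = "take (width ns) w" and ?w2 = "drop (width ns) w"
  have le: "width ns \<le> length w" using Cons.prems(3) ns by simp
  have IH: "koszul (factors_f (concat nss')) ?w2 + koszul (factors_g (outer nss')) (word_f (concat nss') ?w2)
    = koszul (factors_gf Ns) ?w2 + refinement_sign f nss' ?w2 - (\<Sum>ns\<leftarrow>nss'. ainf_eps ns) + int (crossing nss')"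
    using Cons.prems ns by (intro Cons.IH nss(3)) (auto dest: in_set_dropD)
  have 1: "koszul (factors_f (concat nss)) w
      = koszul (factors_f ns) ?w1 + koszul (factors_f (concat nss')) ?w2 + int (sum_list (concat nss')) * wdeg ?w1"
    using koszul_append[of "factors_f ns" w "factors_f (concat nss')"] le
    unfolding nss(1) concat.simps map_append arity_mor_factor fdeg_mor_factor by blast
  have 2: "koszul (factors_gf (N # Ns)) w = int (sum_list Ns) * wdeg ?w1 + koszul (factors_gf Ns) ?w2"
    using koszul_append[of "factors_gf [N]" w "factors_gf Ns"] le ns(2)
    unfolding arity_mor_factor fdeg_mor_factor by (simp add: mor_factor_def)
  have 3: "int (sum_list Ns) = int (sum_list (outer nss')) + int (sum_list (concat nss'))"
    using sum_refinements[OF nss(3)] by simp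
  show ?case
    using IH refinement_word_Cons(2)[OF nss(2) le Cons.prems(2), of nss'] 1 2 3
    by (simp add: nss(1) algebra_simps)
qed simp

text \<open>The prefix \<open>z\<close> holds the letters already expanded. Linearity in the next
  slot expands one more factor, and the induction hypothesis is applied with the chosen term
  appended to the prefix.\<close>

lemma pure_tensor_expand:
  assumes "word_ok A w" "length w = width Ns" "word_ok C z"
    and "n = length z + length Ns" "m = wdeg z + wdeg w + int (sum_list Ns)"
  defines "N \<equiv> tensor_power K C n m"
  shows "pure_tensor K C (z @ word_gf Ns w)
    = (\<Oplus>\<^bsub>N\<^esub>nss\<in>refinements Ns. signed N (refinement_sign f nss w)
        (pure_tensor K C (z @ word_g (outer nss) (word_f (concat nss) w))))"
proof -
  have N: "module K N" unfolding N_def by (rule module_tensor_power[OF K C])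
  interpret N: abelian_monoid N by (rule module_abelian_monoid[OF N])
  show ?thesis using assms(1-5)
  proof (induction Ns arbitrary: w z)
    case Nil
    then have "pure_tensor K C z \<in> carrier N"
      unfolding N_def by (intro pure_tensor_closed[OF K C]) (auto simp: words_iff)
    then show ?case using Nil by (simp add: signed_0)
  next
    case (Cons L Ns)
    define w1 w2 where "w1 = take (Suc L) w" and "w2 = drop (Suc L) w"
    have w1: "word_ok A w1" "length w1 = Suc L" and w2: "word_ok A w2" "length w2 = width Ns"
      using Cons.prems by (auto simp: w1_def w2_def dest: in_set_takeD in_set_dropD)
    have deg: "wdeg w = wdeg w1 + wdeg w2" by (simp add: w1_def w2_def wdeg_take_drop)
    let ?D = "wdeg w1 + int L" and ?X = "pure_tensor K A w1"
    let ?y = "\<lambda>ns. comp_term ns (wdeg w1) ?X"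
    let ?s = "\<lambda>ns. ainf_eps ns + koszul (factors_f ns) w1"
    let ?x = "\<lambda>ns. g (length ns - 1) (wdeg w1 + int (sum_list ns)) (pure_tensor K B (word_f ns w1))"
    have X: "?X \<in> carrier (tensor_power K A (Suc L) (wdeg w1))"
      using w1 by (intro pure_tensor_closed[OF K A]) (auto simp: words_iff)
    have y: "?y ns = signed (C ?D) (koszul (factors_f ns) w1) (?x ns)" and x: "?x ns \<in> carrier (C ?D)"
      if ns: "ns \<in> refine L" for ns
    proof -
      have len: "length ns = Suc (length ns - 1)" "width ns = Suc L" using ns by (auto simp: refine_def)
      have P: "pure_tensor K B (word_f ns w1) \<in> carrier (tensor_power K B (Suc (length ns - 1)) (wdeg w1 + int (sum_list ns)))"
        using word_f_ok[of w1 ns] w1 len by (intro pure_tensor_closed[OF K B]) (auto simp: words_iff)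
      have D: "wdeg w1 + int (sum_list ns) + int (length ns - 1) = ?D" using refine_sum[OF ns] by simp
      have "tensor_map K A B (factors_f ns) (wdeg w1) ?X
          = signed (tensor_power K B (Suc (length ns - 1)) (wdeg w1 + int (sum_list ns)))
              (koszul (factors_f ns) w1) (pure_tensor K B (word_f ns w1))"
        using tensor_map_pure_tensor[OF K A B linear_mor_factors[OF f], of w1 ns "wdeg w1"] w1 len
        unfolding arity_mor_factor fdeg_mor_factor length_map by (simp add: words_iff)
      then show "?y ns = signed (C ?D) (koszul (factors_f ns) w1) (?x ns)"
        unfolding comp_term_def using lin_maps_signed[OF g_lin module_tensor_power[OF K B] C P, unfolded D] by simp
      show "?x ns \<in> carrier (C ?D)" using lin_maps_closed[OF g_lin P, unfolded D] by simp
    qed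
    have letter: "ainf_comp K A B C g f L (wdeg w1) ?X = (\<Oplus>\<^bsub>C ?D\<^esub>ns\<in>refine L. signed (C ?D) (?s ns) (?x ns))"
      unfolding ainf_comp_refine[OF X]
    proof (rule finsum_cong_mod[OF C refl])
      fix ns assume ns: "ns \<in> refine L"
      show "signed (C ?D) (?s ns) (?x ns) \<in> carrier (C ?D)" by (rule signed_closed[OF C x[OF ns]])
      show "signed (C ?D) (ainf_eps ns) (?y ns) = signed (C ?D) (?s ns) (?x ns)"
        unfolding y[OF ns] by (rule signed_signed[OF C x[OF ns]])
    qed
    have tail: "word_ok C (word_gf Ns w2)" "wdeg (word_gf Ns w2) = wdeg w2 + int (sum_list Ns)"
      using tensor_word_ok[OF K A C linear_mor_factors[OF linear_maps_ainf_comp], of w2 Ns] w2 by auto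
    have lin: "(\<lambda>a. pure_tensor K C (z @ (?D, a) # word_gf Ns w2)) \<in> lin_maps K (C ?D) N"
      unfolding N_def using Cons.prems tail deg by (intro pure_tensor_letter_lin_maps[OF K C]) auto
    let ?W = "\<lambda>nss. word_g (outer nss) (word_f (concat nss) w2)"
    let ?T = "\<lambda>ns nss. signed N (?s ns + refinement_sign f nss w2)
        (pure_tensor K C ((z @ [(?D, ?x ns)]) @ ?W nss))"
    have T: "pure_tensor K C ((z @ [(?D, ?x ns)]) @ ?W nss) \<in> carrier N"
      if "ns \<in> refine L" "nss \<in> refinements Ns" for ns nss
      unfolding N_def
      using refinement_words[OF that(2) w2] x[OF that(1)] Cons.prems deg
      by (intro pure_tensor_closed[OF K C]) (auto simp: words_iff)
    have "word_gf (L # Ns) w = (?D, ainf_comp K A B C g f L (wdeg w1) ?X) # word_gf Ns w2"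
      by (simp add: mor_factor_def w1_def w2_def)
    then have "pure_tensor K C (z @ word_gf (L # Ns) w)
        = pure_tensor K C (z @ (?D, \<Oplus>\<^bsub>C ?D\<^esub>ns\<in>refine L. signed (C ?D) (?s ns) (?x ns)) # word_gf Ns w2)"
      by (simp add: letter)
    also have "\<dots> = (\<Oplus>\<^bsub>N\<^esub>ns\<in>refine L. pure_tensor K C (z @ (?D, signed (C ?D) (?s ns) (?x ns)) # word_gf Ns w2))"
      by (rule lin_maps_finsum[OF lin C N]) (use x signed_closed[OF C] in auto)
    also have "\<dots> = (\<Oplus>\<^bsub>N\<^esub>ns\<in>refine L. \<Oplus>\<^bsub>N\<^esub>nss\<in>refinements Ns. ?T ns nss)"
    proof (rule finsum_cong_mod[OF N refl])
      fix ns assume ns: "ns \<in> refine L"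
      show "(\<Oplus>\<^bsub>N\<^esub>nss\<in>refinements Ns. ?T ns nss) \<in> carrier N"
        using T[OF ns] signed_closed[OF N] by (intro N.finsum_closed) auto
      have "pure_tensor K C (z @ (?D, signed (C ?D) (?s ns) (?x ns)) # word_gf Ns w2)
          = signed N (?s ns) (pure_tensor K C ((z @ [(?D, ?x ns)]) @ word_gf Ns w2))"
        using lin_maps_signed[OF lin C N x[OF ns]] by simp
      also have "pure_tensor K C ((z @ [(?D, ?x ns)]) @ word_gf Ns w2)
          = (\<Oplus>\<^bsub>N\<^esub>nss\<in>refinements Ns. signed N (refinement_sign f nss w2)
              (pure_tensor K C ((z @ [(?D, ?x ns)]) @ ?W nss)))"
        using x[OF ns] w2 Cons.prems deg by (intro Cons.IH) auto
      also have "signed N (?s ns) \<dots> = (\<Oplus>\<^bsub>N\<^esub>nss\<in>refinements Ns. ?T ns nss)"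
        by (rule signed_finsum_signed[OF N T[OF ns]])
      finally show "pure_tensor K C (z @ (?D, signed (C ?D) (?s ns) (?x ns)) # word_gf Ns w2)
          = (\<Oplus>\<^bsub>N\<^esub>nss\<in>refinements Ns. ?T ns nss)" .
    qed
    also have "\<dots> = (\<Oplus>\<^bsub>N\<^esub>p\<in>refine L \<times> refinements Ns. ?T (fst p) (snd p))"
      using T signed_closed[OF N] by (intro N.finsum_Sigma finite_refine finite_refinements) auto
    also have "\<dots> = (\<Oplus>\<^bsub>N\<^esub>p\<in>refine L \<times> refinements Ns.
        signed N (refinement_sign f (fst p # snd p) w)
          (pure_tensor K C (z @ word_g (outer (fst p # snd p)) (word_f (concat (fst p # snd p)) w))))"
    proof (rule finsum_cong_mod[OF N refl])
      fix p assume "p \<in> refine L \<times> refinements Ns"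
      then have p: "fst p \<in> refine L" "snd p \<in> refinements Ns" by auto
      have wd: "width (fst p) = Suc L" using p(1) by (simp add: refine_def)
      have le: "width (fst p) \<le> length w" using Cons.prems wd by simp
      have e1: "word_g (outer (fst p # snd p)) (word_f (concat (fst p # snd p)) w)
          = (?D, ?x (fst p)) # ?W (snd p)"
        using refinement_word_Cons(1)[OF p(1) le Cons.prems(1), of "snd p"] unfolding wd w1_def w2_def .
      have e2: "refinement_sign f (fst p # snd p) w = ?s (fst p) + refinement_sign f (snd p) w2"
        unfolding refinement_sign.simps wd w1_def w2_def ..
      show eq: "?T (fst p) (snd p) = signed N (refinement_sign f (fst p # snd p) w)
          (pure_tensor K C (z @ word_g (outer (fst p # snd p)) (word_f (concat (fst p # snd p)) w)))"
        unfolding e1 e2 by simp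
      show "signed N (refinement_sign f (fst p # snd p) w)
          (pure_tensor K C (z @ word_g (outer (fst p # snd p)) (word_f (concat (fst p # snd p)) w))) \<in> carrier N"
        unfolding eq[symmetric] by (rule signed_closed[OF N T[OF p]])
    qed
    also have "\<dots> = (\<Oplus>\<^bsub>N\<^esub>nss\<in>refinements (L # Ns). signed N (refinement_sign f nss w)
        (pure_tensor K C (z @ word_g (outer nss) (word_f (concat nss) w))))"
    proof (rule N.finsum_reindex_bij[OF refinements_Cons_bij, symmetric])
      fix nss assume nss: "nss \<in> refinements (L # Ns)"
      then have "pure_tensor K C (z @ word_g (outer nss) (word_f (concat nss) w)) \<in> carrier N"
        unfolding N_def using refinement_words[OF nss Cons.prems(1,2)] Cons.prems
        by (intro pure_tensor_closed[OF K C]) (auto simp: words_iff)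
      then show "signed N (refinement_sign f nss w)
          (pure_tensor K C (z @ word_g (outer nss) (word_f (concat nss) w))) \<in> carrier N"
        by (rule signed_closed[OF N])
    qed
    finally show ?case .
  qed
qed

lemma induced_ainf_comp_joins:
  assumes n: "width Ns = n" and X: "X \<in> carrier (tensor_power K A n q)"
  shows "induced K A C (ainf_comp K A B C g f) n q (joins 0 Ns) X
    = family_comp (tensor_power K C) (induced K B C g) (induced K A B f) n q (joins 0 Ns) X"
proof -
  define M where "M = tensor_power K C (length Ns) (q + int (sum_list Ns))"
  have M: "module K M" unfolding M_def by (rule module_tensor_power[OF K C])
  interpret M: abelian_monoid M by (rule module_abelian_monoid[OF M])
  have n_diff: "n - sum_list Ns = length Ns" using n by (simp add: width_eq)
  define h where "h nss X = tensor_map K B C (factors_g (outer nss)) (q + int (sum_list (concat nss)))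
      (tensor_map K A B (factors_f (concat nss)) q X)" for nss X
  \<comment> \<open>The total exponent of a term: the shuffle, then the sign of \<open>g\<close>
    evaluated in the raised degree, then the sign of \<open>f\<close> in degree
    \<open>q\<close>.\<close>
  define E where "E nss = int (inv_all nss)
      + (int (sum_list (outer nss)) * (q + int (sum_list (concat nss)) - 1) + int (pairsum (outer nss))
      + (int (sum_list (concat nss)) * (q - 1) + int (pairsum (concat nss))))" for nss
  have tf: "tensor_map K A B (factors_f (concat nss)) q \<in> lin_maps K (tensor_power K A n q)
        (tensor_power K B (length (concat nss)) (q + int (sum_list (concat nss))))"
    and tg: "tensor_map K B C (factors_g (outer nss)) (q + int (sum_list (concat nss)))
      \<in> lin_maps K (tensor_power K B (length (concat nss)) (q + int (sum_list (concat nss)))) M"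
    if nss: "nss \<in> refinements Ns" for nss
    using width_refinements[OF nss] width_outer[OF nss] length_refinements[OF nss]
      sum_refinements[OF nss] n unfolding M_def
    by (intro tensor_map_mor_lin_maps[OF K A B f] tensor_map_mor_lin_maps[OF K B C g]; simp)+
  have h: "h nss \<in> lin_maps K (tensor_power K A n q) M" if "nss \<in> refinements Ns" for nss
    unfolding h_def[abs_def] by (rule lin_maps_comp[OF tf[OF that] tg[OF that]])
  define t where "t T = induced K B C g (n - card T) (q + int (card T))
      (map (\<lambda>s. s - count_less s (slist T)) (slist (set (joins 0 Ns) - T)))
      (induced K A B f n q (slist T) X)" for T
  have t: "t (set (joins 0 (concat nss)))
      = signed M (E nss - int (inv_all nss)) (h nss X)" if nss: "nss \<in> refinements Ns" for nss
  proof -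
    let ?T = "set (joins 0 (concat nss))"
    note l = refinement_lists[OF nss, of 0]
    have w: "width (concat nss) = n" using width_refinements[OF nss] n by simp
    have len: "n - sum_list (concat nss) = length (concat nss)" using w by (simp add: width_eq)
    note w' = width_outer[OF nss]
    have d: "length (concat nss) - sum_list (outer nss) = length Ns"
      using n_diff sum_refinements[OF nss] len by simp
    have deg: "q + int (sum_list (concat nss)) + int (sum_list (outer nss)) = q + int (sum_list Ns)"
      using sum_refinements[OF nss] by simp
    have S: "map (\<lambda>s. s - count_less s (joins 0 (concat nss))) (all_seps 0 nss) = joins 0 (outer nss)"
      using all_seps_counts(1)[OF nss, of 0 0] by simp
    have "t ?T = signed M (int (sum_list (outer nss)) * (q + int (sum_list (concat nss)) - 1) + int (pairsum (outer nss)))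
        (tensor_map K B C (factors_g (outer nss)) (q + int (sum_list (concat nss)))
          (signed (tensor_power K B (length (concat nss)) (q + int (sum_list (concat nss))))
            (int (sum_list (concat nss)) * (q - 1) + int (pairsum (concat nss)))
            (tensor_map K A B (factors_f (concat nss)) q X)))"
      unfolding t_def l S induced_joins[OF w] induced_joins[OF w'] d deg M_def[symmetric] len ..
    also have "\<dots> = signed M (E nss - int (inv_all nss)) (h nss X)"
      unfolding lin_maps_signed[OF tg[OF nss] module_tensor_power[OF K B] M lin_maps_closed[OF tf[OF nss] X]]
        h_def[symmetric] signed_signed[OF M lin_maps_closed[OF h[OF nss] X]]
      by (simp add: E_def)
    finally show ?thesis .
  qed
  have cl: "t T \<in> carrier M" if "T \<subseteq> set (joins 0 Ns)" for T
  proof -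
    \<comment> \<open>Each subset comes from a refinement, so its summand is a signed value of
      \<open>h\<close> and thus lies in the carrier.\<close>
    have "T \<in> (\<lambda>nss. set (joins 0 (concat nss))) ` refinements Ns"
      unfolding bij_betw_imp_surj_on[OF refinements_bij] using that by (rule PowI)
    then show ?thesis
    proof (rule imageE)
      fix nss assume T: "T = set (joins 0 (concat nss))" and nss: "nss \<in> refinements Ns"
      show ?thesis unfolding T t[OF nss] by (rule signed_closed[OF M lin_maps_closed[OF h[OF nss] X]])
    qed
  qed
  let ?v = "\<lambda>X. \<Oplus>\<^bsub>M\<^esub>nss\<in>refinements Ns. signed M (E nss) (h nss X)"
  have "family_comp (tensor_power K C) (induced K B C g) (induced K A B f) n q (joins 0 Ns) X
      = (\<Oplus>\<^bsub>M\<^esub>T\<in>Pow (set (joins 0 Ns)).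
          signed M (int (inversions (slist (set (joins 0 Ns) - T) @ slist T))) (t T))"
    using family_comp_shuffles[where Z = "tensor_power K C" and G = "induced K B C g" and q = q
        and F = "induced K A B f" and x = X and n = n, OF sorted_joins[of 0 Ns]] M cl n_diff
    unfolding t_def M_def by simp
  also have "\<dots> = (\<Oplus>\<^bsub>M\<^esub>nss\<in>refinements Ns.
      signed M (int (inversions (slist (set (joins 0 Ns) - set (joins 0 (concat nss)))
        @ slist (set (joins 0 (concat nss)))))) (t (set (joins 0 (concat nss)))))"
    by (rule M.finsum_reindex_bij[OF refinements_bij]) (use cl signed_closed[OF M] in auto)
  also have "\<dots> = ?v X"
  proof (rule finsum_cong_mod[OF M refl])
    fix nss assume nss: "nss \<in> refinements Ns"
    note hc = lin_maps_closed[OF h[OF nss] X]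
    show "signed M (E nss) (h nss X) \<in> carrier M" by (rule signed_closed[OF M hc])
    show "signed M (int (inversions (slist (set (joins 0 Ns) - set (joins 0 (concat nss)))
        @ slist (set (joins 0 (concat nss)))))) (t (set (joins 0 (concat nss)))) = signed M (E nss) (h nss X)"
      unfolding refinement_lists[OF nss, of 0] inversions_refinement[OF nss] t[OF nss] signed_signed[OF M hc]
      by simp
  qed
  finally have rhs: "family_comp (tensor_power K C) (induced K B C g) (induced K A B f) n q (joins 0 Ns) X = ?v X" .
  let ?e = "int (sum_list Ns) * (q - 1) + int (pairsum Ns)"
  let ?u = "\<lambda>X. signed M ?e (tensor_map K A C (factors_gf Ns) q X)"
  have lhs: "induced K A C (ainf_comp K A B C g f) n q (joins 0 Ns) X = ?u X"
    unfolding induced_joins[OF n] n_diff M_def ..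
  have "?u X = ?v X"
  proof (rule tensor_power_eqI[OF K A M _ _ _ X])
    have "tensor_map K A C (factors_gf Ns) q \<in> lin_maps K (tensor_power K A n q) M"
      unfolding M_def using n by (intro tensor_map_mor_lin_maps[OF K A C linear_maps_ainf_comp]) auto
    then show "?u \<in> lin_maps K (tensor_power K A n q) M"
      by (rule lin_maps_comp[OF _ signed_lin_maps[OF M]])
    show "?v \<in> lin_maps K (tensor_power K A n q) M"
      by (intro finsum_lin_maps[OF M finite_refinements] lin_maps_comp[OF h signed_lin_maps[OF M]])
    fix w assume w: "w \<in> words A n q"
    then have ok: "word_ok A w" "length w = width Ns" "wdeg w = q" using n by (auto simp: words_iff)
    let ?P = "\<lambda>nss. pure_tensor K C (word_g (outer nss) (word_f (concat nss) w))"
    have P: "?P nss \<in> carrier M" if "nss \<in> refinements Ns" for nss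
      unfolding M_def using refinement_words[OF that ok(1,2)] ok(3)
      by (intro pure_tensor_closed[OF K C]) (auto simp: words_iff)
    have "tensor_map K A C (factors_gf Ns) q (pure_tensor K A w)
        = signed M (koszul (factors_gf Ns) w) (pure_tensor K C ([] @ word_gf Ns w))"
      using tensor_map_pure_tensor[OF K A C linear_mor_factors[OF linear_maps_ainf_comp], of w Ns q] w n
      unfolding arity_mor_factor fdeg_mor_factor length_map M_def by simp
    also have "pure_tensor K C ([] @ word_gf Ns w)
        = (\<Oplus>\<^bsub>M\<^esub>nss\<in>refinements Ns. signed M (refinement_sign f nss w) (?P nss))"
      unfolding M_def using pure_tensor_expand[OF ok(1,2), of "[]" "length Ns" "q + int (sum_list Ns)"] ok(3)
      by simp
    finally have "?u (pure_tensor K A w) = signed M (?e + koszul (factors_gf Ns) w)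
        (\<Oplus>\<^bsub>M\<^esub>nss\<in>refinements Ns. signed M (refinement_sign f nss w) (?P nss))"
      using P signed_closed[OF M] by (simp add: signed_signed[OF M] M.finsum_closed Pi_iff)
    also have "\<dots> = (\<Oplus>\<^bsub>M\<^esub>nss\<in>refinements Ns.
        signed M (?e + koszul (factors_gf Ns) w + refinement_sign f nss w) (?P nss))"
      by (rule signed_finsum_signed[OF M P])
    also have "\<dots> = ?v (pure_tensor K A w)"
    proof (rule finsum_cong_mod[OF M refl])
      fix nss assume nss: "nss \<in> refinements Ns"
      have wX: "pure_tensor K A w \<in> carrier (tensor_power K A n q)"
        using w by (rule pure_tensor_closed[OF K A])
      show "signed M (E nss) (h nss (pure_tensor K A w)) \<in> carrier M"
        by (rule signed_closed[OF M lin_maps_closed[OF h[OF nss] wX]])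
      let ?w = "word_f (concat nss) w" and ?t = "sum_list (concat nss)"
      have wc: "width (concat nss) = n" using width_refinements[OF nss] n by simp
      have wB: "?w \<in> words B (length (concat nss)) (q + int ?t)"
        using word_f_ok[OF ok(1), of "concat nss"] ok wc n by (auto simp: words_iff)
      then have pB: "pure_tensor K B ?w \<in> carrier (tensor_power K B (length (concat nss)) (q + int ?t))"
        by (rule pure_tensor_closed[OF K B])
      have "tensor_map K A B (factors_f (concat nss)) q (pure_tensor K A w)
          = signed (tensor_power K B (length (concat nss)) (q + int ?t)) (koszul (factors_f (concat nss)) w)
              (pure_tensor K B ?w)"
        using tensor_map_pure_tensor[OF K A B linear_mor_factors[OF f], of w "concat nss" q] w wc
        unfolding arity_mor_factor fdeg_mor_factor length_map by simp
      then have "h nss (pure_tensor K A w) = signed M (koszul (factors_f (concat nss)) w)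
          (tensor_map K B C (factors_g (outer nss)) (q + int ?t) (pure_tensor K B ?w))"
        unfolding h_def using lin_maps_signed[OF tg[OF nss] module_tensor_power[OF K B] M pB] by simp
      also have "tensor_map K B C (factors_g (outer nss)) (q + int ?t) (pure_tensor K B ?w)
          = signed M (koszul (factors_g (outer nss)) ?w) (?P nss)"
      proof -
        have deg: "q + int ?t + int (sum_list (outer nss)) = q + int (sum_list Ns)"
          using sum_refinements[OF nss] by simp
        show ?thesis
          by (rule tensor_map_pure_tensor[OF K B C linear_mor_factors[OF g], of ?w "outer nss" "q + int ?t",
                unfolded arity_mor_factor fdeg_mor_factor length_map width_outer[OF nss]
                  length_refinements[OF nss] deg, OF wB, folded M_def])
      qed
      finally have hw: "h nss (pure_tensor K A w)
          = signed M (koszul (factors_f (concat nss)) w + koszul (factors_g (outer nss)) ?w) (?P nss)"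
        unfolding signed_signed[OF M P[OF nss]] .
      \<comment> \<open>The multiples of \<open>q - 1\<close> cancel since the degrees of both
        layers add up to \<open>sum_list Ns\<close>; only the product of the two sums is left of
        them.\<close>
      have eq: "?e + koszul (factors_gf Ns) w + refinement_sign f nss w
          - (E nss + (koszul (factors_f (concat nss)) w + koszul (factors_g (outer nss)) ?w))
        = int (pairsum Ns) + (\<Sum>ns\<leftarrow>nss. ainf_eps ns)
          - int (inv_all nss + sum_list (outer nss) * sum_list (concat nss) + pairsum (outer nss)
            + pairsum (concat nss) + crossing nss)"
        unfolding koszul_refinement[OF nss ok(1,2)] sum_refinements[OF nss] E_def
        by (simp add: algebra_simps)
      have "even (?e + koszul (factors_gf Ns) w + refinement_sign f nss w
          - (E nss + (koszul (factors_f (concat nss)) w + koszul (factors_g (outer nss)) ?w)))"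
        unfolding eq by (rule sign_parity[OF nss])
      then show "signed M (?e + koszul (factors_gf Ns) w + refinement_sign f nss w) (?P nss)
          = signed M (E nss) (h nss (pure_tensor K A w))"
        unfolding hw signed_signed[OF M P[OF nss]] by (rule signed_cong)
    qed
    finally show "?u (pure_tensor K A w) = ?v (pure_tensor K A w)" .
  qed
  then show ?thesis using lhs rhs by simp
qed

text \<open>A boundary entry in \<open>T\<close> makes the value of \<open>f\<close> zero, and
  \<open>g\<close> maps zero to zero. Otherwise that entry stays at the boundary when lowered and
  makes the component of \<open>g\<close> zero.\<close>

lemma family_comp_boundary:
  assumes I: "sorted_wrt (<) I" "\<forall>i\<in>set I. i \<le> n" and bd: "0 \<in> set I \<or> n \<in> set I"
    and X: "X \<in> carrier (tensor_power K A n q)"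
  shows "family_comp (tensor_power K C) (induced K B C g) (induced K A B f) n q I X
    = \<zero>\<^bsub>tensor_power K C (n - length I) (q + int (length I))\<^esub>"
proof -
  define M where "M = tensor_power K C (n - length I) (q + int (length I))"
  have M: "module K M" unfolding M_def by (rule module_tensor_power[OF K C])
  interpret M: abelian_monoid M by (rule module_abelian_monoid[OF M])
  define J where "J T = map (\<lambda>s. s - count_less s (slist T)) (slist (set I - T))" for T
  define t where "t T = induced K B C g (n - card T) (q + int (card T)) (J T)
      (induced K A B f n q (slist T) X)" for T
  have t: "t T = \<zero>\<^bsub>M\<^esub>" if T: "T \<subseteq> set I" for T
  proof -
    have fin: "finite T" using T finite_subset by auto
    note J = shuffled_tuple[OF I T, folded J_def]
    have len: "length (slist T) = card T" by simp
    have Mi: "n - card T - length (J T) = n - length I"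
      "q + int (card T) + int (length (J T)) = q + int (length I)" using J(3) by auto
    show ?thesis
    proof (cases "0 \<in> T \<or> n \<in> T")
      case True
      have "\<forall>i\<in>set (slist T). i \<le> n" using I(2) T fin by auto
      then have "slist T \<noteq> [] \<and> (hd (slist T) = 0 \<or> last (slist T) = n)"
        using in_tuple_bounds[of "slist T" n] True fin by simp
      then have zero: "induced K A B f n q (slist T) X = \<zero>\<^bsub>tensor_power K B (n - card T) (q + int (card T))\<^esub>"
        by (auto simp: induced_def Let_def)
      have lin: "induced K B C g (n - card T) (q + int (card T)) (J T) \<in>
          lin_maps K (tensor_power K B (n - card T) (q + int (card T))) M"
        using induced_lin_maps[OF K B C g J(1,2) refl, of "q + int (card T)"] unfolding Mi M_def .
      show ?thesis
        unfolding t_def zero by (rule lin_maps_zero[OF lin module_tensor_power[OF K B] M])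
    next
      case False
      then have "0 \<in> set (J T) \<or> n - card T \<in> set (J T)" using bd J(4,5) by blast
      then have "J T \<noteq> [] \<and> (hd (J T) = 0 \<or> last (J T) = n - card T)"
        using in_tuple_bounds[OF J(1,2)] by simp
      then show ?thesis
        unfolding t_def induced_def Let_def Mi M_def by auto
    qed
  qed
  have "family_comp (tensor_power K C) (induced K B C g) (induced K A B f) n q I X
      = (\<Oplus>\<^bsub>M\<^esub>T\<in>Pow (set I). signed M (int (inversions (slist (set I - T) @ slist T))) (t T))"
    using family_comp_shuffles[where Z = "tensor_power K C" and G = "induced K B C g" and q = q
        and F = "induced K A B f" and x = X and n = n, OF I(1)] M t M.zero_closed
    unfolding t_def M_def J_def by simp
  also have "\<dots> = \<zero>\<^bsub>M\<^esub>"
    using t by (intro M.add.finprod_one_eqI) (simp add: signed_zero[OF M])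
  finally show ?thesis unfolding M_def .
qed

theorem induced_ainf_comp:
  assumes I: "index_tuple n I" and X: "X \<in> carrier (tensor_power K A n q)"
  shows "induced K A C (ainf_comp K A B C g f) n q I X
    = family_comp (tensor_power K C) (induced K B C g) (induced K A B f) n q I X"
proof (cases "0 \<in> set I \<or> n \<in> set I")
  case True
  have s: "sorted_wrt (<) I" "\<forall>i\<in>set I. i \<le> n" using I by (auto simp: index_tuple_def)
  then have "I \<noteq> [] \<and> (hd I = 0 \<or> last I = n)" using in_tuple_bounds True by blast
  then have "induced K A C (ainf_comp K A B C g f) n q I X
      = \<zero>\<^bsub>tensor_power K C (n - length I) (q + int (length I))\<^esub>"
    by (auto simp: induced_def Let_def)
  then show ?thesis using family_comp_boundary[OF s True X] by simp
next
  case False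
  have s: "sorted_wrt (<) I" using I by (simp add: index_tuple_def)
  have "0 < i \<and> i < n" if "i \<in> set I" for i
    using that I False unfolding index_tuple_def by (metis gr0I le_neq_implies_less)
  then have "set I \<subseteq> {0<..<n}" by auto
  then obtain Ns where "I = joins 0 Ns" "width Ns = n" using ex_joins[OF s] by blast
  then show ?thesis using induced_ainf_comp_joins X by simp
qed

end

theorem theorem3p3:
  fixes K :: "'k ring"
    and A :: "('k, 'a) graded" and d :: "int \<Rightarrow> 'a \<Rightarrow> 'a" and \<pi> :: "('k, 'a, 'a) maps"
    and A' :: "('k, 'b) graded" and d' :: "int \<Rightarrow> 'b \<Rightarrow> 'b" and \<pi>' :: "('k, 'b, 'b) maps"
    and A'' :: "('k, 'c) graded" and d'' :: "int \<Rightarrow> 'c \<Rightarrow> 'c" and \<pi>'' :: "('k, 'c, 'c) maps"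
    and f :: "('k, 'a, 'b) maps" and g :: "('k, 'b, 'c) maps"
  assumes "cring K"
    and "ainf_algebra K A d \<pi>"
    and "ainf_algebra K A' d' \<pi>'"
    and "ainf_algebra K A'' d'' \<pi>''"
    and "ainf_morphism K A d \<pi> A' d' \<pi>' f"
    and "ainf_morphism K A' d' \<pi>' A'' d'' \<pi>'' g"
  shows "\<forall>n q I. index_tuple n I \<longrightarrow>
           (\<forall>X\<in>carrier (tensor_power K A n q).
              induced K A A'' (ainf_comp K A A' A'' g f) n q I X
              = family_comp (tensor_power K A'') (induced K A' A'' g) (induced K A A' f) n q I X)"
proof -
  have "module K (A n)" "module K (A' n)" "module K (A'' n)" for n
    using assms(2-4) by (auto simp: ainf_algebra_def diff_graded_module_def graded_module_def)
  moreover have "linear_maps K A A' f" "linear_maps K A' A'' g"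
    using assms(5,6) by (auto simp: ainf_morphism_def linear_maps_def)
  ultimately show ?thesis
    using induced_ainf_comp[OF assms(1)] by blast
qed

end
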